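(* Let $\lambda=(\lambda_n)_{n\in\mathbb N}$ be a frequency such that $$\forall \delta>0\ \exists C>0\ \forall n\in\mathbb N\ \exists m>n:\quad \log\left(\frac{\lambda_m}{\lambda_m-\lambda_n}\right)+\sum_{j=n+1}^{m-1}\frac{\lambda_j-\lambda_n}{\varepsilon_j}\le C e^{\delta\lambda_n},$$ and let $k\ge 0$ be a real number. Then $\sigma^{\lambda,k}(D)\le 0$ for every $D\in\mathcal D^{\mathrm{ext}}_{\infty,k}(\lambda)$; that is, $D$ is $(\lambda,k)$-summable at every $s\in\mathbb C$ with $\operatorname{Re}s>0$.
   Context: $\mathbb N=\{1,2,\dots\}$ and $\mathbb C_\theta=\{s\in\mathbb C:\operatorname{Re}s>\theta\}$. A frequency is a strictly increasing sequence $\lambda=(\lambda_n)_{n\in\mathbb N}$ of non-negative reals tending to infinity. Put $\varepsilon_1=\min\{1,\lambda_2-\lambda_1\}$ and $\varepsilon_n=\min\{1,\lambda_n-\lambda_{n-1},\lambda_{n+1}-\lambda_n\}$ for $n\ge2$. Empty sums are $0$. $\mathcal D(\lambda)$ is the space of all formal $\lambda$-Dirichlet series $D=\sum_{n=1}^\infty a_n(D)e^{-\lambda_n s}$ with $a_n(D)\in\mathbb C$. For real $l\ge0$, $x>0$ and $s\in\mathbb C$ let $$R^{\lambda,l}_x(D)(s)=\sum_{\lambda_n\le x}a_n(D)\left(1-\frac{\lambda_n}{x}\right)^l e^{-\lambda_n s}$$ (with $0^0=1$). $D$ is $(\lambda,l)$-summable at $s$ if $\lim_{x\to\infty}R^{\lambda,l}_x(D)(s)$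 exists. Put $\sigma^{\lambda,l}(D)=\inf\{\sigma\in\mathbb R: D\text{ is }(\lambda,l)\text{-summable at }\sigma\}$ (infimum in $[-\infty,\infty]$). It is known that $(\lambda,l)$-summability at $s_0$ implies $(\lambda,l)$-summability on $\mathbb C_{\operatorname{Re}s_0}$ with holomorphic limit function, and that $(\lambda,l)$-summability implies $(\lambda,l')$-summability to the same limit for $l'\ge l$. For $k\ge0$, $\mathcal D^{\mathrm{ext}}_{\infty,k}(\lambda)$ is the space of all $D\in\mathcal D(\lambda)$ for which there is $l\ge0$ with $\sigma^{\lambda,l}(D)<\infty$ such that the limit function $f(s)=\lim_{x\to\infty}R^{\lambda,l}_x(D)(s)$, $s\in\mathbb C_{\sigma^{\lambda,l}(D)}$, has a holomorphic extension to $\mathbb C_0$, again denoted $f=f_D$ (it does not depend on $l$), satisfying $\sup_{s\in\mathbb C_0}|f_D(s)|/(1+|s|)^k<\infty$. *)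

theory Defs
  imports "HOL-Complex_Analysis.Complex_Analysis"
begin

text \<open>
  Sequences are indexed from 0: the frequency \<open>\<lambda>\<^sub>1 < \<lambda>\<^sub>2 < \<dots>\<close> is \<open>lam 0 < lam 1 < \<dots>\<close>. A formal
  \<open>\<lambda>\<close>-Dirichlet series is given by its coefficient sequence \<open>a :: nat \<Rightarrow> complex\<close>; the coefficients
  are arbitrary.
\<close>

definition frequency :: "(nat \<Rightarrow> real) \<Rightarrow> bool" where
  "frequency lam \<longleftrightarrow>
     strict_mono lam \<and> (\<forall>n. 0 \<le> lam n) \<and> filterlim lam at_top sequentially"

definition freq_gap :: "(nat \<Rightarrow> real) \<Rightarrow> nat \<Rightarrow> real" where
  "freq_gap lam n =
     (if n = 0 then min 1 (lam 1 - lam 0)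
      else Min {1, lam n - lam (n - 1), lam (n + 1) - lam n})"

definition half_plane :: "ereal \<Rightarrow> complex set" where
  "half_plane \<theta> = {s. \<theta> < ereal (Re s)}"

text \<open>
  For \<open>l = 0\<close> the weight is constantly 1; this case is separate because
  \<open>0 powr 0 = 0\<close>, whereas the convention here is \<open>0\<^sup>0 = 1\<close>.
\<close>

definition riesz_weight :: "(nat \<Rightarrow> real) \<Rightarrow> real \<Rightarrow> real \<Rightarrow> nat \<Rightarrow> real" where
  "riesz_weight lam l x n = (if l = 0 then 1 else (1 - lam n / x) powr l)"

definition riesz_mean ::
    "(nat \<Rightarrow> real) \<Rightarrow> real \<Rightarrow> (nat \<Rightarrow> complex) \<Rightarrow> real \<Rightarrow> complex \<Rightarrow> complex" where
  "riesz_mean lam l a x s =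
     (\<Sum>n | lam n \<le> x. a n * of_real (riesz_weight lam l x n) * exp (- of_real (lam n) * s))"

definition riesz_summable ::
    "(nat \<Rightarrow> real) \<Rightarrow> real \<Rightarrow> (nat \<Rightarrow> complex) \<Rightarrow> complex \<Rightarrow> bool" where
  "riesz_summable lam l a s \<longleftrightarrow> (\<exists>L. ((\<lambda>x. riesz_mean lam l a x s) \<longlongrightarrow> L) at_top)"

definition riesz_abscissa :: "(nat \<Rightarrow> real) \<Rightarrow> real \<Rightarrow> (nat \<Rightarrow> complex) \<Rightarrow> ereal" where
  "riesz_abscissa lam l a =
     Inf {ereal \<sigma> |\<sigma>. riesz_summable lam l a (complex_of_real \<sigma>)}"

text \<open>
  If the abscissa is negative, the limit function already lives on a half-plane larger than
  \<open>half_plane 0\<close>, and extending it there means restricting it; hence the intersection.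
\<close>

definition dirichlet_ext :: "real \<Rightarrow> (nat \<Rightarrow> real) \<Rightarrow> (nat \<Rightarrow> complex) set" where
  "dirichlet_ext k lam =
     {a. \<exists>l\<ge>0. riesz_abscissa lam l a < \<infinity> \<and>
        (\<exists>f. f holomorphic_on half_plane 0 \<and>
          (\<forall>s \<in> half_plane (riesz_abscissa lam l a) \<inter> half_plane 0.
             ((\<lambda>x. riesz_mean lam l a x s) \<longlongrightarrow> f s) at_top) \<and>
          bdd_above ((\<lambda>s. norm (f s) / (1 + norm s) powr k) ` half_plane 0))}"

end

theory Submission
  imports Defs "HOL-Probability.Characteristic_Functions" "HOL-Probability.Sinc_Integral"
    "HOL-Real_Asymp.Real_Asymp"
begin

text \<open>
  Let \<open>Re s0 > 0\<close>. Replacing \<open>a n\<close> by \<open>a n * exp (- lam n * s0)\<close> and \<open>f\<close> by its translate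
  \<open>f (s0 + s)\<close>, which is holomorphic and of growth \<open>(1 + |s|)\<^sup>k\<close> on \<open>Re s > - Re s0\<close>, one has to show that
  the Riesz means of order \<open>k\<close> at \<open>0\<close> converge to \<open>f 0\<close>. What the translation gains is room to the
  left of \<open>0\<close>: on the line \<open>Re s = - \<kappa>\<close> with \<open>\<kappa> = Re s0 / 2\<close> the kernel formula
  \<open>\<Sum>\<^sub>n a n \<psi> (lam n) = 1 / (2 \<pi>) \<integral> f (c + i t) \<Psi> (c + i t) dt\<close>, where
  \<open>\<Psi> s = \<integral> \<psi> v exp (v s) dv\<close> (\<open>perron_pairing\<close>), produces the factor \<open>exp (- \<kappa> y)\<close> for a kernel
  \<open>\<psi>\<close> located near \<open>y\<close>.

  The kernel formula holds for every compactly supported \<open>\<psi>\<close> of class \<open>C\<^sup>L\<close> with \<open>L\<close> large. Far to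
  the right it follows from Fourier inversion, because there \<open>f\<close> is the limit of Riesz means that
  grow at most polynomially along vertical lines, uniformly in \<open>x\<close>; these polynomials in \<open>|s|\<close> are
  absorbed by the decay of \<open>\<Psi>\<close>. Cauchy's theorem then moves the line. Two consequences are used. A bump of
  width \<open>h\<close> around \<open>y\<close> gives a sum of size \<open>O ((1 + 1 / h)\<^sup>k exp (- \<kappa> y))\<close> (\<open>local_mean_bound\<close>), so that
  in particular \<open>a n = O (\<epsilon>\<^sub>n powr - k exp (- \<kappa> lam n))\<close>, where \<open>\<epsilon>\<^sub>n\<close> is the gap at \<open>lam n\<close>; and a fixed smooth kernel,
  stretched by the factor \<open>x\<close>, gives sums tending to \<open>f 0\<close> times its value at \<open>0\<close> (\<open>smooth_mean_limit\<close>).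

  The kernel \<open>(1 - v / x)\<^sup>k\<close> on \<open>v \<le> x\<close> is smooth except at its endpoint \<open>x\<close>. Away from \<open>x\<close> it is a stretched
  smooth kernel, responsible for the limit \<open>f 0\<close>. The part at distance about \<open>h\<close> from
  \<open>x\<close> is, up to the factor \<open>(h / x)\<^sup>k\<close>, a bump of width \<open>h\<close>; the factor \<open>h\<^sup>k\<close> compensates \<open>h powr - k\<close>, so every dyadic
  scale contributes an exponentially small amount, and going down to distance \<open>\<tau>\<close> takes about
  \<open>log (x / \<tau>)\<close> scales. With \<open>B = C exp (\<delta> x)\<close> from the gap condition one can afford
  \<open>\<tau> \<approx> exp (- B)\<close>, as this costs only about \<open>B + x\<close> scales.

  The frequencies within about \<open>2 \<tau>\<close> of \<open>x\<close> remain. The logarithm in the gap condition at \<open>lam p\<close>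
  gives an \<open>m > p\<close> with \<open>lam m - lam p \<ge> 8 \<tau>\<close>, hence \<open>lam m > x\<close>; the sum in the condition bounds
  \<open>\<Sum> ((lam n - lam p) / \<epsilon>\<^sub>n)\<^sup>k\<close> over \<open>p < n < m\<close>, and thereby also the sum of \<open>|a n| (lam n - lam p)\<^sup>k\<close>. So a
  kernel may be altered at each \<open>lam n\<close> with \<open>p < n < m\<close> by \<open>O ((lam n - lam p)\<^sup>k)\<close>, but not at \<open>lam p\<close> or below
  (\<open>tail_bound\<close>). If some frequency lies between \<open>x - 2 \<tau>\<close> and \<open>x - \<tau>\<close>, it serves as \<open>lam p\<close>, and
  the Riesz kernel can be cut off between \<open>lam p\<close> and \<open>x\<close>. If there is none, let \<open>lam p\<close> be the first
  frequency that is at least \<open>x - \<tau>\<close>; to the right of the gap before \<open>lam p\<close> the kernel is replaced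
  by its Taylor polynomial of degree \<open>\<lfloor>k\<rfloor>\<close> at \<open>lam p\<close>, times a bump of width \<open>\<tau>\<close>. The
  error of this replacement is again \<open>O ((lam n - lam p)\<^sup>k)\<close>.
\<close>


section \<open>Functions of class \<open>C\<^sup>n\<close> and smooth cutoffs\<close>

text \<open>
  Iterating the total function \<open>deriv\<close> instead of asking for a chain of derivatives makes gluing
  along open sets immediate and determines the derivatives uniquely.
\<close>

primrec Ck :: "nat \<Rightarrow> real set \<Rightarrow> (real \<Rightarrow> real) \<Rightarrow> bool" where
  "Ck 0 S g \<longleftrightarrow> continuous_on S g"
| "Ck (Suc n) S g \<longleftrightarrow> (\<forall>x\<in>S. g field_differentiable at x) \<and> Ck n S (deriv g)"

lemma Ck_cong:
  assumes "open S" "\<And>x. x \<in> S \<Longrightarrow> u x = v x"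
  shows "Ck n S u = Ck n S v"
  using assms(2)
proof (induction n arbitrary: u v)
  case 0
  then show ?case by (simp cong: continuous_on_cong)
next
  case (Suc n)
  have ev: "eventually (\<lambda>y. u y = v y) (nhds x)" if "x \<in> S" for x
    using eventually_nhds_in_open[OF assms(1) that] by eventually_elim (use Suc.prems in auto)
  have 1: "u field_differentiable at x \<longleftrightarrow> v field_differentiable at x" if "x \<in> S" for x
    unfolding field_differentiable_def
    using DERIV_cong_ev[OF refl ev[OF that] refl] by blast
  have 2: "deriv u x = deriv v x" if "x \<in> S" for x
    using deriv_cong_ev[OF ev[OF that]] by simp
  show ?case
    using 1 Suc.IH[OF 2] by simp
qed

lemma Ck_SucI:
  assumes "open S" "\<And>x. x \<in> S \<Longrightarrow> (g has_real_derivative g' x) (at x)" "Ck n S g'"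
  shows "Ck (Suc n) S g"
proof -
  have "deriv g x = g' x" if "x \<in> S" for x
    using assms(2)[OF that] by (rule DERIV_imp_deriv)
  then have "Ck n S (deriv g) = Ck n S g'"
    by (intro Ck_cong assms(1)) auto
  then show ?thesis
    using assms(2,3) by (auto simp: field_differentiable_def)
qed

lemma Ck_SucD:
  assumes "Ck (Suc n) S g"
  shows "\<And>x. x \<in> S \<Longrightarrow> (g has_real_derivative deriv g x) (at x)" "Ck n S (deriv g)"
  using assms by (auto simp: DERIV_deriv_iff_field_differentiable)

lemma Ck_subset: "Ck n S g \<Longrightarrow> T \<subseteq> S \<Longrightarrow> Ck n T g"
  by (induction n arbitrary: g) (auto intro: continuous_on_subset)

lemma Ck_Suc_imp: "Ck (Suc n) S g \<Longrightarrow> Ck n S g"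
proof (induction n arbitrary: g)
  case 0
  then show ?case
    by (auto intro!: continuous_at_imp_continuous_on field_differentiable_imp_continuous_at)
qed simp

lemma Ck_le: "Ck n S g \<Longrightarrow> m \<le> n \<Longrightarrow> Ck m S g"
  by (induction n) (auto simp: le_Suc_eq dest: Ck_Suc_imp simp del: Ck.simps)

lemma Ck_imp_continuous: "Ck n S g \<Longrightarrow> continuous_on S g"
  using Ck_le[of n S g 0] by simp

lemma Ck_union: "open S \<Longrightarrow> open T \<Longrightarrow> Ck n S g \<Longrightarrow> Ck n T g \<Longrightarrow> Ck n (S \<union> T) g"
  by (induction n arbitrary: g) (auto intro: continuous_on_open_Un)

lemma Ck_const [simp]: "Ck n S (\<lambda>_. c)"
proof (induction n arbitrary: c)
  case (Suc n)
  have "deriv (\<lambda>_::real. c) = (\<lambda>_. 0)" by (auto simp: fun_eq_iff)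
  then show ?case using Suc by simp
qed simp

lemma Ck_ident [simp]: "Ck n S (\<lambda>x. x)"
proof (cases n)
  case (Suc m)
  have "deriv (\<lambda>x::real. x) = (\<lambda>_. 1)" by (auto simp: fun_eq_iff)
  then show ?thesis using Suc by simp
qed simp

lemma Ck_add: "open S \<Longrightarrow> Ck n S f \<Longrightarrow> Ck n S g \<Longrightarrow> Ck n S (\<lambda>x. f x + g x)"
proof (induction n arbitrary: f g)
  case 0 then show ?case by (auto intro: continuous_intros)
next
  case (Suc n)
  note d = Ck_SucD(1)[OF Suc.prems(2)] Ck_SucD(1)[OF Suc.prems(3)]
  show ?case
    by (rule Ck_SucI[OF \<open>open S\<close>, where g' = "\<lambda>x. deriv f x + deriv g x"])
       (use d Suc in \<open>auto intro!: derivative_eq_intros\<close>)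
qed

lemma Ck_mult: "open S \<Longrightarrow> Ck n S f \<Longrightarrow> Ck n S g \<Longrightarrow> Ck n S (\<lambda>x. f x * g x)"
proof (induction n arbitrary: f g)
  case 0 then show ?case by (auto intro: continuous_intros)
next
  case (Suc n)
  note d = Ck_SucD(1)[OF Suc.prems(2)] Ck_SucD(1)[OF Suc.prems(3)]
  show ?case
  proof (rule Ck_SucI[OF \<open>open S\<close>, where g' = "\<lambda>x. deriv f x * g x + deriv g x * f x"])
    show "Ck n S (\<lambda>x. deriv f x * g x + deriv g x * f x)"
      by (intro Ck_add Suc.IH \<open>open S\<close> Ck_SucD(2)[OF Suc.prems(2)] Ck_SucD(2)[OF Suc.prems(3)]
          Ck_Suc_imp[OF Suc.prems(2)] Ck_Suc_imp[OF Suc.prems(3)])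
  qed (use d in \<open>auto intro!: derivative_eq_intros\<close>)
qed

lemma Ck_cmult: "open S \<Longrightarrow> Ck n S f \<Longrightarrow> Ck n S (\<lambda>x. c * f x)"
  by (rule Ck_mult) auto

lemma Ck_diff: "open S \<Longrightarrow> Ck n S f \<Longrightarrow> Ck n S g \<Longrightarrow> Ck n S (\<lambda>x. f x - g x)"
  using Ck_add[of S n f "\<lambda>x. -1 * g x"] Ck_cmult[of S n g "-1"] by simp

lemma Ck_power: "open S \<Longrightarrow> Ck n S f \<Longrightarrow> Ck n S (\<lambda>x. f x ^ r)"
  by (induction r) (auto intro!: Ck_mult)

lemma Ck_inverse: "open S \<Longrightarrow> Ck n S f \<Longrightarrow> (\<And>x. x \<in> S \<Longrightarrow> f x \<noteq> 0) \<Longrightarrow> Ck n S (\<lambda>x. inverse (f x))"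
proof (induction n)
  case 0 then show ?case by (auto intro!: continuous_intros)
next
  case (Suc n)
  note d = Ck_SucD(1)[OF Suc.prems(2)]
  show ?case
  proof (rule Ck_SucI[OF \<open>open S\<close>, where g' = "\<lambda>x. -1 * (inverse (f x) * deriv f x * inverse (f x))"])
    show "Ck n S (\<lambda>x. -1 * (inverse (f x) * deriv f x * inverse (f x)))"
      using Suc.IH[OF Suc.prems(1) Ck_Suc_imp[OF Suc.prems(2)] Suc.prems(3)] Suc.prems
      by (intro Ck_cmult Ck_mult Ck_SucD(2)) auto
  qed (use d Suc.prems in \<open>auto intro!: derivative_eq_intros simp: power2_eq_square\<close>)
qed

lemma Ck_affine: "Ck n UNIV g \<Longrightarrow> Ck n UNIV (\<lambda>x. g (p * x + q))"
proof (induction n arbitrary: g)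
  case 0 then show ?case by (auto intro!: continuous_on_compose2[of UNIV g] continuous_intros)
next
  case (Suc n)
  have d: "(g has_real_derivative deriv g (p * x + q)) (at (p * x + q))" for x
    using Ck_SucD(1)[OF Suc.prems(1)] by blast
  have "((\<lambda>x. g (p * x + q)) has_real_derivative p * deriv g (p * x + q)) (at x)" for x
    by (rule DERIV_cong[OF DERIV_chain2[where f = g and g = "\<lambda>x. p * x + q", OF d]])
       (auto intro!: derivative_eq_intros)
  moreover have "Ck n UNIV (\<lambda>x. p * deriv g (p * x + q))"
    by (intro Ck_cmult Suc.IH Ck_SucD(2)[OF Suc.prems]) auto
  ultimately show ?case by (intro Ck_SucI[where g' = "\<lambda>x. p * deriv g (p * x + q)"]) auto
qed

lemma Ck_powr: "Ck n {0<..} (\<lambda>x::real. x powr a)"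
proof (induction n arbitrary: a)
  case 0 then show ?case by (auto intro!: continuous_intros)
next
  case (Suc n)
  show ?case
    by (rule Ck_SucI[where g' = "\<lambda>x. a * x powr (a - 1)"])
       (use Suc[of "a - 1"] in \<open>auto intro!: Ck_cmult DERIV_powr DERIV_cong[OF has_real_derivative_powr]\<close>)
qed

text \<open>
  These functions are the only source of smooth but non-analytic behaviour: smooth steps and bumps are rational
  expressions in them.
\<close>

lemma Ck_truncated_power: "Ck n UNIV (\<lambda>x::real. max 0 x ^ Suc n)"
proof (induction n)
  case 0 then show ?case by (auto intro!: continuous_intros)
next
  case (Suc n)
  have D: "((\<lambda>x::real. max 0 x ^ Suc (Suc n)) has_real_derivative real (Suc (Suc n)) * max 0 x ^ Suc n) (at x)" for x
  proof (cases "x = 0")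
    case True
    have "((\<lambda>y::real. max 0 y ^ Suc n) \<longlongrightarrow> max 0 0 ^ Suc n) (at 0)"
      by (intro tendsto_intros)
    then have lim: "((\<lambda>y::real. max 0 y ^ Suc n) \<longlongrightarrow> 0) (at 0)" by simp
    have eq: "eventually (\<lambda>y::real. (max 0 y ^ Suc (Suc n) - max 0 0 ^ Suc (Suc n)) / (y - 0) = max 0 y ^ Suc n) (at 0)"
      by (auto simp: eventually_at_filter max_def)
    show ?thesis
      unfolding True has_field_derivative_iff using lim tendsto_cong[OF eq] by simp
  next
    case False
    consider "x > 0" | "x < 0" using False by linarith
    then show ?thesis
    proof cases
      case 1
      have "((\<lambda>y. y ^ Suc (Suc n)) has_real_derivative real (Suc (Suc n)) * max 0 x ^ Suc n) (at x)"
        using 1 DERIV_pow[of "Suc (Suc n)" x UNIV] by simp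
      moreover have "eventually (\<lambda>y. max 0 y ^ Suc (Suc n) = y ^ Suc (Suc n)) (nhds x)"
        using eventually_nhds_in_open[of "{0<..}" x] 1 by (auto elim!: eventually_mono simp: max_def)
      ultimately show ?thesis by (subst DERIV_cong_ev[OF refl _ refl]) 
    next
      case 2
      have "((\<lambda>y. 0) has_real_derivative real (Suc (Suc n)) * max 0 x ^ Suc n) (at x)"
        using 2 by auto
      moreover have "eventually (\<lambda>y. max 0 y ^ Suc (Suc n) = 0) (nhds x)"
        using eventually_nhds_in_open[of "{..<0}" x] 2 by (auto elim!: eventually_mono simp: max_def)
      ultimately show ?thesis by (subst DERIV_cong_ev[OF refl _ refl]) 
    qed
  qed
  show ?case
    using D Suc.IH by (intro Ck_SucI[where g' = "\<lambda>x. real (Suc (Suc n)) * max 0 x ^ Suc n"] Ck_cmult) auto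
qed

lemma Ck_exp: "Ck n UNIV (\<lambda>x::real. exp (a * x))"
proof (induction n)
  case 0 then show ?case by (auto intro!: continuous_intros)
next
  case (Suc n)
  show ?case
    using Suc by (intro Ck_SucI[where g' = "\<lambda>x. a * exp (a * x)"] Ck_cmult) (auto intro!: derivative_eq_intros)
qed

text \<open>
  The denominator never vanishes, since \<open>v - 1\<close> and \<open>2 - v\<close> are not both non-positive.
\<close>

definition smooth_step :: "nat \<Rightarrow> real \<Rightarrow> real" where
  "smooth_step L v = max 0 (v - 1) ^ Suc L * inverse (max 0 (v - 1) ^ Suc L + max 0 (2 - v) ^ Suc L)"

lemma smooth_step_denom_pos: "max 0 (v - 1) ^ Suc L + max 0 (2 - v) ^ Suc L > (0::real)"
proof (cases "v > 1")
  case True then show ?thesis by (intro add_pos_nonneg) auto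
next
  case False then show ?thesis by (intro add_nonneg_pos) auto
qed

lemma Ck_smooth_step: "Ck L UNIV (smooth_step L)"
proof -
  have 1: "Ck L UNIV (\<lambda>v::real. max 0 (v - 1) ^ Suc L)"
    using Ck_affine[OF Ck_truncated_power, of L 1 "-1"] by simp
  have 2: "Ck L UNIV (\<lambda>v::real. max 0 (2 - v) ^ Suc L)"
    using Ck_affine[OF Ck_truncated_power, of L "-1" 2] by (simp add: algebra_simps)
  show ?thesis
    unfolding smooth_step_def[abs_def]
    using smooth_step_denom_pos by (intro Ck_mult Ck_inverse Ck_add 1 2) (auto simp: less_le)
qed

lemma smooth_step_eq_0: "v \<le> 1 \<Longrightarrow> smooth_step L v = 0"
  by (simp add: smooth_step_def)

lemma smooth_step_eq_1: "v \<ge> 2 \<Longrightarrow> smooth_step L v = 1"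
  by (simp add: smooth_step_def del: power_Suc)

lemma smooth_step_bounds: "0 \<le> smooth_step L v" "smooth_step L v \<le> 1"
  using smooth_step_denom_pos[of v L] by (auto simp: smooth_step_def field_simps)

definition bump :: "nat \<Rightarrow> real \<Rightarrow> real" where
  "bump L v = 1 - smooth_step L (2 * v) - smooth_step L (- 2 * v)"

lemma Ck_bump: "Ck L UNIV (bump L)"
  unfolding bump_def[abs_def]
  using Ck_affine[OF Ck_smooth_step, of L 2 0] Ck_affine[OF Ck_smooth_step, of L "-2" 0]
  by (intro Ck_diff) auto

lemma bump_eq_1: "\<bar>v\<bar> \<le> 1/2 \<Longrightarrow> bump L v = 1"
  by (simp add: bump_def smooth_step_eq_0)

lemma bump_eq_0: "\<bar>v\<bar> \<ge> 1 \<Longrightarrow> bump L v = 0"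
  by (cases "v \<ge> 0") (simp_all add: bump_def smooth_step_eq_0 smooth_step_eq_1)

lemma bump_bounds: "0 \<le> bump L v" "bump L v \<le> 1"
  using smooth_step_bounds[of L "2 * v"] smooth_step_bounds[of L "- 2 * v"]
  by (cases "v \<ge> 0"; simp add: bump_def smooth_step_eq_0)+

text \<open>
  Provides the homogeneous building blocks \<open>v powr k * b v\<close> of the Riesz kernel at a single scale.
\<close>

lemma Ck_powr_cutoff:
  assumes "Ck n UNIV b" "0 < \<delta>" "\<And>v. v \<le> \<delta> \<Longrightarrow> b v = 0"
  shows "Ck n UNIV (\<lambda>v. v powr a * b v)"
proof -
  have "Ck n {0<..} (\<lambda>v. v powr a * b v)"
    using assms(1) by (intro Ck_mult Ck_powr) (auto intro: Ck_subset)
  moreover have "Ck n {..<\<delta>} (\<lambda>v. v powr a * b v)"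
    by (subst Ck_cong[where v = "\<lambda>_. 0"]) (use assms(3) in auto)
  moreover have "UNIV = {0<..} \<union> {..<\<delta>}" using assms(2) by auto
  ultimately show ?thesis by (metis Ck_union open_greaterThan open_lessThan)
qed


section \<open>Laplace transforms of compactly supported functions\<close>

text \<open>
  The bilateral Laplace transform; on the imaginary axis it is the Fourier transform.
\<close>

definition laplace :: "(real \<Rightarrow> real) \<Rightarrow> complex \<Rightarrow> complex" where
  "laplace b z = (LINT v|lborel. of_real (b v) * exp (- (of_real v * z)))"

lemma integrable_compact_support:
  fixes b :: "real \<Rightarrow> real" and g :: "real \<Rightarrow> complex"
  assumes "continuous_on UNIV b" "\<And>v. K < \<bar>v\<bar> \<Longrightarrow> b v = 0" "continuous_on UNIV g"
  shows "integrable lborel (\<lambda>v. of_real (b v) * g v)"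
proof -
  have "integrable lborel (\<lambda>v. indicator {-K..K} v *\<^sub>R (of_real (b v) * g v))"
    using assms(1,3) by (intro borel_integrable_compact) (auto intro!: continuous_intros intro: continuous_on_subset)
  also have "(\<lambda>v. indicator {-K..K} v *\<^sub>R (of_real (b v) * g v)) = (\<lambda>v. of_real (b v) * g v)"
    using assms(2) by (auto simp: fun_eq_iff indicator_def abs_real_def split: if_splits)
  finally show ?thesis .
qed

lemma integrable_compact_support_real:
  fixes b :: "real \<Rightarrow> real"
  assumes "continuous_on UNIV b" "\<And>v. K < \<bar>v\<bar> \<Longrightarrow> b v = 0"
  shows "integrable lborel b"
proof -
  have "integrable lborel (\<lambda>v. complex_of_real (b v) * 1)"
    using assms by (intro integrable_compact_support) auto
  then show ?thesis by (simp add: complex_of_real_integrable_eq)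
qed

lemma laplace_bound:
  assumes "continuous_on UNIV b" "\<And>v. K < \<bar>v\<bar> \<Longrightarrow> b v = 0"
  shows "norm (laplace b z) \<le> (LINT v|lborel. \<bar>b v\<bar>) * exp (K * \<bar>Re z\<bar>)"
proof -
  have "norm (laplace b z) \<le> (LINT v|lborel. \<bar>b v\<bar> * exp (K * \<bar>Re z\<bar>))"
    unfolding laplace_def
  proof (rule Bochner_Integration.integral_norm_bound_integral)
    show "integrable lborel (\<lambda>v. of_real (b v) * exp (- (of_real v * z)))"
      by (rule integrable_compact_support[OF assms]) (auto intro!: continuous_intros)
    show "integrable lborel (\<lambda>v. \<bar>b v\<bar> * exp (K * \<bar>Re z\<bar>))"
      using integrable_compact_support_real[OF assms] by simp
    fix v
    show "norm (of_real (b v) * exp (- (of_real v * z))) \<le> \<bar>b v\<bar> * exp (K * \<bar>Re z\<bar>)"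
    proof (cases "K < \<bar>v\<bar>")
      case False
      have "- (v * Re z) \<le> \<bar>v\<bar> * \<bar>Re z\<bar>" by (metis abs_ge_minus_self abs_mult)
      also have "\<dots> \<le> K * \<bar>Re z\<bar>" using False by (intro mult_right_mono) auto
      finally show ?thesis by (auto simp: norm_mult intro!: mult_left_mono)
    qed (simp add: assms)
  qed
  then show ?thesis by simp
qed

lemma laplace_deriv:
  assumes "Ck (Suc n) UNIV b" "\<And>v. K < \<bar>v\<bar> \<Longrightarrow> b v = 0"
  shows "z * laplace b z = laplace (deriv b) z" "\<And>v. K < \<bar>v\<bar> \<Longrightarrow> deriv b v = 0"
proof -
  show supp': "deriv b v = 0" if "K < \<bar>v\<bar>" for v
  proof -
    have "open {v. K < \<bar>v\<bar>}" by (intro open_Collect_less continuous_intros)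
    then have "eventually (\<lambda>y. b y = 0) (nhds v)"
      using eventually_nhds_in_open[of "{v. K < \<bar>v\<bar>}" v] that
      by (auto elim!: eventually_mono simp: assms(2))
    from deriv_cong_ev[OF this refl] show ?thesis by simp
  qed
  let ?e = "\<lambda>v. exp (- (of_real v * z))"
  define F where "F = (\<lambda>v. of_real (b v) * ?e v)"
  define F' where "F' = (\<lambda>v. of_real (deriv b v) * ?e v - z * (of_real (b v) * ?e v))"
  have cb: "continuous_on UNIV b" "continuous_on UNIV (deriv b)"
    using Ck_imp_continuous[OF assms(1)] Ck_imp_continuous[OF Ck_SucD(2)[OF assms(1)]] by auto
  define R where "R = \<bar>K\<bar> + 1"
  have R: "R > \<bar>K\<bar>" "R > 0" by (auto simp: R_def)
  have D: "(F has_vector_derivative F' v) (at v within {-R..R})" for v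
  proof -
    have "(b has_real_derivative deriv b v) (at v within {-R..R})"
      using Ck_SucD(1)[OF assms(1), of v] by (auto intro: has_field_derivative_at_within)
    then have 1: "((\<lambda>v. of_real (b v)) has_vector_derivative complex_of_real (deriv b v)) (at v within {-R..R})"
      by (intro has_vector_derivative_of_real) (simp add: has_real_derivative_iff_has_vector_derivative)
    have "((\<lambda>w. exp (- (w * z))) has_field_derivative - z * ?e v) (at (of_real v))"
      by (auto intro!: derivative_eq_intros)
    then have 2: "(?e has_vector_derivative - z * ?e v) (at v within {-R..R})"
      using has_vector_derivative_real_field[of "\<lambda>w. exp (- (w * z))" "- z * ?e v" v "{-R..R}"] by auto
    show ?thesis unfolding F_def F'_def
      using has_vector_derivative_mult[OF 1 2] by (rule has_vector_derivative_eq_rhs) (simp add: algebra_simps)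
  qed
  have "(\<integral>v. indicator {-R..R} v *\<^sub>R F' v \<partial>lborel) = F R - F (-R)"
    using R D cb by (intro integral_FTC_Icc) (auto simp: F'_def intro!: continuous_intros intro: continuous_on_subset)
  also have "F R - F (-R) = 0" using R assms(2) by (simp add: F_def)
  also have "(\<lambda>v. indicator {-R..R} v *\<^sub>R F' v) = F'"
  proof
    fix v show "indicator {-R..R} v *\<^sub>R F' v = F' v"
      using R assms(2)[of v] supp'[of v] by (cases "v \<in> {-R..R}") (auto simp: F'_def)
  qed
  also have "(\<integral>v. F' v \<partial>lborel) = laplace (deriv b) z - z * laplace b z"
    unfolding F'_def laplace_def
    by (subst Bochner_Integration.integral_diff)
       (auto intro!: integrable_compact_support[where K = K] integrable_mult_right cb continuous_intros simp: assms supp')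
  finally show "z * laplace b z = laplace (deriv b) z" by simp
qed

text \<open>
  Each integration by parts trades a derivative of \<open>b\<close> for a factor \<open>z\<close>.
\<close>

lemma laplace_decay:
  assumes "Ck L UNIV b" "\<And>v. K < \<bar>v\<bar> \<Longrightarrow> b v = 0"
  shows "\<exists>C\<ge>0. \<forall>z. norm (laplace b z) * (1 + norm z) ^ L \<le> C * exp (K * \<bar>Re z\<bar>)"
  using assms
proof (induction L arbitrary: b)
  case 0
  show ?case
    using laplace_bound[OF Ck_imp_continuous[OF 0(1)] 0(2)] by (intro exI[of _ "LINT v|lborel. \<bar>b v\<bar>"]) auto
next
  case (Suc L)
  obtain C1 where C1: "C1 \<ge> 0" "\<And>z. norm (laplace b z) * (1 + norm z) ^ L \<le> C1 * exp (K * \<bar>Re z\<bar>)"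
    using Suc.IH[OF Ck_Suc_imp[OF Suc.prems(1)] Suc.prems(2)] by auto
  have supp': "deriv b v = 0" if "K < \<bar>v\<bar>" for v
    using laplace_deriv(2)[OF Suc.prems(1) _ that] Suc.prems(2) by blast
  obtain C2 where C2: "C2 \<ge> 0" "\<And>z. norm (laplace (deriv b) z) * (1 + norm z) ^ L \<le> C2 * exp (K * \<bar>Re z\<bar>)"
    using Suc.IH[OF Ck_SucD(2)[OF Suc.prems(1)] supp'] by auto
  have "norm (laplace b z) * (1 + norm z) ^ Suc L \<le> (C1 + C2) * exp (K * \<bar>Re z\<bar>)" for z
  proof -
    have "norm (laplace b z) * (1 + norm z) ^ Suc L
        = norm (laplace b z) * (1 + norm z) ^ L + norm (z * laplace b z) * (1 + norm z) ^ L"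
      by (simp add: norm_mult algebra_simps)
    also have "\<dots> \<le> C1 * exp (K * \<bar>Re z\<bar>) + C2 * exp (K * \<bar>Re z\<bar>)"
      using C1(2)[of z] C2(2)[of z] laplace_deriv(1)[of L b K z, OF Suc.prems] by simp
    finally show ?thesis by (simp add: algebra_simps)
  qed
  then show ?case using C1(1) C2(1) by (intro exI[of _ "C1 + C2"]) auto
qed

lemma powr_over_power_le:
  fixes y k :: real
  assumes "1 \<le> y" "k + 2 \<le> real L"
  shows "y powr k / y ^ L \<le> 1 / y\<^sup>2"
proof -
  have "y powr k * y\<^sup>2 = y powr k * y powr 2" using assms by (simp add: powr_numeral)
  also have "\<dots> = y powr (k + 2)" by (simp add: powr_add)
  also have "\<dots> \<le> y powr (real L)" using assms by (intro powr_mono) auto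
  also have "\<dots> = y ^ L" using assms by (simp add: powr_realpow)
  finally show ?thesis using assms by (simp add: field_simps)
qed

text \<open>
  Along vertical lines the transform remains integrable after multiplication by a function of growth
  \<open>m\<close>.
\<close>

lemma laplace_weighted_decay:
  assumes "Ck L UNIV b" "\<And>v. K < \<bar>v\<bar> \<Longrightarrow> b v = 0"
  shows "\<exists>C\<ge>0. \<forall>m z. m + 2 \<le> real L \<longrightarrow>
    norm (laplace b z) * (1 + norm z) powr m \<le> C * exp (K * \<bar>Re z\<bar>) / (1 + (Im z)\<^sup>2)"
proof -
  obtain C where C: "C \<ge> 0" "\<And>z. norm (laplace b z) * (1 + norm z) ^ L \<le> C * exp (K * \<bar>Re z\<bar>)"
    using laplace_decay[OF assms] by auto
  have "norm (laplace b z) * (1 + norm z) powr m \<le> C * exp (K * \<bar>Re z\<bar>) / (1 + (Im z)\<^sup>2)" if m: "m + 2 \<le> real L" for m z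
  proof -
    have pos: "0 < 1 + norm z" by (simp add: add_pos_nonneg)
    have "(1 + norm z) powr m / (1 + norm z) ^ L \<le> 1 / (1 + norm z)\<^sup>2"
      using m by (intro powr_over_power_le) auto
    also have "\<dots> \<le> 1 / (1 + (Im z)\<^sup>2)"
    proof (rule divide_left_mono)
      have "(Im z)\<^sup>2 \<le> (norm z)\<^sup>2" using abs_Im_le_cmod[of z] by (simp add: abs_le_square_iff[symmetric])
      then show "1 + (Im z)\<^sup>2 \<le> (1 + norm z)\<^sup>2" unfolding power2_sum by (simp add: add_increasing2)
      show "0 < (1 + norm z)\<^sup>2 * (1 + (Im z)\<^sup>2)" using pos by (intro mult_pos_pos zero_less_power) (auto simp: add_pos_nonneg)
    qed simp
    finally have "norm (laplace b z) * (1 + norm z) ^ L * ((1 + norm z) powr m / (1 + norm z) ^ L)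
        \<le> C * exp (K * \<bar>Re z\<bar>) * (1 / (1 + (Im z)\<^sup>2))"
      using C(1) by (intro mult_mono[OF C(2)]) auto
    then show ?thesis using pos by simp
  qed
  then show ?thesis using C(1) by blast
qed

lemma laplace_holomorphic:
  assumes "continuous_on UNIV b" "\<And>v. K < \<bar>v\<bar> \<Longrightarrow> b v = 0"
  shows "laplace b holomorphic_on UNIV"
proof -
  have eq: "laplace b z = integral (cbox (-K) K) (\<lambda>v. of_real (b v) * exp (- (of_real v * z)))" for z
  proof -
    let ?g = "\<lambda>v. of_real (b v) * exp (- (of_real v * z))"
    have "integrable lborel ?g"
      by (rule integrable_compact_support[OF assms]) (auto intro!: continuous_intros)
    from has_integral_integral_lborel[OF this] have "(?g has_integral laplace b z) UNIV"
      by (simp add: laplace_def)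
    also have "?g = (\<lambda>v. if v \<in> cbox (-K) K then ?g v else 0)"
      using assms(2) by (auto simp: fun_eq_iff abs_real_def)
    finally show ?thesis
      by (subst (asm) has_integral_restrict_UNIV) (simp add: integral_unique)
  qed
  have "(\<lambda>z::complex. integral (cbox (-K) K) (\<lambda>v. of_real (b v) * exp (- (of_real v * z)))) holomorphic_on UNIV"
  proof (rule leibniz_rule_holomorphic)
    show "((\<lambda>z. of_real (b v) * exp (- (of_real v * z))) has_field_derivative
           (of_real (b v) * (- of_real v) * exp (- (of_real v * z)))) (at z within UNIV)" for z :: complex and v
      by (auto intro!: derivative_eq_intros)
    show "(\<lambda>v. of_real (b v) * exp (- (of_real v * z))) integrable_on cbox (- K) K" for z :: complex
    proof (rule integrable_continuous)
      have "continuous_on UNIV (\<lambda>v. of_real (b v) * exp (- (of_real v * z)))"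
        by (intro continuous_on_mult continuous_on_of_real assms(1)) (auto intro!: continuous_intros)
      then show "continuous_on (cbox (-K) K) (\<lambda>v. of_real (b v) * exp (- (of_real v * z)))"
        by (rule continuous_on_subset) simp
    qed
    show "continuous_on (UNIV \<times> cbox (- K) K)
      (\<lambda>(z::complex, v). of_real (b v) * (- of_real v) * exp (- (of_real v * z)))"
      unfolding case_prod_beta
      by (intro continuous_intros continuous_on_compose2[OF assms(1)]) auto
  qed auto
  then show ?thesis using eq by presburger
qed

text \<open>
  A window of width \<open>h\<close> placed at \<open>y\<close>: its transform spreads over the frequency scale
  \<open>1 / h\<close>, and the location appears only in the exponential factor.
\<close>

lemma laplace_affine:
  assumes "h > 0"
  shows "laplace (\<lambda>v. b ((y - v) / h)) (- s) = of_real h * exp (of_real y * s) * laplace b (of_real h * s)"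
proof -
  have "laplace (\<lambda>v. b ((y - v) / h)) (- s) = (LINT v|lborel. of_real (b ((y - v) / h)) * exp (of_real v * s))"
    by (simp add: laplace_def)
  also have "\<dots> = \<bar>- h\<bar> *\<^sub>R (LINT v|lborel. of_real (b ((y - (y + - h * v)) / h)) * exp (of_real (y + - h * v) * s))"
    using assms by (subst lborel_integral_real_affine[where c = "- h" and t = y]) auto
  also have "(\<lambda>v. of_real (b ((y - (y + - h * v)) / h)) * exp (of_real (y + - h * v) * s))
      = (\<lambda>v. exp (of_real y * s) * (of_real (b v) * exp (- (of_real v * (of_real h * s)))))"
    using assms by (auto simp: fun_eq_iff algebra_simps exp_diff exp_minus field_simps)
  finally show ?thesis
    using assms by (simp add: laplace_def scaleR_conv_of_real)
qed


section \<open>Fourier inversion\<close>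

lemma integrable_shifted_gaussian:
  "e > 0 \<Longrightarrow> integrable lborel (\<lambda>t. std_normal_density (e * t))"
  using lborel_integrable_real_affine[OF integrable_normal_density[of 1 0], of e 0] by simp

lemma gaussian_fourier:
  "(LINT x|lborel. of_real (std_normal_density x) * exp (\<i> * of_real (t * x))) = complex_of_real (exp (- (t^2) / 2))"
proof -
  have "char std_normal_distribution t = (LINT x|lborel. std_normal_density x *\<^sub>R iexp (t * x))"
    unfolding char_def by (subst integral_density) (auto simp: normal_density_nonneg)
  then show ?thesis by (simp add: char_std_normal_distribution scaleR_conv_of_real)
qed

text \<open>
  Damp the integral by a Gaussian of width \<open>1 / e\<close>. After an exchange of integrations it becomes
  the average of \<open>b\<close> against a Gaussian of width \<open>e\<close> centred at \<open>u\<close>, and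
  both sides pass to the limit \<open>e \<longrightarrow> 0\<close> by dominated convergence.
\<close>

lemma fourier_inversion:
  assumes cont: "continuous_on UNIV b" and supp: "\<And>v. K < \<bar>v\<bar> \<Longrightarrow> b v = 0"
    and int: "integrable lborel (\<lambda>t. laplace b (\<i> * of_real t))"
  shows "(LINT t|lborel. laplace b (\<i> * of_real t) * exp (\<i> * of_real (t * u))) = of_real (2 * pi * b u)"
proof -
  let ?g = std_normal_density
  have [measurable]: "b \<in> borel_measurable borel"
    using cont by (simp add: borel_measurable_continuous_onI)
  have ibK: "integrable lborel (\<lambda>v. \<bar>b v\<bar>)"
    using integrable_compact_support_real[OF cont supp] by simp
  define I where "I = (\<lambda>n::nat. LINT t|lborel. (laplace b (\<i> * of_real t) * exp (\<i> * of_real (t * u))) *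
     of_real (exp (- ((t * inverse (real (Suc n)))^2) / 2)))"
  have gauss: "(\<lambda>i. exp (- (t * inverse (real (Suc i)))\<^sup>2 / 2)) \<longlonglongrightarrow> exp (- (t * 0)\<^sup>2 / 2)" for t
    by (rule tendsto_exp, intro tendsto_divide tendsto_minus tendsto_power tendsto_mult tendsto_const LIMSEQ_inverse_real_of_nat) simp
  have "I \<longlonglongrightarrow> (LINT t|lborel. (laplace b (\<i> * of_real t) * exp (\<i> * of_real (t * u))) * of_real (exp (- ((t * 0)^2) / 2)))"
    unfolding I_def
  proof (rule integral_dominated_convergence)
    show "integrable lborel (\<lambda>t. norm (laplace b (\<i> * of_real t)))" using int by simp
    show "AE t in lborel. (\<lambda>i. laplace b (\<i> * of_real t) * exp (\<i> * of_real (t * u)) * of_real (exp (- (t * inverse (real (Suc i)))\<^sup>2 / 2)))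
        \<longlonglongrightarrow> laplace b (\<i> * of_real t) * exp (\<i> * of_real (t * u)) * of_real (exp (- (t * 0)\<^sup>2 / 2))"
      by (intro AE_I2 tendsto_mult tendsto_const tendsto_of_real gauss)
    show "AE t in lborel. norm (laplace b (\<i> * of_real t) * exp (\<i> * of_real (t * u)) * of_real (exp (- (t * inverse (real (Suc n)))\<^sup>2 / 2)))
        \<le> norm (laplace b (\<i> * of_real t))" for n
      by (intro AE_I2) (auto simp: norm_mult mult_left_le)
  qed (use int in \<open>auto intro!: borel_measurable_times dest: borel_measurable_integrable\<close>)
  then have lim1: "I \<longlonglongrightarrow> (LINT t|lborel. laplace b (\<i> * of_real t) * exp (\<i> * of_real (t * u)))" by simp
  have I_eq: "I n = of_real (2 * pi * (LINT w|lborel. b (u + inverse (real (Suc n)) * w) * ?g w))" for n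
  proof -
    define e where "e = inverse (real (Suc n))"
    have e: "e > 0" by (simp add: e_def)
    let ?F = "\<lambda>t v. of_real (b v) * exp (- (of_real v * (\<i> * of_real t))) * exp (\<i> * of_real (t * u)) * complex_of_real (?g (e * t))"
    have dens: "complex_of_real (exp (- ((t * e)^2) / 2)) = of_real (sqrt (2 * pi)) * of_real (?g (e * t))" for t
    proof -
      have "exp (- ((t * e)^2) / 2) = sqrt (2 * pi) * ?g (e * t)"
        by (simp add: std_normal_density_def mult.commute[of t e])
      then show ?thesis by (simp only: of_real_mult[symmetric])
    qed
    have "I n = (LINT t|lborel. of_real (sqrt (2 * pi)) * (LINT v|lborel. ?F t v))"
    proof -
      have "(LINT v|lborel. ?F t v) = laplace b (\<i> * of_real t) * exp (\<i> * of_real (t * u)) * complex_of_real (?g (e * t))" for t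
        unfolding laplace_def integral_mult_left_zero ..
      then show ?thesis
        unfolding I_def e_def[symmetric] dens
        by (intro Bochner_Integration.integral_cong refl) (simp add: mult_ac)
    qed
    also have "\<dots> = of_real (sqrt (2 * pi)) * (LINT t|lborel. LINT v|lborel. ?F t v)" by simp
    also have "(LINT t|lborel. LINT v|lborel. ?F t v) = (LINT v|lborel. LINT t|lborel. ?F t v)"
    proof (rule lborel_pair.Fubini_integral[symmetric])
      show "integrable (lborel \<Otimes>\<^sub>M lborel) (\<lambda>(t, v). ?F t v)"
      proof (rule lborel_pair.Fubini_integrable)
        show "(\<lambda>(t, v). ?F t v) \<in> borel_measurable (lborel \<Otimes>\<^sub>M lborel)" by measurable
        have "(\<lambda>t. LINT v|lborel. norm (?F t v)) = (\<lambda>t. (LINT v|lborel. \<bar>b v\<bar>) * ?g (e * t))"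
          by (auto simp: fun_eq_iff norm_mult normal_density_nonneg)
        then show "integrable lborel (\<lambda>t. LINT v|lborel. norm (case (t, v) of (t, v) \<Rightarrow> ?F t v))"
          using integrable_shifted_gaussian[OF e] by simp
        show "AE t in lborel. integrable lborel (\<lambda>v. case (t, v) of (t, v) \<Rightarrow> ?F t v)"
          unfolding prod.case mult.assoc
          by (intro AE_I2 integrable_compact_support[OF cont supp] continuous_intros) auto
      qed
    qed
    also have "(\<lambda>v. LINT t|lborel. ?F t v) = (\<lambda>v. of_real (b v * (exp (- (((u - v) / e)\<^sup>2) / 2) / e)))"
    proof
      fix v
      have "(LINT t|lborel. ?F t v) = (LINT t|lborel. of_real (b v) * (of_real (?g (e * t)) * exp (\<i> * of_real ((u - v) / e * (e * t)))))"
      proof (intro Bochner_Integration.integral_cong refl)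
        fix t
        have "exp (- (of_real v * (\<i> * of_real t))) * exp (\<i> * of_real (t * u)) = exp (\<i> * of_real ((u - v) / e * (e * t)))"
        proof -
          have "(u - v) / e * (e * t) = (u - v) * t" using e by simp
          then show ?thesis by (simp only: mult_exp_exp) (simp add: algebra_simps)
        qed
        then have "?F t v = of_real (b v) * exp (\<i> * of_real ((u - v) / e * (e * t))) * of_real (?g (e * t))"
          by (simp only: mult.assoc[of "of_real (b v)"])
        then show "?F t v = of_real (b v) * (of_real (?g (e * t)) * exp (\<i> * of_real ((u - v) / e * (e * t))))"
          by (simp only: mult.assoc mult.commute[of "of_real (?g (e * t))"])
      qed
      also have "\<dots> = of_real (b v) * (LINT t|lborel. (of_real (?g (e * t)) * exp (\<i> * of_real ((u - v) / e * (e * t)))))"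
        by simp
      also have "(LINT t|lborel. (of_real (?g (e * t)) * exp (\<i> * of_real ((u - v) / e * (e * t)))))
         = (1 / e) *\<^sub>R (LINT x|lborel. of_real (?g x) * exp (\<i> * of_real ((u - v) / e * x)))"
        using e by (subst (2) lborel_integral_real_affine[where c = e and t = 0]) auto
      finally show "(LINT t|lborel. ?F t v) = of_real (b v * (exp (- (((u - v) / e)\<^sup>2) / 2) / e))"
        unfolding gaussian_fourier by (simp add: scaleR_conv_of_real)
    qed
    also have "(LINT v|lborel. complex_of_real (b v * (exp (- (((u - v) / e)\<^sup>2) / 2) / e)))
        = of_real (LINT v|lborel. b v * (exp (- (((u - v) / e)\<^sup>2) / 2) / e))" by (rule integral_complex_of_real)
    also have "(LINT v|lborel. b v * (exp (- (((u - v) / e)\<^sup>2) / 2) / e))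
        = (LINT w|lborel. b (u + e * w) * exp (- (w\<^sup>2) / 2))"
    proof -
      have "(LINT v|lborel. b v * (exp (- (((u - v) / e)\<^sup>2) / 2) / e))
          = \<bar>e\<bar> *\<^sub>R (LINT w|lborel. b (u + e * w) * (exp (- (((u - (u + e * w)) / e)\<^sup>2) / 2) / e))"
        using e by (intro lborel_integral_real_affine) simp
      also have "(\<lambda>w. b (u + e * w) * (exp (- (((u - (u + e * w)) / e)\<^sup>2) / 2) / e))
          = (\<lambda>w. b (u + e * w) * exp (- (w\<^sup>2) / 2) * (1 / e))"
        using e by (auto simp: fun_eq_iff)
      finally show ?thesis using e by simp
    qed
    also have "\<dots> = (LINT w|lborel. sqrt (2 * pi) * (b (u + e * w) * ?g w))"
      by (intro Bochner_Integration.integral_cong refl) (simp add: std_normal_density_def)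
    also have "of_real (sqrt (2 * pi)) * complex_of_real (LINT w|lborel. sqrt (2 * pi) * (b (u + e * w) * ?g w))
       = of_real (2 * pi * (LINT w|lborel. b (u + e * w) * ?g w))"
    proof -
      have "sqrt (2 * pi) * (LINT w|lborel. sqrt (2 * pi) * (b (u + e * w) * ?g w)) = 2 * pi * (LINT w|lborel. b (u + e * w) * ?g w)"
      proof -
        have "sqrt (2 * pi) * sqrt (2 * pi) = 2 * pi" by simp
        then show ?thesis unfolding integral_mult_right_zero by (simp only: mult.assoc[symmetric])
      qed
      then show ?thesis by (simp only: of_real_mult[symmetric])
    qed
    finally show ?thesis by (simp only: e_def)
  qed
  obtain M where M: "\<And>v. \<bar>b v\<bar> \<le> M"
  proof -
    have "compact (b ` {-\<bar>K\<bar>..\<bar>K\<bar>})"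
      using cont by (intro compact_continuous_image) (auto intro: continuous_on_subset)
    then obtain M where M: "\<And>x. x \<in> b ` {-\<bar>K\<bar>..\<bar>K\<bar>} \<Longrightarrow> norm x \<le> M"
      using compact_imp_bounded bounded_iff by metis
    have "\<bar>b v\<bar> \<le> \<bar>M\<bar>" for v
    proof (cases "K < \<bar>v\<bar>")
      case False
      then have "v \<in> {-\<bar>K\<bar>..\<bar>K\<bar>}" by auto
      then show ?thesis using M[of "b v"] by auto
    qed (simp add: supp)
    then show ?thesis using that by blast
  qed
  have "(\<lambda>n. LINT w|lborel. b (u + inverse (real (Suc n)) * w) * ?g w) \<longlonglongrightarrow> (LINT w|lborel. b (u + 0 * w) * ?g w)"
  proof (rule integral_dominated_convergence)
    show "integrable lborel (\<lambda>w. M * ?g w)" by simp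
    have c: "isCont b (u + 0 * w)" for w using cont by (simp add: continuous_on_eq_continuous_at)
    show "AE w in lborel. (\<lambda>i. b (u + inverse (real (Suc i)) * w) * ?g w) \<longlonglongrightarrow> b (u + 0 * w) * ?g w"
      by (intro AE_I2 tendsto_mult tendsto_const tendsto_add isCont_tendsto_compose[OF c] LIMSEQ_inverse_real_of_nat)
    show "AE w in lborel. norm (b (u + inverse (real (Suc n)) * w) * ?g w) \<le> M * ?g w" for n
      using M by (intro AE_I2) (auto simp: abs_mult normal_density_nonneg intro!: mult_right_mono)
  qed auto
  then have "I \<longlonglongrightarrow> of_real (2 * pi * b u)"
    unfolding I_eq by (intro tendsto_intros) simp
  with lim1 show ?thesis by (rule LIMSEQ_unique)
qed


section \<open>Integrals along vertical lines\<close>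

abbreviation vline :: "real \<Rightarrow> real \<Rightarrow> complex" where
  "vline c t \<equiv> of_real c + \<i> * of_real t"

lemma integrable_inverse_1_plus_square_UNIV: "integrable lborel (\<lambda>t::real. C / (1 + t\<^sup>2))"
proof -
  have "integrable lborel (\<lambda>t::real. inverse (1 + t\<^sup>2))"
    using integrable_inverse_1_plus_square by (simp add: set_integrable_def)
  then show ?thesis by (simp add: divide_inverse)
qed

lemma integrable_of_decay:
  fixes g :: "real \<Rightarrow> complex"
  assumes "continuous_on UNIV g" "\<And>t. norm (g t) \<le> C / (1 + t\<^sup>2)"
  shows "integrable lborel g"
proof (rule Bochner_Integration.integrable_bound[OF integrable_inverse_1_plus_square_UNIV])
  show "g \<in> borel_measurable lborel" using assms(1) by (simp add: borel_measurable_continuous_onI)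
  show "AE t in lborel. norm (g t) \<le> norm (C / (1 + t\<^sup>2))"
    by (intro AE_I2 order_trans[OF assms(2)]) (simp del: norm_divide abs_divide)
qed

text \<open>
  With a primitive \<open>P\<close> of \<open>H\<close> on the half-plane, the integrals over the two truncated
  lines differ only by increments of \<open>P\<close> along two horizontal segments of fixed length, where
  \<open>H\<close> tends to zero.
\<close>

lemma line_integral_shift:
  fixes H :: "complex \<Rightarrow> complex"
  assumes hol: "H holomorphic_on {s. \<theta> < Re s}" and c: "\<theta> < c" "c \<le> c1"
    and bound: "\<And>s. c \<le> Re s \<Longrightarrow> Re s \<le> c1 \<Longrightarrow> norm (H s) \<le> C / (1 + (Im s)\<^sup>2)"
  shows "(LINT t|lborel. H (vline c t)) = (LINT t|lborel. H (vline c1 t))"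
proof -
  let ?S = "{s. \<theta> < Re s}"
  have S: "open ?S" "convex ?S"
    using open_halfspace_Re_gt[of \<theta>] convex_halfspace_Re_gt[of \<theta>] by auto
  have cont: "continuous_on UNIV (\<lambda>t. H (vline d t))" if "c \<le> d" for d
    using that c by (intro continuous_on_compose2[OF holomorphic_on_imp_continuous_on[OF hol]] continuous_intros) auto
  have integ: "integrable lborel (\<lambda>t. H (vline d t))" if "c \<le> d" "d \<le> c1" for d
  proof (rule integrable_of_decay[OF cont])
    show "norm (H (vline d t)) \<le> C / (1 + t\<^sup>2)" for t
      using bound[of "vline d t"] that by simp
  qed (use that in auto)
  obtain P where P: "\<And>x. x \<in> ?S \<Longrightarrow> (P has_field_derivative H x) (at x within ?S)"
    using holomorphic_convex_primitive'[OF S(2,1) hol] by blast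
  have P': "(P has_field_derivative H x) (at x)" if "\<theta> < Re x" for x
    using P[of x] at_within_open[of x ?S] that S(1) by simp
  define J where "J = (\<lambda>d n. LINT t|lborel. indicator {- real n..real n} t *\<^sub>R H (vline d t))"
  have Jlim: "J d \<longlonglongrightarrow> (LINT t|lborel. H (vline d t))" if "c \<le> d" "d \<le> c1" for d
    unfolding J_def
  proof (rule integral_dominated_convergence)
    show "integrable lborel (\<lambda>t. norm (H (vline d t)))" using integ that by simp
    show "AE t in lborel. (\<lambda>n. indicator {- real n..real n} t *\<^sub>R H (vline d t))
           \<longlonglongrightarrow> H (vline d t)"
    proof (rule AE_I2)
      fix t :: real
      obtain N where "\<bar>t\<bar> \<le> real N" using real_arch_simple by blast
      then have "\<forall>\<^sub>F n in sequentially. indicator {- real n..real n} t *\<^sub>R H (vline d t)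
           = H (vline d t)"
        by (intro eventually_sequentiallyI[of N]) (auto simp: indicator_def)
      then show "(\<lambda>n. indicator {- real n..real n} t *\<^sub>R H (vline d t))
           \<longlonglongrightarrow> H (vline d t)" by (rule tendsto_eventually)
    qed
  qed (use integ that in \<open>auto simp: indicator_def\<close>)
  have Jeq: "J d n = - \<i> * (P (vline d (real n)) - P (of_real d - \<i> * of_real (real n)))" if "c \<le> d" for d n
  proof -
    have "((\<lambda>t. - \<i> * P (vline d t)) has_vector_derivative H (vline d t)) (at t within {- real n..real n})" for t
    proof -
      have "((\<lambda>w. - \<i> * P (of_real d + \<i> * w)) has_field_derivative - \<i> * (H (vline d t) * \<i>)) (at (of_real t))"
        by (intro DERIV_cmult DERIV_chain2[where f = P] P') (use that c in \<open>auto intro!: derivative_eq_intros\<close>)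
      then show ?thesis
        using has_vector_derivative_real_field[where s = "{- real n..real n}"] by (fastforce simp: algebra_simps)
    qed
    then have "J d n = - \<i> * P (vline d (real n)) - - \<i> * P (vline d (- real n))"
      unfolding J_def using that by (intro integral_FTC_Icc continuous_on_subset[OF cont]) auto
    then show ?thesis by (simp add: algebra_simps)
  qed
  have Pdiff: "norm (P (vline c T) - P (vline c1 T)) \<le> C / (1 + T\<^sup>2) * (c1 - c)" for T
  proof -
    let ?L = "{z. Im z = T \<and> c \<le> Re z \<and> Re z \<le> c1}"
    have "?L = {z. Im z = T} \<inter> {z. Re z \<ge> c} \<inter> {z. Re z \<le> c1}" by auto
    moreover have "convex {z. Im z = T}"
      using convex_hyperplane[of \<i> T] by simp
    ultimately have "convex ?L"
      using convex_Int convex_halfspace_Re_ge convex_halfspace_Re_le by metis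
    have "norm (P (vline c T) - P (vline c1 T)) \<le> C / (1 + T\<^sup>2) * norm (vline c T - vline c1 T)"
    proof (rule field_differentiable_bound[OF \<open>convex ?L\<close>])
      show "(P has_field_derivative H z) (at z within ?L)" if "z \<in> ?L" for z
        using P'[of z] that c by (auto intro: has_field_derivative_at_within)
      show "norm (H z) \<le> C / (1 + T\<^sup>2)" if "z \<in> ?L" for z
        using bound[of z] that by auto
    qed (use c in auto)
    also have "norm (vline c T - vline c1 T) = c1 - c"
      using c by (simp flip: of_real_diff)
    finally show ?thesis .
  qed
  have "(\<lambda>n. J c n - J c1 n) \<longlonglongrightarrow> 0"
  proof (rule Lim_null_comparison)
    show "\<forall>\<^sub>F n in sequentially. norm (J c n - J c1 n) \<le> 2 * (C / (1 + (real n)\<^sup>2) * (c1 - c))"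
    proof (intro always_eventually allI)
      fix n
      have "J c n - J c1 n = - \<i> * ((P (vline c (real n)) - P (vline c1 (real n)))
          - (P (vline c (- real n)) - P (vline c1 (- real n))))"
        using c by (simp add: Jeq algebra_simps)
      also have "norm \<dots> \<le> norm (P (vline c (real n)) - P (vline c1 (real n)))
          + norm (P (vline c (- real n)) - P (vline c1 (- real n)))"
        unfolding norm_mult by (simp only: norm_minus_cancel norm_ii mult_1 norm_triangle_ineq4)
      also have "\<dots> \<le> C / (1 + (real n)\<^sup>2) * (c1 - c) + C / (1 + (- real n)\<^sup>2) * (c1 - c)"
        by (intro add_mono Pdiff)
      finally show "norm (J c n - J c1 n) \<le> 2 * (C / (1 + (real n)\<^sup>2) * (c1 - c))" by simp
    qed
    show "(\<lambda>n. 2 * (C / (1 + (real n)\<^sup>2) * (c1 - c))) \<longlonglongrightarrow> 0"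
      by real_asymp
  qed
  moreover have "(\<lambda>n. J c n - J c1 n) \<longlonglongrightarrow> (LINT t|lborel. H (vline c t)) - (LINT t|lborel. H (vline c1 t))"
    using c by (intro tendsto_diff Jlim) auto
  ultimately have "(LINT t|lborel. H (vline c t)) - (LINT t|lborel. H (vline c1 t)) = 0"
    using LIMSEQ_unique by blast
  then show "(LINT t|lborel. H (vline c t)) = (LINT t|lborel. H (vline c1 t))" by simp
qed


section \<open>Riesz means of higher order\<close>

lemma frequency_facts:
  assumes "frequency lam"
  shows "finite {n. lam n \<le> x}" "0 \<le> lam n" "m < n \<Longrightarrow> lam m < lam n" "lam m < lam n \<longleftrightarrow> m < n" "lam m \<le> lam n \<longleftrightarrow> m \<le> n"
    "\<exists>n. x < lam n"
proof -
  have sm: "strict_mono lam" and nn: "\<And>n. 0 \<le> lam n" and lim: "filterlim lam at_top sequentially"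
    using assms by (auto simp: frequency_def)
  show "0 \<le> lam n" by (rule nn)
  show "m < n \<Longrightarrow> lam m < lam n" "lam m < lam n \<longleftrightarrow> m < n" "lam m \<le> lam n \<longleftrightarrow> m \<le> n"
    using sm by (auto simp: strict_mono_less strict_mono_less_eq)
  have "eventually (\<lambda>n. x < lam n) sequentially" using lim by (simp add: filterlim_at_top_dense)
  then obtain N where N: "\<And>n. n \<ge> N \<Longrightarrow> x < lam n" by (auto simp: eventually_sequentially)
  then show "\<exists>n. x < lam n" by blast
  have "{n. lam n \<le> x} \<subseteq> {..<N}"
  proof
    fix n assume "n \<in> {n. lam n \<le> x}"
    then show "n \<in> {..<N}" using N[of n] by (cases "N \<le> n") auto
  qed
  then show "finite {n. lam n \<le> x}" by (rule finite_subset) simp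
qed

text \<open>
  The Beta density (up to normalisation) that expresses a Riesz mean of order \<open>\<alpha> + l + 1\<close> as
  an average of those of order \<open>l\<close>.
\<close>

definition raise_weight :: "real \<Rightarrow> real \<Rightarrow> real \<Rightarrow> real" where
  "raise_weight \<alpha> l u = indicator {0..1} u * ((1 - u) powr \<alpha> * u powr l)"

definition raise_const :: "real \<Rightarrow> real \<Rightarrow> real" where
  "raise_const \<alpha> l = (LINT u|lborel. raise_weight \<alpha> l u)"

lemma raise_weight_bounds:
  assumes "0 \<le> \<alpha>" "0 \<le> l"
  shows "0 \<le> raise_weight \<alpha> l u" "raise_weight \<alpha> l u \<le> indicator {0..1} u"
  using assms by (auto simp: raise_weight_def indicator_def intro!: mult_le_one powr_le1)

lemma integrable_raise_weight:
  assumes "0 \<le> \<alpha>" "0 \<le> l"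
  shows "integrable lborel (raise_weight \<alpha> l)"
proof (rule Bochner_Integration.integrable_bound)
  show "integrable lborel (indicator {0..1::real} :: real \<Rightarrow> real)" by simp
  show "raise_weight \<alpha> l \<in> borel_measurable lborel" unfolding raise_weight_def[abs_def] by measurable
qed (use raise_weight_bounds[OF assms] in auto)

lemma raise_const_pos:
  assumes "0 \<le> \<alpha>" "0 \<le> l"
  shows "raise_const \<alpha> l > 0"
proof -
  have "0 < (1/3) powr \<alpha> * (1/3) powr l * (1/3::real)" by simp
  also have "\<dots> = (LINT u|lborel. indicator {1/3..2/3::real} u * ((1/3) powr \<alpha> * (1/3) powr l))" by simp
  also have "\<dots> \<le> raise_const \<alpha> l"
    unfolding raise_const_def
  proof (rule integral_mono)
    fix u :: real
    show "indicator {1/3..2/3} u * ((1/3) powr \<alpha> * (1/3) powr l) \<le> raise_weight \<alpha> l u"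
    proof (cases "u \<in> {1/3..2/3}")
      case True
      then have "(1/3) powr \<alpha> \<le> (1 - u) powr \<alpha>" "(1/3) powr l \<le> u powr l"
        using assms by (auto intro!: powr_mono2)
      then show ?thesis using True by (auto simp: raise_weight_def intro!: mult_mono)
    qed (use raise_weight_bounds[OF assms] in auto)
  qed (use integrable_raise_weight[OF assms] in auto)
  finally show ?thesis .
qed

text \<open>
  Almost everywhere the integrand is \<open>(1 - u)\<^sup>\<alpha> (u - v)\<^sup>l\<close> on \<open>v \<le> u
  \<le> 1\<close>, with \<open>v = \<mu> / x\<close>, and the affine map from \<open>{0..1}\<close> onto
  \<open>{v..1}\<close> turns this into a multiple of the weight. The excluded points are those where \<open>0
  powr 0 = 0\<close> differs from the convention \<open>0\<^sup>0 = 1\<close>.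
\<close>

lemma raise_weight_integral:
  assumes "0 \<le> \<alpha>" "0 \<le> l" "0 < x" "0 \<le> \<mu>" "\<mu> \<le> x"
  defines "W \<equiv> (\<lambda>u. raise_weight \<alpha> l u * (if \<mu> \<le> x * u then (if l = 0 then 1 else (1 - \<mu> / (x * u)) powr l) else 0))"
  shows "integrable lborel W" "(LINT u|lborel. W u) = raise_const \<alpha> l * (1 - \<mu> / x) powr (\<alpha> + l + 1)"
proof -
  have Wm: "W \<in> borel_measurable lborel"
    unfolding W_def raise_weight_def[abs_def] by measurable
  show "integrable lborel W"
  proof (rule Bochner_Integration.integrable_bound[OF integrable_raise_weight[OF assms(1,2)]])
    have "norm (W u) \<le> norm (raise_weight \<alpha> l u)" for u
    proof -
      have "\<bar>if \<mu> \<le> x * u then (if l = 0 then 1 else (1 - \<mu> / (x * u)) powr l) else 0\<bar> \<le> 1"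
      proof (cases "\<mu> \<le> x * u \<and> x * u \<noteq> 0")
        case True
        moreover from this have "0 < x * u" using assms(4) by linarith
        ultimately have "0 \<le> \<mu> / (x * u)" "\<mu> / (x * u) \<le> 1"
          using assms(4) by (auto simp: divide_le_eq_1)
        then show ?thesis using assms by (auto intro!: powr_le1)
      qed (use assms in auto)
      then show ?thesis unfolding W_def by (simp add: abs_mult mult_left_le)
    qed
    then show "AE u in lborel. norm (W u) \<le> norm (raise_weight \<alpha> l u)" by simp
  qed (rule Wm)
  define v where "v = \<mu> / x"
  have v: "0 \<le> v" "v \<le> 1" using assms by (auto simp: v_def)
  define V where "V = (\<lambda>u. indicator {v..1} u * ((1 - u) powr \<alpha> * (u - v) powr l))"
  have "AE u in lborel. W u = V u"
  proof -
    have "AE u in lborel. u \<noteq> v" "AE u in lborel. u \<noteq> 0" by (rule AE_lborel_singleton)+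
    then show ?thesis
    proof eventually_elim
      case (elim u)
      have le: "\<mu> \<le> x * u \<longleftrightarrow> v \<le> u" using assms by (simp add: v_def field_simps)
      show ?case
      proof (cases "v < u \<and> u \<le> 1")
        case True
        then have u: "0 < u" using v by auto
        have "1 - \<mu> / (x * u) = (u - v) / u" using u assms by (simp add: v_def field_simps)
        then have "u powr l * (if l = 0 then 1 else (1 - \<mu> / (x * u)) powr l) = (u - v) powr l"
          using True u by (simp add: powr_divide)
        then show ?thesis using True u le by (simp add: W_def V_def raise_weight_def)
      next
        case False
        then have "u < v \<or> u > 1" using elim by auto
        then show ?thesis using le v by (auto simp: W_def V_def raise_weight_def)
      qed
    qed
  qed
  then have "(LINT u|lborel. W u) = (LINT u|lborel. V u)"
    using Wm by (intro integral_cong_AE) (auto simp: V_def)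
  also have "\<dots> = raise_const \<alpha> l * (1 - v) powr (\<alpha> + l + 1)"
  proof (cases "v = 1")
    case True
    have "AE u in lborel. V u = 0"
      using AE_lborel_singleton[of "1::real"] by eventually_elim (use True in \<open>auto simp: V_def\<close>)
    then have "(LINT u|lborel. V u) = (LINT u|(lborel :: real measure). 0)"
      by (intro integral_cong_AE) (auto simp: V_def)
    then show ?thesis using True by simp
  next
    case False
    then have v1: "v < 1" using v by simp
    have "(LINT u|lborel. V u) = \<bar>1 - v\<bar> *\<^sub>R (LINT w|lborel. V (v + (1 - v) * w))"
      using v1 by (intro lborel_integral_real_affine) simp
    also have "(\<lambda>w. V (v + (1 - v) * w)) = (\<lambda>w. (1 - v) powr (\<alpha> + l) * raise_weight \<alpha> l w)"
    proof
      fix w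
      have iff: "v + (1 - v) * w \<in> {v..1} \<longleftrightarrow> w \<in> {0..1}"
      proof -
        have "v + (1 - v) * w \<le> 1 \<longleftrightarrow> (1 - v) * w \<le> (1 - v) * 1" by (simp add: algebra_simps)
        then show ?thesis using v1 by (auto simp: zero_le_mult_iff mult_le_cancel_left)
      qed
      have "1 - (v + (1 - v) * w) = (1 - v) * (1 - w)" by (simp add: algebra_simps)
      then show "V (v + (1 - v) * w) = (1 - v) powr (\<alpha> + l) * raise_weight \<alpha> l w"
        using iff by (simp add: V_def raise_weight_def powr_mult powr_add indicator_def)
    qed
    finally show ?thesis
      using v1 by (simp add: raise_const_def powr_add)
  qed
  finally show "(LINT u|lborel. W u) = raise_const \<alpha> l * (1 - \<mu> / x) powr (\<alpha> + l + 1)"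
    by (simp add: v_def)
qed

lemma riesz_mean_raise:
  assumes fr: "frequency lam" and ge: "0 \<le> \<alpha>" "0 \<le> l" and x: "0 < x"
  shows "(\<lambda>u. of_real (raise_weight \<alpha> l u) * riesz_mean lam l a (x * u) s) \<in> borel_measurable lborel"
    and "of_real (raise_const \<alpha> l) * riesz_mean lam (\<alpha> + l + 1) a x s
      = (LINT u|lborel. of_real (raise_weight \<alpha> l u) * riesz_mean lam l a (x * u) s)"
proof -
  let ?F = "{n. lam n \<le> x}"
  define W where "W = (\<lambda>n u. raise_weight \<alpha> l u * (if lam n \<le> x * u then (if l = 0 then 1 else (1 - lam n / (x * u)) powr l) else 0))"
  have eq: "of_real (raise_weight \<alpha> l u) * riesz_mean lam l a (x * u) s
      = (\<Sum>n\<in>?F. of_real (W n u) * (a n * exp (- of_real (lam n) * s)))" for u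
  proof (cases "u \<in> {0..1}")
    case True
    then have sub: "{n. lam n \<le> x * u} \<subseteq> ?F"
      using x by (auto intro: order_trans[of _ "x * u"] simp: mult_left_le)
    have "of_real (raise_weight \<alpha> l u) * riesz_mean lam l a (x * u) s
      = (\<Sum>n | lam n \<le> x * u. of_real (W n u) * (a n * exp (- of_real (lam n) * s)))"
      unfolding riesz_mean_def riesz_weight_def sum_distrib_left
      by (intro sum.cong) (auto simp: W_def)
    also have "\<dots> = (\<Sum>n\<in>?F. of_real (W n u) * (a n * exp (- of_real (lam n) * s)))"
      by (rule sum.mono_neutral_left) (use sub frequency_facts(1)[OF fr] in \<open>auto simp: W_def\<close>)
    finally show ?thesis .
  qed (auto simp: raise_weight_def W_def)
  have W: "integrable lborel (W n)" "(LINT u|lborel. W n u) = raise_const \<alpha> l * (1 - lam n / x) powr (\<alpha> + l + 1)" if "n \<in> ?F" for n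
    using raise_weight_integral[OF ge x, of "lam n"] that frequency_facts(2)[OF fr] by (auto simp: W_def)
  have "(\<lambda>u. \<Sum>n\<in>?F. of_real (W n u) * (a n * exp (- of_real (lam n) * s))) \<in> borel_measurable lborel"
    using W(1) by (intro borel_measurable_sum borel_measurable_times) (auto dest: borel_measurable_integrable)
  then show "(\<lambda>u. of_real (raise_weight \<alpha> l u) * riesz_mean lam l a (x * u) s) \<in> borel_measurable lborel"
    by (simp only: eq)
  have "(LINT u|lborel. of_real (raise_weight \<alpha> l u) * riesz_mean lam l a (x * u) s)
      = (\<Sum>n\<in>?F. (LINT u|lborel. of_real (W n u) * (a n * exp (- of_real (lam n) * s))))"
    unfolding eq using W(1) by (intro Bochner_Integration.integral_sum integrable_mult_left integrable_of_real)
  also have "\<dots> = (\<Sum>n\<in>?F. of_real (raise_const \<alpha> l * (1 - lam n / x) powr (\<alpha> + l + 1)) * (a n * exp (- of_real (lam n) * s)))"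
    by (intro sum.cong refl) (simp add: W(2))
  also have "\<dots> = of_real (raise_const \<alpha> l) * riesz_mean lam (\<alpha> + l + 1) a x s"
    using ge unfolding riesz_mean_def riesz_weight_def sum_distrib_left
    by (intro sum.cong refl) (simp add: mult_ac)
  finally show "of_real (raise_const \<alpha> l) * riesz_mean lam (\<alpha> + l + 1) a x s
      = (LINT u|lborel. of_real (raise_weight \<alpha> l u) * riesz_mean lam l a (x * u) s)" ..
qed

lemma riesz_mean_raise_bound:
  assumes fr: "frequency lam" and ge: "0 \<le> \<alpha>" "0 \<le> l" and x: "0 < x"
    and M: "\<And>y. 0 < y \<Longrightarrow> norm (riesz_mean lam l a y s) \<le> M"
  shows "norm (riesz_mean lam (\<alpha> + l + 1) a x s) \<le> M"
proof -
  have M0: "0 \<le> M" using M[of 1] by (smt (verit) norm_ge_zero)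
  have pt: "norm (of_real (raise_weight \<alpha> l u) * riesz_mean lam l a (x * u) s) \<le> raise_weight \<alpha> l u * M" for u
  proof (cases "0 < u")
    case True
    then show ?thesis using M[of "x * u"] x raise_weight_bounds(1)[OF ge] by (simp add: norm_mult mult_left_mono)
  next
    case False
    then have "raise_weight \<alpha> l u = 0" by (auto simp: raise_weight_def indicator_def)
    then show ?thesis by simp
  qed
  have "raise_const \<alpha> l * norm (riesz_mean lam (\<alpha> + l + 1) a x s)
      = norm (LINT u|lborel. of_real (raise_weight \<alpha> l u) * riesz_mean lam l a (x * u) s)"
    using riesz_mean_raise(2)[OF fr ge x, of a s] raise_const_pos[OF ge]
    by (metis abs_of_pos norm_mult norm_of_real)
  also have "\<dots> \<le> (LINT u|lborel. raise_weight \<alpha> l u * M)"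
  proof (rule Bochner_Integration.integral_norm_bound_integral)
    show int: "integrable lborel (\<lambda>u. raise_weight \<alpha> l u * M)" using integrable_raise_weight[OF ge] by simp
    show "integrable lborel (\<lambda>u. of_real (raise_weight \<alpha> l u) * riesz_mean lam l a (x * u) s)"
      by (rule Bochner_Integration.integrable_bound[OF int riesz_mean_raise(1)[OF fr ge x]])
        (use pt in \<open>auto intro: order_trans[OF _ abs_ge_self]\<close>)
  qed (rule pt)
  also have "\<dots> = raise_const \<alpha> l * M" by (simp add: raise_const_def)
  finally show ?thesis using raise_const_pos[OF ge] by simp
qed

lemma riesz_mean_bounded:
  assumes fr: "frequency lam" and l: "0 \<le> l" and lim: "((\<lambda>x. riesz_mean lam l a x s) \<longlongrightarrow> L) at_top"
  shows "\<exists>M. \<forall>y>0. norm (riesz_mean lam l a y s) \<le> M"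
proof -
  have "eventually (\<lambda>x. dist (riesz_mean lam l a x s) L < 1) at_top"
    using lim by (rule tendstoD) simp
  then obtain X where X: "\<And>x. x \<ge> X \<Longrightarrow> dist (riesz_mean lam l a x s) L < 1"
    by (auto simp: eventually_at_top_linorder)
  define M1 where "M1 = (\<Sum>n | lam n \<le> X. norm (a n * exp (- of_real (lam n) * s)))"
  have M1: "0 \<le> M1" unfolding M1_def by (intro sum_nonneg) auto
  have "norm (riesz_mean lam l a y s) \<le> norm L + 1 + M1" if y: "y > 0" for y
  proof (cases "y \<ge> X")
    case True
    have "norm (riesz_mean lam l a y s) \<le> norm L + norm (riesz_mean lam l a y s - L)"
      by (metis add.commute diff_add_cancel norm_triangle_ineq)
    then show ?thesis using X[OF True] M1 by (simp add: dist_norm)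
  next
    case False
    have "norm (riesz_mean lam l a y s) \<le> (\<Sum>n | lam n \<le> y. norm (a n * exp (- of_real (lam n) * s)))"
      unfolding riesz_mean_def
    proof (rule sum_norm_le)
      fix n assume "n \<in> {n. lam n \<le> y}"
      then have "0 \<le> 1 - lam n / y" "1 - lam n / y \<le> 1" using y frequency_facts(2)[OF fr, of n] by auto
      then have "\<bar>riesz_weight lam l y n\<bar> \<le> 1" using l by (auto simp: riesz_weight_def intro!: powr_le1)
      then have "\<bar>riesz_weight lam l y n\<bar> * norm (a n * exp (- of_real (lam n) * s)) \<le> 1 * norm (a n * exp (- of_real (lam n) * s))"
        by (rule mult_right_mono) simp
      then show "norm (a n * of_real (riesz_weight lam l y n) * exp (- of_real (lam n) * s)) \<le> norm (a n * exp (- of_real (lam n) * s))"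
        by (simp add: norm_mult mult_ac)
    qed
    also have "\<dots> \<le> M1" unfolding M1_def
      by (intro sum_mono2 frequency_facts(1)[OF fr]) (use False in auto)
    finally show ?thesis by (smt (verit) norm_ge_zero)
  qed
  then show ?thesis by blast
qed

text \<open>
  This makes it possible to replace a real order of summability by an integer one, for which Taylor's formula is
  available.
\<close>

lemma riesz_mean_raise_limit:
  assumes fr: "frequency lam" and ge: "0 \<le> \<alpha>" "0 \<le> l"
    and lim: "((\<lambda>x. riesz_mean lam l a x s) \<longlongrightarrow> L) at_top"
  shows "((\<lambda>x. riesz_mean lam (\<alpha> + l + 1) a x s) \<longlongrightarrow> L) at_top"
proof -
  obtain M where M: "\<And>y. y > 0 \<Longrightarrow> norm (riesz_mean lam l a y s) \<le> M"
    using riesz_mean_bounded[OF fr ge(2) lim] by blast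
  define c where "c = raise_const \<alpha> l"
  have c: "c > 0" using raise_const_pos[OF ge] by (simp add: c_def)
  let ?g = "\<lambda>x u. of_real (raise_weight \<alpha> l u) * riesz_mean lam l a (max 1 x * u) s"
  have w0: "raise_weight \<alpha> l u = 0" if "u \<le> 0" for u using that by (auto simp: raise_weight_def indicator_def)
  have "((\<lambda>x. LINT u|lborel. ?g x u) \<longlongrightarrow> (LINT u|lborel. of_real (raise_weight \<alpha> l u) * L)) at_top"
  proof (rule integral_dominated_convergence_at_top)
    show "integrable lborel (\<lambda>u. raise_weight \<alpha> l u * M)" using integrable_raise_weight[OF ge] by simp
    show "(\<lambda>u. of_real (raise_weight \<alpha> l u) * L) \<in> borel_measurable lborel"
      using integrable_raise_weight[OF ge] by (auto dest!: borel_measurable_integrable)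
    show "?g x \<in> borel_measurable lborel" for x
      by (rule riesz_mean_raise(1)[OF fr ge]) simp
    show "AE u in lborel. ((\<lambda>x. ?g x u) \<longlongrightarrow> of_real (raise_weight \<alpha> l u) * L) at_top"
    proof (rule AE_I2)
      fix u :: real
      show "((\<lambda>x. ?g x u) \<longlongrightarrow> of_real (raise_weight \<alpha> l u) * L) at_top"
      proof (cases "u > 0")
        case True
        have "filterlim (\<lambda>x. max 1 x * u) at_top at_top"
          using True by (intro filterlim_at_top_mult_tendsto_pos[OF tendsto_const True]
              filterlim_at_top_mono[OF filterlim_ident]) auto
        then show ?thesis by (intro tendsto_intros filterlim_compose[OF lim])
      qed (simp add: w0)
    qed
    show "\<forall>\<^sub>F x in at_top. AE u in lborel. norm (?g x u) \<le> raise_weight \<alpha> l u * M"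
    proof (intro always_eventually allI AE_I2)
      fix x u :: real
      show "norm (?g x u) \<le> raise_weight \<alpha> l u * M"
      proof (cases "u > 0")
        case True
        then have "norm (riesz_mean lam l a (max 1 x * u) s) \<le> M" by (intro M) (auto simp: zero_less_mult_iff)
        then show ?thesis using raise_weight_bounds(1)[OF ge, of u] by (simp add: norm_mult mult_left_mono)
      qed (simp add: w0)
    qed
  qed
  also have "(LINT u|lborel. of_real (raise_weight \<alpha> l u) * L) = of_real c * L"
    by (simp add: c_def raise_const_def)
  finally have "((\<lambda>x. inverse (of_real c) * (LINT u|lborel. ?g x u)) \<longlongrightarrow> inverse (of_real c) * (of_real c * L)) at_top"
    by (intro tendsto_intros)
  also have "inverse (of_real c) * (of_real c * L) = L" using c by simp
  finally have "((\<lambda>x. inverse (of_real c) * (LINT u|lborel. ?g x u)) \<longlongrightarrow> L) at_top" .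
  moreover have "\<forall>\<^sub>F x in at_top. inverse (of_real c) * (LINT u|lborel. ?g x u) = riesz_mean lam (\<alpha> + l + 1) a x s"
    using eventually_ge_at_top[of 1]
  proof eventually_elim
    case (elim x)
    then show ?case using riesz_mean_raise(2)[OF fr ge, of x a s] c by (simp add: c_def[symmetric] max_def field_simps)
  qed
  ultimately show ?thesis by (rule Lim_transform_eventually)
qed

lemma higher_deriv_power_times_zero:
  assumes "h holomorphic_on UNIV" "j < m"
  shows "(deriv ^^ j) (\<lambda>z. z ^ m * h z) (0::complex) = 0"
  using assms
proof (induction j arbitrary: m h)
  case 0 then show ?case by simp
next
  case (Suc j)
  then obtain m' where m: "m = Suc m'" by (cases m) auto
  have hd: "(h has_field_derivative deriv h z) (at z)" for z
    using Suc.prems(1) by (simp add: holomorphic_derivI)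
  have "deriv (\<lambda>z. z ^ m * h z) = (\<lambda>z. z ^ m' * (of_nat m * h z + z * deriv h z))"
  proof
    fix z
    have "((\<lambda>z. z ^ m * h z) has_field_derivative z ^ m' * (of_nat m * h z + z * deriv h z)) (at z)"
      unfolding m by (rule DERIV_cong[OF DERIV_mult[OF DERIV_power_Suc[OF DERIV_ident] hd]]) (simp add: algebra_simps)
    then show "deriv (\<lambda>z. z ^ m * h z) z = z ^ m' * (of_nat m * h z + z * deriv h z)"
      by (rule DERIV_imp_deriv)
  qed
  moreover have "(deriv ^^ j) (\<lambda>z. z ^ m' * (of_nat m * h z + z * deriv h z)) 0 = 0"
    by (rule Suc.IH) (use Suc.prems m in \<open>auto intro!: holomorphic_intros\<close>)
  ultimately show ?case by (simp only: funpow_Suc_right comp_def)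
qed

text \<open>
  Taylor's formula with integral remainder at \<open>0\<close>, for a function whose Taylor polynomial vanishes
  there.
\<close>

lemma taylor_remainder_vanishing:
  fixes E :: "complex \<Rightarrow> complex"
  assumes hol: "E holomorphic_on UNIV" and z: "\<And>j. j \<le> q \<Longrightarrow> (deriv ^^ j) E 0 = 0" and b: "0 \<le> b"
  shows "((\<lambda>t. of_real ((b - t) ^ q / fact q) * (deriv ^^ Suc q) E (of_real t)) has_integral E (of_real b)) {0..b}"
proof -
  define Df where "Df = (\<lambda>m t. (deriv ^^ m) E (complex_of_real t))"
  have D: "(Df m has_vector_derivative Df (Suc m) t) (at t within {0..b})" for m t
  proof -
    have "((deriv ^^ m) E has_field_derivative (deriv ^^ Suc m) E (of_real t)) (at (of_real t))"
      using has_field_derivative_higher_deriv[OF hol] by auto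
    then show ?thesis unfolding Df_def by (rule has_vector_derivative_real_field)
  qed
  have "((\<lambda>t. ((b - t) ^ (Suc q - 1) / fact (Suc q - 1)) *\<^sub>R Df (Suc q) t) has_integral
     Df 0 b - (\<Sum>i<Suc q. ((b-0) ^ i / fact i) *\<^sub>R Df i 0)) {0..b}"
    by (rule Taylor_has_integral) (use D b in auto)
  also have "(\<Sum>i<Suc q. ((b-0) ^ i / fact i) *\<^sub>R Df i 0) = 0"
    by (intro sum.neutral ballI) (simp add: Df_def z)
  finally show ?thesis by (simp add: Df_def scaleR_conv_of_real)
qed

lemma power_le_fact_exp:
  fixes y :: real assumes "0 \<le> y"
  shows "y ^ q \<le> fact q * exp y"
proof -
  have "(\<Sum>n\<in>{q}. y ^ n /\<^sub>R fact n) \<le> exp y"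
    unfolding exp_def using assms summable_exp_generic[of y] by (intro sum_le_suminf) auto
  then show ?thesis by (simp add: field_simps)
qed

lemma riesz_weight_nat:
  assumes "1 \<le> q" "0 \<le> 1 - lam n / y"
  shows "riesz_weight lam (real q) y n = (1 - lam n / y) ^ q"
proof (cases "1 - lam n / y = 0")
  case True
  then show ?thesis using assms(1) by (simp add: riesz_weight_def power_0_left)
next
  case False
  then have "0 < 1 - lam n / y" using assms(2) by linarith
  then show ?thesis using assms(1) by (simp only: riesz_weight_def powr_realpow) simp
qed

text \<open>
  Bounded Riesz means of order \<open>q\<close> at \<open>s0\<close> control those of order \<open>q + 1\<close>
  far to the right of \<open>s0\<close>, with polynomial growth in \<open>w\<close>. The kernel \<open>(x -
  v)\<^bsup>q+1\<^esup> exp (- v w)\<close> vanishes at \<open>v = x\<close> together with its derivatives of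
  order up to \<open>q\<close>, so Taylor's formula represents it as a superposition of the kernels \<open>(y -
  v)\<^sup>q\<close>, weighted by its derivative of order \<open>q + 1\<close>. That derivative is estimated by
  Cauchy's inequality on a circle of radius \<open>1 / (1 + |w|)\<close>, on which the exponential hardly
  changes.
\<close>

lemma riesz_mean_twisted_bound:
  assumes fr: "frequency lam" and q: "1 \<le> q"
    and M: "\<And>y. 0 < y \<Longrightarrow> norm (riesz_mean lam (real q) a y s0) \<le> M"
    and x: "1 \<le> x" and w: "2 \<le> Re w"
  shows "norm (riesz_mean lam (real (Suc q)) a x (s0 + w)) \<le> M * exp 1 * fact (Suc q) * 2 ^ Suc q * (1 + norm w) ^ Suc q"
proof -
  let ?F = "{n. lam n \<le> x}"
  define b where "b = (\<lambda>n. a n * exp (- of_real (lam n) * s0))"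
  \<comment> \<open>In the variable \<open>t = x - v\<close>, so that the zero of order \<open>q + 1\<close> sits at
    \<open>0\<close>.\<close>
  define E where "E = (\<lambda>z. z ^ Suc q * exp (- ((of_real x - z) * w)))"
  define D where "D = (\<lambda>t. (deriv ^^ Suc q) E (complex_of_real t))"
  define S where "S = (\<lambda>y. \<Sum>n | lam n \<le> y. b n * of_real ((y - lam n) ^ q))"
  have M0: "0 \<le> M" using M[of 1] by (smt (verit) norm_ge_zero)
  have Ehol: "E holomorphic_on UNIV" unfolding E_def by (intro holomorphic_intros)
  have Ez: "(deriv ^^ j) E 0 = 0" if "j \<le> q" for j
    unfolding E_def by (rule higher_deriv_power_times_zero) (use that in \<open>auto intro!: holomorphic_intros\<close>)
  have S_bound: "norm (S y) \<le> M * y ^ q" if "0 \<le> y" for y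
  proof (cases "y = 0")
    case True
    have "S y = 0" unfolding S_def
    proof (rule sum.neutral, rule ballI)
      fix n assume "n \<in> {n. lam n \<le> y}"
      then have "lam n = 0" using True frequency_facts(2)[OF fr, of n] by simp
      then show "b n * of_real ((y - lam n) ^ q) = 0" using True q by (simp add: power_0_left)
    qed
    then show ?thesis using M0 that by simp
  next
    case False
    then have y: "0 < y" using that by simp
    have "S y = of_real (y ^ q) * riesz_mean lam (real q) a y s0"
      unfolding S_def riesz_mean_def sum_distrib_left
    proof (rule sum.cong[OF refl])
      fix n assume "n \<in> {n. lam n \<le> y}"
      then have n: "0 \<le> 1 - lam n / y" using y by simp
      have "riesz_weight lam (real q) y n = (1 - lam n / y) ^ q"
        using n q by (intro riesz_weight_nat)
      then have "y ^ q * riesz_weight lam (real q) y n = (y - lam n) ^ q"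
        using y by (simp add: field_simps flip: power_mult_distrib)
      then have "complex_of_real ((y - lam n) ^ q) = of_real (y ^ q) * of_real (riesz_weight lam (real q) y n)"
        by (simp only: of_real_mult[symmetric])
      then show "b n * of_real ((y - lam n) ^ q) = of_real (y ^ q) * (a n * of_real (riesz_weight lam (real q) y n) * exp (- of_real (lam n) * s0))"
        by (simp only: b_def mult_ac)
    qed
    then show ?thesis using M[OF y] y by (simp add: norm_mult norm_power mult.commute mult_left_mono)
  qed
  have D_bound: "norm (D t) \<le> fact (Suc q) * ((x + 1) ^ Suc q * exp (1 - 2 * (x - t))) * (1 + norm w) ^ Suc q" if t: "t \<in> {0..x}" for t
  proof -
    define r where "r = 1 / (1 + norm w)"
    have r: "0 < r" "r \<le> 1" "r * norm w \<le> 1" by (auto simp: r_def field_simps add_nonneg_pos add_pos_nonneg)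
    have "norm (D t) \<le> fact (Suc q) * ((x + 1) ^ Suc q * exp (1 - 2 * (x - t))) / r ^ Suc q"
      unfolding D_def
    proof (rule Cauchy_inequality)
      show "E holomorphic_on ball (complex_of_real t) r" using Ehol holomorphic_on_subset by blast
      show "continuous_on (cball (complex_of_real t) r) E"
        using holomorphic_on_imp_continuous_on[OF Ehol] continuous_on_subset by blast
      fix z assume z: "norm (complex_of_real t - z) = r"
      have "norm z \<le> norm (complex_of_real t) + norm (complex_of_real t - z)"
        by (metis norm_minus_commute norm_triangle_sub)
      then have z1: "norm z \<le> x + 1" using t r z by simp
      have "- Re ((of_real x - z) * w) = - ((x - t) * Re w) + - Re ((of_real t - z) * w)"
        by (simp add: algebra_simps)
      also have "\<dots> \<le> - ((x - t) * 2) + 1"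
      proof (rule add_mono)
        show "- ((x - t) * Re w) \<le> - ((x - t) * 2)" using w t mult_left_mono[of 2 "Re w" "x - t"] by simp
        have "- Re ((of_real t - z) * w) \<le> norm ((of_real t - z) * w)"
          using complex_Re_le_cmod[of "- ((of_real t - z) * w)"] by simp
        also have "\<dots> \<le> 1" using z r by (simp add: norm_mult)
        finally show "- Re ((of_real t - z) * w) \<le> 1" .
      qed
      finally have "exp (- Re ((of_real x - z) * w)) \<le> exp (1 - 2 * (x - t))" by (simp add: algebra_simps)
      then show "norm (E z) \<le> (x + 1) ^ Suc q * exp (1 - 2 * (x - t))"
        unfolding E_def norm_mult norm_power norm_exp_eq_Re
        using z1 x by (intro mult_mono power_mono zero_le_power) auto
    qed (use r in auto)
    then show ?thesis by (simp add: r_def power_divide)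
  qed
  define B where "B = M * fact (Suc q) * (x + 1) ^ Suc q * exp 1 * (1 + norm w) ^ Suc q"
  define I where "I = (\<lambda>t. of_real (1 / fact q) * S (x - t) * D t)"
  have hI: "(I has_integral (\<Sum>n\<in>?F. b n * E (of_real (x - lam n)))) {0..x}"
  proof -
    have 1: "((\<lambda>t. b n * (if t \<in> {0..x - lam n} then of_real ((x - lam n - t) ^ q / fact q) * D t else 0)) has_integral
          b n * E (of_real (x - lam n))) {0..x}" if "n \<in> ?F" for n
    proof (rule has_integral_mult_right)
      have "((\<lambda>t. of_real ((x - lam n - t) ^ q / fact q) * D t) has_integral E (of_real (x - lam n))) {0..x - lam n}"
        unfolding D_def by (rule taylor_remainder_vanishing[OF Ehol Ez]) (use that in auto)
      then show "((\<lambda>t. if t \<in> {0..x - lam n} then of_real ((x - lam n - t) ^ q / fact q) * D t else 0) has_integral E (of_real (x - lam n))) {0..x}"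
        using frequency_facts(2)[OF fr, of n] by (subst has_integral_restrict) auto
    qed
    have "((\<lambda>t. \<Sum>n\<in>?F. b n * (if t \<in> {0..x - lam n} then of_real ((x - lam n - t) ^ q / fact q) * D t else 0)) has_integral
       (\<Sum>n\<in>?F. b n * E (of_real (x - lam n)))) {0..x}"
      by (rule has_integral_sum[OF frequency_facts(1)[OF fr] 1])
    moreover have "(\<Sum>n\<in>?F. b n * (if t \<in> {0..x - lam n} then of_real ((x - lam n - t) ^ q / fact q) * D t else 0)) = I t"
      if t: "t \<in> {0..x}" for t
    proof -
      have "(\<Sum>n\<in>?F. b n * (if t \<in> {0..x - lam n} then of_real ((x - lam n - t) ^ q / fact q) * D t else 0))
        = (\<Sum>n | lam n \<le> x - t. b n * (of_real ((x - t - lam n) ^ q / fact q) * D t))"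
        using t frequency_facts(1)[OF fr, of x] by (intro sum.mono_neutral_cong_right) (auto simp: algebra_simps)
      also have "\<dots> = I t" unfolding I_def S_def sum_distrib_left sum_distrib_right
        by (intro sum.cong refl) simp
      finally show ?thesis .
    qed
    ultimately show ?thesis by (rule has_integral_eq[rotated]) auto
  qed
  have hB: "((\<lambda>t. B * exp (t - x)) has_integral B * (exp 0 - exp (0 - x))) {0..x}"
  proof -
    have "((\<lambda>t. B * exp (t - x)) has_integral B * exp (x - x) - B * exp (0 - x)) {0..x}"
      using x by (intro fundamental_theorem_of_calculus) (auto intro!: derivative_eq_intros simp: has_real_derivative_iff_has_vector_derivative[symmetric])
    then show ?thesis by (simp add: algebra_simps)
  qed
  have ptw: "norm (I t) \<le> B * exp (t - x)" if t: "t \<in> {0..x}" for t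
  proof -
    have "norm (I t) = 1 / fact q * norm (S (x - t)) * norm (D t)" by (simp add: I_def norm_mult norm_divide)
    also have "\<dots> \<le> 1 / fact q * (M * (fact q * exp (x - t))) * (fact (Suc q) * ((x + 1) ^ Suc q * exp (1 - 2 * (x - t))) * (1 + norm w) ^ Suc q)"
    proof (intro mult_mono order_refl D_bound t)
      have "norm (S (x - t)) \<le> M * (x - t) ^ q" using t by (intro S_bound) auto
      also have "\<dots> \<le> M * (fact q * exp (x - t))" using t M0 by (intro mult_left_mono power_le_fact_exp) auto
      finally show "norm (S (x - t)) \<le> M * (fact q * exp (x - t))" .
    qed (use M0 x in auto)
    also have "\<dots> = M * fact (Suc q) * (x + 1) ^ Suc q * (1 + norm w) ^ Suc q * (exp (x - t) * exp (1 - 2 * (x - t)))"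
      by simp
    also have "exp (x - t) * exp (1 - 2 * (x - t)) = exp 1 * exp (t - x)" by (simp add: mult_exp_exp algebra_simps)
    finally show ?thesis by (simp only: B_def mult_ac)
  qed
  have "norm (\<Sum>n\<in>?F. b n * E (of_real (x - lam n))) \<le> B * (exp 0 - exp (0 - x))"
    using Henstock_Kurzweil_Integration.integral_norm_bound_integral
      [OF has_integral_integrable[OF hI] has_integral_integrable[OF hB] ptw]
    unfolding integral_unique[OF hI] integral_unique[OF hB] .
  also have "\<dots> \<le> B" using M0 x by (simp add: B_def mult_left_le)
  finally have main: "norm (\<Sum>n\<in>?F. b n * E (of_real (x - lam n))) \<le> B" .
  have "(\<Sum>n\<in>?F. b n * E (of_real (x - lam n))) = of_real (x ^ Suc q) * riesz_mean lam (real (Suc q)) a x (s0 + w)"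
    unfolding riesz_mean_def sum_distrib_left
  proof (rule sum.cong[OF refl])
    fix n assume "n \<in> ?F"
    then have n: "0 \<le> 1 - lam n / x" using x by simp
    have "riesz_weight lam (real (Suc q)) x n = (1 - lam n / x) ^ Suc q"
      using n by (intro riesz_weight_nat) auto
    then have "x ^ Suc q * riesz_weight lam (real (Suc q)) x n = (x - lam n) ^ Suc q"
      using x by (simp add: field_simps flip: power_mult_distrib del: power_Suc)
    then have 1: "complex_of_real ((x - lam n) ^ Suc q) = of_real (x ^ Suc q) * of_real (riesz_weight lam (real (Suc q)) x n)"
      by (simp only: of_real_mult[symmetric])
    have 2: "exp (- of_real (lam n) * s0) * exp (- ((of_real x - of_real (x - lam n)) * w)) = exp (- of_real (lam n) * (s0 + w))"
      by (simp add: mult_exp_exp algebra_simps)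
    have "b n * E (of_real (x - lam n)) = a n * (complex_of_real ((x - lam n) ^ Suc q)) * (exp (- of_real (lam n) * s0) * exp (- ((of_real x - of_real (x - lam n)) * w)))"
      by (simp only: b_def E_def of_real_power mult_ac)
    then show "b n * E (of_real (x - lam n)) = of_real (x ^ Suc q) * (a n * of_real (riesz_weight lam (real (Suc q)) x n) * exp (- of_real (lam n) * (s0 + w)))"
      unfolding 1 2 by (simp only: mult_ac)
  qed
  then have "x ^ Suc q * norm (riesz_mean lam (real (Suc q)) a x (s0 + w)) \<le> B"
    using main x by (simp add: norm_mult norm_power)
  also have "B \<le> x ^ Suc q * (M * exp 1 * fact (Suc q) * 2 ^ Suc q * (1 + norm w) ^ Suc q)"
  proof -
    have "(x + 1) ^ Suc q \<le> (2 * x) ^ Suc q" using x by (intro power_mono) auto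
    also have "\<dots> = x ^ Suc q * 2 ^ Suc q" by (simp only: power_mult_distrib mult_ac)
    finally have "(M * fact (Suc q) * exp 1 * (1 + norm w) ^ Suc q) * (x + 1) ^ Suc q \<le> (M * fact (Suc q) * exp 1 * (1 + norm w) ^ Suc q) * (x ^ Suc q * 2 ^ Suc q)"
      using M0 by (intro mult_left_mono) auto
    then show ?thesis by (simp only: B_def mult_ac)
  qed
  finally show ?thesis using x by (simp del: power_Suc)
qed


section \<open>The kernel formula\<close>

text \<open>
  Fourier inversion for \<open>b v * exp (c * v)\<close>: at \<open>v = u\<close> the weight is undone by the
  factor \<open>exp (- u * c)\<close>.
\<close>

lemma inversion_on_vertical_line:
  assumes L: "2 \<le> L" and b: "Ck L UNIV b" "\<And>v. K < \<bar>v\<bar> \<Longrightarrow> b v = 0"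
  shows "integrable lborel (\<lambda>t. laplace b (- vline c t) * exp (- of_real u * vline c t))"
    and "(LINT t|lborel. laplace b (- vline c t) * exp (- of_real u * vline c t)) = of_real (2 * pi * b u)"
proof -
  define g where "g = (\<lambda>v. b v * exp (c * v))"
  have g: "Ck L UNIV g" "\<And>v. K < \<bar>v\<bar> \<Longrightarrow> g v = 0"
    using b by (auto simp: g_def intro!: Ck_mult Ck_exp)
  have ftg: "laplace b (- vline c t) = laplace g (- (\<i> * of_real t))" for t
    unfolding laplace_def
    by (intro Bochner_Integration.integral_cong refl)
       (simp add: g_def exp_of_real[symmetric] mult_exp_exp algebra_simps)
  have hol: "laplace g holomorphic_on UNIV" by (rule laplace_holomorphic[OF Ck_imp_continuous[OF g(1)] g(2)])
  have cont: "continuous_on UNIV (\<lambda>t. laplace g (\<i> * of_real t))"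
    by (intro continuous_on_compose2[OF holomorphic_on_imp_continuous_on[OF hol]] continuous_intros) auto
  obtain C where C: "\<And>m z. m + 2 \<le> real L \<Longrightarrow> norm (laplace g z) * (1 + norm z) powr m \<le> C * exp (K * \<bar>Re z\<bar>) / (1 + (Im z)\<^sup>2)"
    using laplace_weighted_decay[where K = K, OF g] by auto
  have int: "integrable lborel (\<lambda>t. laplace g (\<i> * of_real t))"
  proof (rule integrable_of_decay[OF cont])
    show "norm (laplace g (\<i> * of_real t)) \<le> C / (1 + t\<^sup>2)" for t
    proof -
      have "1 + norm (\<i> * of_real t) \<noteq> 0" by (smt (verit) norm_ge_zero)
      then show ?thesis using C[of 0 "\<i> * of_real t"] L by simp
    qed
  qed
  have eq: "laplace b (- vline c t) * exp (- of_real u * vline c t)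
      = of_real (exp (- u * c)) * (laplace g (\<i> * of_real (0 + (-1) * t)) * exp (\<i> * of_real ((0 + (-1) * t) * u)))" for t
  proof -
    have "exp (- of_real u * vline c t) = of_real (exp (- u * c)) * exp (\<i> * of_real ((0 + (-1) * t) * u))"
      by (simp add: exp_of_real[symmetric] mult_exp_exp algebra_simps)
    then show ?thesis using ftg[of t] by simp
  qed
  let ?F = "\<lambda>t. laplace g (\<i> * of_real t) * exp (\<i> * of_real (t * u))"
  have intF: "integrable lborel ?F"
  proof (rule Bochner_Integration.integrable_bound[OF int])
    show "?F \<in> borel_measurable lborel" using int by (auto dest: borel_measurable_integrable)
    show "AE t in lborel. norm (?F t) \<le> norm (laplace g (\<i> * of_real t))"
      by (intro AE_I2) (simp add: norm_mult)
  qed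
  have intF': "integrable lborel (\<lambda>t. ?F (0 + (-1) * t))"
    using lborel_integrable_real_affine[OF intF, of "-1" 0] by simp
  then show "integrable lborel (\<lambda>t. laplace b (- vline c t) * exp (- of_real u * vline c t))"
    unfolding eq by (rule integrable_mult_right)
  have "(LINT t|lborel. laplace b (- vline c t) * exp (- of_real u * vline c t))
      = of_real (exp (- u * c)) * (LINT t|lborel. ?F (0 + (-1) * t))"
    unfolding eq by (rule integral_mult_right_zero)
  also have "(LINT t|lborel. ?F (0 + (-1) * t)) = (LINT t|lborel. ?F t)"
    using lborel_integral_real_affine[of "-1" ?F 0] by simp
  also have "\<dots> = of_real (2 * pi * g u)"
    by (rule fourier_inversion[OF Ck_imp_continuous[OF g(1)] g(2) int])
  also have "of_real (exp (- u * c)) * complex_of_real (2 * pi * g u) = of_real (2 * pi * b u)"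
  proof -
    have "exp (- u * c) * (2 * pi * g u) = 2 * pi * b u * (exp (- u * c) * exp (c * u))"
      by (simp add: g_def)
    also have "exp (- u * c) * exp (c * u) = 1" by (simp add: mult_exp_exp)
    finally show ?thesis by (simp only: of_real_mult[symmetric] mult_1_right)
  qed
  finally show "(LINT t|lborel. laplace b (- vline c t) * exp (- of_real u * vline c t)) = of_real (2 * pi * b u)" .
qed

text \<open>
  The common situation of the following estimates: the Riesz means of some order \<open>l\<close> converge to
  \<open>f\<close> far to the right, and \<open>f\<close> extends with growth of order \<open>k\<close> to
  \<open>Re s > \<theta>\<close>. The number \<open>L\<close> is a class of smoothness of kernels for which all
  integrals converge absolutely.
\<close>

locale riesz_extension =
  fixes lam :: "nat \<Rightarrow> real" and a :: "nat \<Rightarrow> complex" and f :: "complex \<Rightarrow> complex"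
    and \<theta> \<sigma>1 l M k :: real and L :: nat
  assumes fr: "frequency lam"
    and l: "0 \<le> l" and k: "0 \<le> k" and M: "0 \<le> M"
    and lim: "\<And>s. \<sigma>1 < Re s \<Longrightarrow> ((\<lambda>x. riesz_mean lam l a x s) \<longlongrightarrow> f s) at_top"
    and hol: "f holomorphic_on {s. \<theta> < Re s}"
    and growth: "\<And>s. \<theta> < Re s \<Longrightarrow> norm (f s) \<le> M * (1 + norm s) powr k"
    and L: "k + 2 \<le> real L" "l + 5 \<le> real L"
begin

abbreviation kernel_sum :: "real \<Rightarrow> (nat \<Rightarrow> real) \<Rightarrow> complex" where
  "kernel_sum X w \<equiv> \<Sum>n | lam n \<le> X. a n * of_real (w n)"

abbreviation gap_sum :: "nat \<Rightarrow> nat \<Rightarrow> real" where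
  "gap_sum p m \<equiv> \<Sum>j\<in>{p<..<m}. (lam j - lam p) / freq_gap lam j"

text \<open>
  On a line \<open>Re s = c1\<close> far to the right, \<open>f\<close> is the limit of Riesz means of integer
  order \<open>q + 1\<close>. For these finite sums the formula is Fourier inversion, and the limit may be taken
  under the integral by \<open>riesz_mean_twisted_bound\<close>. Decay of the transform then allows to shift the
  line to any \<open>c > \<theta>\<close>.
\<close>

lemma perron_pairing:
  assumes \<psi>: "Ck L UNIV \<psi>" "\<And>v. K < \<bar>v\<bar> \<Longrightarrow> \<psi> v = 0" and X: "\<And>v. X < v \<Longrightarrow> \<psi> v = 0" and c: "\<theta> < c"
  shows "kernel_sum X (\<lambda>n. \<psi> (lam n))
     = of_real (1 / (2 * pi)) * (LINT t|lborel. f (vline c t) * laplace \<psi> (- vline c t))"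
proof -
  \<comment> \<open>Raising the order requires \<open>q \<ge> l + 1\<close>, and convergence of the integrals requires
    \<open>q + 3 \<le> L\<close>.\<close>
  define q where "q = nat \<lceil>l\<rceil> + 1"
  have q: "1 \<le> q" "l + 1 \<le> real q" "real q \<le> l + 2" using l by (auto simp: q_def) linarith+
  define s0 where "s0 = complex_of_real (max \<sigma>1 \<theta> + 1)"
  \<comment> \<open>The summand 2 is the distance from \<open>s0\<close> required by
    \<open>riesz_mean_twisted_bound\<close>.\<close>
  define c1 where "c1 = max c (Re s0 + 2)"
  have c1: "c \<le> c1" "\<theta> < c1" "\<sigma>1 < c1" "Re s0 + 2 \<le> c1" using c by (auto simp: c1_def s0_def)
  let ?l1 = "vline c1"
  define H where "H = (\<lambda>s. f s * laplace \<psi> (- s))"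
  have \<psi>c: "continuous_on UNIV \<psi>" by (rule Ck_imp_continuous[OF \<psi>(1)])
  have fthol: "laplace \<psi> holomorphic_on UNIV" by (rule laplace_holomorphic[OF \<psi>c \<psi>(2)])
  have ftcont: "continuous_on UNIV (\<lambda>t. laplace \<psi> (- ?l1 t))"
    by (intro continuous_on_compose2[OF holomorphic_on_imp_continuous_on[OF fthol]] continuous_intros) auto
  have "uminus holomorphic_on (UNIV :: complex set)" by (intro holomorphic_on_minus holomorphic_on_ident)
  then have "(\<lambda>s. laplace \<psi> (- s)) holomorphic_on UNIV"
    using holomorphic_on_compose_gen[of uminus UNIV "laplace \<psi>" UNIV] fthol by (simp add: comp_def)
  then have Hhol: "H holomorphic_on {s. \<theta> < Re s}"
    unfolding H_def by (intro holomorphic_on_mult hol) (auto intro: holomorphic_on_subset)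
  have "\<psi> v = 0" if "\<bar>K\<bar> < \<bar>v\<bar>" for v using that by (intro \<psi>(2)) linarith
  from laplace_weighted_decay[where K = "\<bar>K\<bar>", OF \<psi>(1) this]
  obtain C where C: "C \<ge> 0" "\<And>m z. m + 2 \<le> real L \<Longrightarrow>
      norm (laplace \<psi> z) * (1 + norm z) powr m \<le> C * exp (\<bar>K\<bar> * \<bar>Re z\<bar>) / (1 + (Im z)\<^sup>2)" by auto
  have ftb: "norm (laplace \<psi> (- s)) * (1 + norm s) powr m \<le> C * exp (\<bar>K\<bar> * \<bar>Re s\<bar>) / (1 + (Im s)\<^sup>2)" if "m + 2 \<le> real L" for s m
    using C(2)[OF that, of "- s"] by simp
  define R where "R = max \<bar>c\<bar> \<bar>c1\<bar>"
  have shift: "(LINT t|lborel. H (vline c t)) = (LINT t|lborel. H (?l1 t))"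
  proof (rule line_integral_shift[OF Hhol c c1(1)])
    fix s assume s: "c \<le> Re s" "Re s \<le> c1"
    have "norm (H s) \<le> M * (1 + norm s) powr k * norm (laplace \<psi> (- s))"
      unfolding H_def norm_mult using s c by (intro mult_right_mono growth) auto
    also have "\<dots> = M * (norm (laplace \<psi> (- s)) * (1 + norm s) powr k)" by simp
    also have "\<dots> \<le> M * (C * exp (\<bar>K\<bar> * \<bar>Re s\<bar>) / (1 + (Im s)\<^sup>2))"
      by (intro mult_left_mono ftb L M)
    also have "\<dots> \<le> M * (C * exp (\<bar>K\<bar> * R) / (1 + (Im s)\<^sup>2))"
    proof -
      have "\<bar>Re s\<bar> \<le> R" using s by (auto simp: R_def)
      then show ?thesis using M C(1) by (intro mult_left_mono divide_right_mono) (auto intro!: mult_left_mono)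
    qed
    finally show "norm (H s) \<le> M * (C * exp (\<bar>K\<bar> * R)) / (1 + (Im s)\<^sup>2)" by simp
  qed
  let ?r = "\<lambda>x s. riesz_mean lam (real (Suc q)) a x s"
  have rlim: "((\<lambda>x. ?r x s) \<longlongrightarrow> f s) at_top" if "\<sigma>1 < Re s" for s
    using riesz_mean_raise_limit[OF fr _ l lim[OF that], of "real q - l"] q by (simp add: add.commute)
  have s0: "\<sigma>1 < Re s0" by (simp add: s0_def)
  obtain M0 where M0: "\<And>y. y > 0 \<Longrightarrow> norm (riesz_mean lam l a y s0) \<le> M0"
    using riesz_mean_bounded[OF fr l lim[OF s0]] by blast
  have M1: "norm (riesz_mean lam (real q) a y s0) \<le> M0" if "y > 0" for y
    using riesz_mean_raise_bound[OF fr _ l that M0, of "real q - l - 1"] q by simp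
  have M0': "0 \<le> M0" using M0[of 1] by (smt (verit) norm_ge_zero)
  define B where "B = M0 * exp 1 * fact (Suc q) * 2 ^ Suc q"
  have B0: "B \<ge> 0" using M0' by (simp add: B_def)
  have rb: "norm (?r x (?l1 t)) \<le> B * ((1 + norm s0) ^ Suc q * (1 + norm (?l1 t)) powr (real (Suc q)))" if "1 \<le> x" for x t
  proof -
    have "norm (?r x (s0 + (?l1 t - s0))) \<le> B * (1 + norm (?l1 t - s0)) ^ Suc q"
      unfolding B_def by (rule riesz_mean_twisted_bound[OF fr q(1) M1 that]) (use c1 in auto)
    also have "\<dots> \<le> B * ((1 + norm s0) * (1 + norm (?l1 t))) ^ Suc q"
    proof (intro mult_left_mono power_mono B0)
      have "norm (?l1 t - s0) \<le> norm (?l1 t) + norm s0" by (rule norm_triangle_ineq4)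
      moreover have "0 \<le> norm s0 * norm (?l1 t)" by simp
      ultimately show "1 + norm (?l1 t - s0) \<le> (1 + norm s0) * (1 + norm (?l1 t))"
        unfolding ring_distribs mult_1_left mult_1_right by linarith
    qed auto
    also have "\<dots> = B * ((1 + norm s0) ^ Suc q * (1 + norm (?l1 t)) powr (real (Suc q)))"
      by (simp add: power_mult_distrib powr_realpow add_pos_nonneg del: power_Suc of_nat_Suc)
    finally show ?thesis by simp
  qed
  define J where "J = (\<lambda>x. LINT t|lborel. ?r x (?l1 t) * laplace \<psi> (- ?l1 t))"
  have Jlim: "(J \<longlongrightarrow> (LINT t|lborel. H (?l1 t))) at_top"
    unfolding J_def
  proof (rule integral_dominated_convergence_at_top)
    show "integrable lborel (\<lambda>t. (B * (1 + norm s0) ^ Suc q * (C * exp (\<bar>K\<bar> * \<bar>c1\<bar>))) / (1 + t\<^sup>2))"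
      by (rule integrable_inverse_1_plus_square_UNIV)
    have "continuous_on UNIV (\<lambda>t. H (?l1 t))"
      using c1 by (intro continuous_on_compose2[OF holomorphic_on_imp_continuous_on[OF Hhol]] continuous_intros) auto
    then show "(\<lambda>t. H (?l1 t)) \<in> borel_measurable lborel" by (simp add: borel_measurable_continuous_onI)
    have "continuous_on UNIV (\<lambda>t. ?r x (?l1 t) * laplace \<psi> (- ?l1 t))" for x
      unfolding riesz_mean_def by (intro continuous_on_mult ftcont) (intro continuous_intros)
    then show "(\<lambda>t. ?r x (?l1 t) * laplace \<psi> (- ?l1 t)) \<in> borel_measurable lborel" for x
      by (simp add: borel_measurable_continuous_onI)
    show "AE t in lborel. ((\<lambda>x. ?r x (?l1 t) * laplace \<psi> (- ?l1 t)) \<longlongrightarrow> H (?l1 t)) at_top"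
      unfolding H_def using c1 by (intro AE_I2 tendsto_mult tendsto_const rlim) auto
    show "\<forall>\<^sub>F x in at_top. AE t in lborel. norm (?r x (?l1 t) * laplace \<psi> (- ?l1 t))
          \<le> (B * (1 + norm s0) ^ Suc q * (C * exp (\<bar>K\<bar> * \<bar>c1\<bar>))) / (1 + t\<^sup>2)"
      using eventually_ge_at_top[of 1]
    proof eventually_elim
      case (elim x)
      show ?case
      proof (rule AE_I2)
        fix t
        have "norm (?r x (?l1 t) * laplace \<psi> (- ?l1 t)) \<le> (B * ((1 + norm s0) ^ Suc q * (1 + norm (?l1 t)) powr (real (Suc q)))) * norm (laplace \<psi> (- ?l1 t))"
          unfolding norm_mult by (intro mult_right_mono rb elim) auto
        also have "\<dots> = (B * (1 + norm s0) ^ Suc q) * (norm (laplace \<psi> (- ?l1 t)) * (1 + norm (?l1 t)) powr (real (Suc q)))"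
          by (simp only: mult_ac)
        also have "\<dots> \<le> (B * (1 + norm s0) ^ Suc q) * (C * exp (\<bar>K\<bar> * \<bar>Re (?l1 t)\<bar>) / (1 + (Im (?l1 t))\<^sup>2))"
          using q L B0 by (intro mult_left_mono ftb) auto
        finally show "norm (?r x (?l1 t) * laplace \<psi> (- ?l1 t)) \<le> (B * (1 + norm s0) ^ Suc q * (C * exp (\<bar>K\<bar> * \<bar>c1\<bar>))) / (1 + t\<^sup>2)"
          by simp
      qed
    qed
  qed
  have Jeq: "J x = (\<Sum>n | lam n \<le> x. a n * of_real (riesz_weight lam (real (Suc q)) x n) * of_real (2 * pi * \<psi> (lam n)))" for x
  proof -
    have L2: "2 \<le> L" using L k by linarith
    have "J x = (LINT t|lborel. (\<Sum>n | lam n \<le> x. a n * of_real (riesz_weight lam (real (Suc q)) x n) *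
        (laplace \<psi> (- ?l1 t) * exp (- of_real (lam n) * ?l1 t))))"
      unfolding J_def riesz_mean_def sum_distrib_right
      by (intro Bochner_Integration.integral_cong refl sum.cong) (simp only: mult_ac)
    also have "\<dots> = (\<Sum>n | lam n \<le> x. (LINT t|lborel. a n * of_real (riesz_weight lam (real (Suc q)) x n) *
        (laplace \<psi> (- ?l1 t) * exp (- of_real (lam n) * ?l1 t))))"
      by (intro Bochner_Integration.integral_sum integrable_mult_right inversion_on_vertical_line(1)[OF L2 \<psi>])
    also have "\<dots> = (\<Sum>n | lam n \<le> x. a n * of_real (riesz_weight lam (real (Suc q)) x n) * of_real (2 * pi * \<psi> (lam n)))"
      by (intro sum.cong refl) (simp only: integral_mult_right_zero inversion_on_vertical_line(2)[OF L2 \<psi>])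
    finally show ?thesis .
  qed
  have "\<forall>\<^sub>F x in at_top. (\<Sum>n | lam n \<le> X. a n * of_real ((1 - lam n / x) powr real (Suc q)) * of_real (2 * pi * \<psi> (lam n))) = J x"
    using eventually_ge_at_top[of X]
  proof eventually_elim
    case (elim x)
    have "J x = (\<Sum>n | lam n \<le> X. a n * of_real (riesz_weight lam (real (Suc q)) x n) * of_real (2 * pi * \<psi> (lam n)))"
      unfolding Jeq using elim X frequency_facts(1)[OF fr] by (intro sum.mono_neutral_right) auto
    then show ?case by (simp add: riesz_weight_def)
  qed
  moreover have "((\<lambda>x. \<Sum>n | lam n \<le> X. a n * of_real ((1 - lam n / x) powr real (Suc q)) * of_real (2 * pi * \<psi> (lam n)))
      \<longlongrightarrow> (\<Sum>n | lam n \<le> X. a n * of_real ((1 - 0) powr real (Suc q)) * of_real (2 * pi * \<psi> (lam n)))) at_top"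
    by (intro tendsto_sum tendsto_mult tendsto_const tendsto_of_real tendsto_powr tendsto_diff
        tendsto_divide_0[OF tendsto_const] filterlim_at_top_imp_at_infinity filterlim_ident) auto
  ultimately have "(J \<longlongrightarrow> (\<Sum>n | lam n \<le> X. a n * of_real ((1 - 0) powr real (Suc q)) * of_real (2 * pi * \<psi> (lam n)))) at_top"
    by (rule Lim_transform_eventually[rotated])
  from tendsto_unique[OF _ this Jlim]
  have "kernel_sum X (\<lambda>n. 2 * pi * \<psi> (lam n)) = (LINT t|lborel. H (vline c t))"
    by (simp add: shift)
  also have "kernel_sum X (\<lambda>n. 2 * pi * \<psi> (lam n)) = of_real (2 * pi) * kernel_sum X (\<lambda>n. \<psi> (lam n))"
    unfolding sum_distrib_left by (intro sum.cong refl) (simp add: mult_ac)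
  finally show ?thesis by (simp add: H_def field_simps)
qed
end


section \<open>Sums against smooth kernels\<close>

context riesz_extension
begin

text \<open>
  Frequencies up to \<open>1 / h\<close> contribute to the transform of a window of width \<open>h\<close>, and
  there \<open>f\<close> is of size \<open>(1 + 1 / h)\<^sup>k\<close>. The factor \<open>exp (c y)\<close>
  stems from evaluating the kernel formula on \<open>Re s = c\<close>; for negative \<open>c\<close> it is a
  gain.
\<close>

lemma local_mean_bound:
  assumes b: "Ck L UNIV b" "\<And>v. K < \<bar>v\<bar> \<Longrightarrow> b v = 0" and K: "0 \<le> K" and c: "\<theta> < c"
  shows "\<exists>C\<ge>0. \<forall>y h X. 0 < h \<longrightarrow> (\<forall>v>X. b ((y - v) / h) = 0) \<longrightarrow>
    norm (kernel_sum X (\<lambda>n. b ((y - lam n) / h))) \<le> C * (1 + 1 / h) powr k * exp (c * y + K * \<bar>c\<bar> * h)"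
proof -
  obtain C where C: "C \<ge> 0" "\<And>m z. m + 2 \<le> real L \<Longrightarrow>
      norm (laplace b z) * (1 + norm z) powr m \<le> C * exp (K * \<bar>Re z\<bar>) / (1 + (Im z)\<^sup>2)"
    using laplace_weighted_decay[where K = K, OF b] by auto
  define I0 where "I0 = (LINT t|lborel. 1 / (1 + t\<^sup>2 :: real))"
  have I0: "I0 \<ge> 0" unfolding I0_def by (intro integral_nonneg_AE AE_I2) simp
  have "norm (kernel_sum X (\<lambda>n. b ((y - lam n) / h))) \<le> (M * C * I0 / (2 * pi)) * (1 + 1 / h) powr k * exp (c * y + K * \<bar>c\<bar> * h)"
    if h: "0 < h" and X: "\<And>v. X < v \<Longrightarrow> b ((y - v) / h) = 0" for y h X
  proof -
    let ?b = "\<lambda>v. b ((y - v) / h)"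
    let ?s = "vline c"
    let ?A = "M * C * (1 + 1 / h) powr k * exp (c * y + K * \<bar>c\<bar> * h)"
    have Ckb: "Ck L UNIV ?b"
      using Ck_affine[OF b(1), of "- 1 / h" "y / h"] by (simp add: diff_divide_distrib algebra_simps)
    have supp: "?b v = 0" if "\<bar>y\<bar> + h * K < \<bar>v\<bar>" for v
    proof (rule b(2))
      have "h * K < \<bar>y - v\<bar>" using that by linarith
      then show "K < \<bar>(y - v) / h\<bar>" using h by (simp add: pos_less_divide_eq mult.commute)
    qed
    have eq: "kernel_sum X (\<lambda>n. ?b (lam n))
       = of_real (1 / (2 * pi)) * (LINT t|lborel. f (?s t) * laplace ?b (- ?s t))"
      by (rule perron_pairing[OF Ckb supp X c])
    have pt: "norm (f (?s t) * laplace ?b (- ?s t)) \<le> ?A * (h * (1 / (1 + (h * t)\<^sup>2)))" for t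
    proof -
      let ?N = "1 + h * norm (?s t)"
      have "1 + norm (?s t) \<le> (1 + 1 / h) * ?N"
      proof -
        have "(1 + 1 / h) * ?N = 1 + norm (?s t) + (1 / h + h * norm (?s t))"
          using h by (simp add: field_simps)
        moreover have "0 \<le> 1 / h + h * norm (?s t)" using h by simp
        ultimately show ?thesis by linarith
      qed
      then have "(1 + norm (?s t)) powr k \<le> ((1 + 1 / h) * ?N) powr k"
        using k by (intro powr_mono2) auto
      also have "\<dots> = (1 + 1 / h) powr k * ?N powr k" by (rule powr_mult)
      finally have 1: "norm (f (?s t)) \<le> M * ((1 + 1 / h) powr k * ?N powr k)"
        using c M by (intro order_trans[OF growth] mult_left_mono) auto
      have "norm (laplace b (of_real h * ?s t)) * ?N powr k \<le> C * exp (K * (h * \<bar>c\<bar>)) / (1 + (h * t)\<^sup>2)"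
        using C(2)[OF L(1), of "of_real h * ?s t"] h by (simp add: norm_mult abs_mult)
      moreover have "norm (f (?s t)) * norm (laplace ?b (- ?s t))
          \<le> (M * ((1 + 1 / h) powr k * ?N powr k)) * (h * exp (c * y) * norm (laplace b (of_real h * ?s t)))"
        unfolding laplace_affine[OF h] norm_mult[of "_ * _"] using M h 1 by (intro mult_mono) (auto simp: norm_mult mult.commute)
      then have "norm (f (?s t) * laplace ?b (- ?s t))
          \<le> M * (1 + 1 / h) powr k * (h * exp (c * y)) * (norm (laplace b (of_real h * ?s t)) * ?N powr k)"
        by (simp only: norm_mult mult_ac)
      ultimately have "norm (f (?s t) * laplace ?b (- ?s t))
          \<le> M * (1 + 1 / h) powr k * (h * exp (c * y)) * (C * exp (K * (h * \<bar>c\<bar>)) / (1 + (h * t)\<^sup>2))"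
        using M h by (elim order_trans[OF _ mult_left_mono]) auto
      also have "\<dots> = M * C * (1 + 1 / h) powr k * (exp (c * y) * exp (K * (h * \<bar>c\<bar>))) * (h * (1 / (1 + (h * t)\<^sup>2)))"
        by (simp only: divide_inverse mult_ac mult_1_left)
      also have "exp (c * y) * exp (K * (h * \<bar>c\<bar>)) = exp (c * y + K * \<bar>c\<bar> * h)" by (simp add: mult_exp_exp mult_ac)
      finally show ?thesis .
    qed
    have gi: "integrable lborel (\<lambda>t. ?A * (h * (1 / (1 + (h * t)\<^sup>2))))"
      using lborel_integrable_real_affine[OF integrable_inverse_1_plus_square_UNIV[of 1], of h 0] h
      by (intro integrable_mult_right) simp
    have "norm (LINT t|lborel. f (?s t) * laplace ?b (- ?s t)) \<le> (LINT t|lborel. ?A * (h * (1 / (1 + (h * t)\<^sup>2))))"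
      by (rule order_trans[OF integral_norm_bound integral_mono']) (use gi pt M C h in \<open>auto simp del: norm_mult\<close>)
    also have "\<dots> = ?A * (h * (LINT t|lborel. 1 / (1 + (h * t)\<^sup>2)))" by (simp only: integral_mult_right_zero)
    also have "h * (LINT t|lborel. 1 / (1 + (h * t)\<^sup>2)) = I0"
      unfolding I0_def using h lborel_integral_real_affine[of h "\<lambda>t. 1 / (1 + t\<^sup>2 :: real)" 0] by simp
    finally have A: "norm (LINT t|lborel. f (?s t) * laplace ?b (- ?s t)) \<le> ?A * I0" .
    have "norm (kernel_sum X (\<lambda>n. ?b (lam n))) \<le> 1 / (2 * pi) * (?A * I0)"
    proof -
      have "norm (complex_of_real (1 / (2 * pi))) = 1 / (2 * pi)" by (simp only: norm_of_real) simp
      then show ?thesis unfolding eq norm_mult by (simp only:) (rule mult_left_mono[OF A], simp)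
    qed
    then show ?thesis by (simp add: mult_ac)
  qed
  then show ?thesis using M C I0 by (intro exI[of _ "M * C * I0 / (2 * pi)"]) auto
qed

text \<open>
  On the imaginary axis the transforms of the stretched kernels form an approximate identity at
  \<open>0\<close>.
\<close>

lemma smooth_mean_limit:
  assumes b: "Ck L UNIV b" "\<And>v. K < \<bar>v\<bar> \<Longrightarrow> b v = 0" and K: "0 \<le> K" and th: "\<theta> < 0"
  shows "((\<lambda>x. \<Sum>n | lam n \<le> K * x. a n * of_real (b (- lam n / x))) \<longlongrightarrow> f 0 * of_real (b 0)) at_top"
proof -
  obtain C where C: "C \<ge> 0" "\<And>m z. m + 2 \<le> real L \<Longrightarrow>
      norm (laplace b z) * (1 + norm z) powr m \<le> C * exp (K * \<bar>Re z\<bar>) / (1 + (Im z)\<^sup>2)"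
    using laplace_weighted_decay[where K = K, OF b] by auto
  have L2: "2 \<le> L" using L k by linarith
  have fthol: "laplace b holomorphic_on UNIV" by (rule laplace_holomorphic[OF Ck_imp_continuous[OF b(1)] b(2)])
  have ftcont: "continuous_on UNIV (\<lambda>t. laplace b (\<i> * of_real t))"
    by (intro continuous_on_compose2[OF holomorphic_on_imp_continuous_on[OF fthol]] continuous_intros) auto
  have fcont: "continuous_on {s. \<theta> < Re s} f" by (rule holomorphic_on_imp_continuous_on[OF hol])
  have ftb: "norm (laplace b (\<i> * of_real t)) * (1 + \<bar>t\<bar>) powr m \<le> C / (1 + t\<^sup>2)" if "m + 2 \<le> real L" for t m
    using C(2)[OF that, of "\<i> * of_real t"] by (simp add: norm_mult)
  have int: "integrable lborel (\<lambda>t. laplace b (\<i> * of_real t))"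
  proof (rule integrable_of_decay[OF ftcont])
    show "norm (laplace b (\<i> * of_real t)) \<le> C / (1 + t\<^sup>2)" for t
    proof -
      have "1 + \<bar>t\<bar> \<noteq> 0" by linarith
      then show ?thesis using ftb[of 0 t] L2 by simp
    qed
  qed
  let ?g = "\<lambda>x t. f (\<i> * of_real (t / max 1 x)) * laplace b (\<i> * of_real t)"
  have lim: "((\<lambda>x. LINT t|lborel. ?g x t) \<longlongrightarrow> (LINT t|lborel. f 0 * laplace b (\<i> * of_real t))) at_top"
  proof (rule integral_dominated_convergence_at_top)
    show "integrable lborel (\<lambda>t. M * C / (1 + t\<^sup>2))" by (rule integrable_inverse_1_plus_square_UNIV)
    show "(\<lambda>t. f 0 * laplace b (\<i> * of_real t)) \<in> borel_measurable lborel"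
      using int by (auto dest: borel_measurable_integrable)
    show "?g x \<in> borel_measurable lborel" for x
    proof -
      have "continuous_on UNIV (?g x)"
        using th by (intro continuous_on_mult ftcont continuous_on_compose2[OF fcont] continuous_intros) auto
      then show ?thesis by (simp add: borel_measurable_continuous_onI)
    qed
    show "AE t in lborel. ((\<lambda>x. ?g x t) \<longlongrightarrow> f 0 * laplace b (\<i> * of_real t)) at_top"
    proof (rule AE_I2)
      fix t
      have op: "open {s. \<theta> < Re s}" using open_halfspace_Re_gt[of \<theta>] by simp
      have c0: "isCont f 0" using continuous_on_eq_continuous_at[OF op, of f] fcont th by auto
      have "((\<lambda>x. \<i> * complex_of_real (t / max 1 x)) \<longlongrightarrow> \<i> * of_real 0) at_top"
        by (intro tendsto_mult tendsto_const tendsto_of_real tendsto_divide_0[OF tendsto_const]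
            filterlim_at_top_imp_at_infinity filterlim_at_top_mono[OF filterlim_ident]) auto
      then have "((\<lambda>x. f (\<i> * complex_of_real (t / max 1 x))) \<longlongrightarrow> f 0) at_top"
        by (intro isCont_tendsto_compose[OF c0]) simp
      then show "((\<lambda>x. ?g x t) \<longlongrightarrow> f 0 * laplace b (\<i> * of_real t)) at_top" by (intro tendsto_mult tendsto_const)
    qed
    show "\<forall>\<^sub>F x in at_top. AE t in lborel. norm (?g x t) \<le> M * C / (1 + t\<^sup>2)"
    proof (intro always_eventually allI AE_I2)
      fix x t :: real
      have "norm (f (\<i> * of_real (t / max 1 x))) \<le> M * (1 + norm (\<i> * complex_of_real (t / max 1 x))) powr k"
        using th by (intro growth) auto
      also have "\<dots> \<le> M * (1 + \<bar>t\<bar>) powr k"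
      proof (intro mult_left_mono M powr_mono2 k add_mono order_refl)
        have "\<bar>t\<bar> / max 1 x \<le> \<bar>t\<bar>"
          using mult_left_mono[of 1 "max 1 x" "\<bar>t\<bar>"] by (simp add: pos_divide_le_eq)
        then show "norm (\<i> * complex_of_real (t / max 1 x)) \<le> \<bar>t\<bar>" by (simp add: norm_mult norm_divide)
      qed auto
      finally have "norm (?g x t) \<le> M * (1 + \<bar>t\<bar>) powr k * norm (laplace b (\<i> * of_real t))"
        unfolding norm_mult by (rule mult_right_mono) simp
      also have "\<dots> = M * (norm (laplace b (\<i> * of_real t)) * (1 + \<bar>t\<bar>) powr k)" by simp
      also have "\<dots> \<le> M * (C / (1 + t\<^sup>2))" by (intro mult_left_mono M ftb L)
      finally show "norm (?g x t) \<le> M * C / (1 + t\<^sup>2)" by simp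
    qed
  qed
  have "(LINT t|lborel. f 0 * laplace b (\<i> * of_real t)) = f 0 * (LINT t|lborel. laplace b (\<i> * of_real t))" by simp
  also have "(LINT t|lborel. laplace b (\<i> * of_real t)) = of_real (2 * pi * b 0)"
    using fourier_inversion[of b K 0, OF Ck_imp_continuous[OF b(1)] b(2) int] by simp
  finally have fin: "(LINT t|lborel. f 0 * laplace b (\<i> * of_real t)) = f 0 * of_real (2 * pi * b 0)" .
  have lim': "((\<lambda>x. of_real (1 / (2 * pi)) * (LINT t|lborel. ?g x t)) \<longlongrightarrow> of_real (1 / (2 * pi)) * (f 0 * of_real (2 * pi * b 0))) at_top"
    by (rule tendsto_mult[OF tendsto_const lim[unfolded fin]])
  have "\<forall>\<^sub>F x in at_top. of_real (1 / (2 * pi)) * (LINT t|lborel. ?g x t) = kernel_sum (K * x) (\<lambda>n. b (- lam n / x))"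
    using eventually_ge_at_top[of 1]
  proof eventually_elim
    case (elim x)
    then have x: "0 < x" by simp
    let ?b = "\<lambda>v. b ((0 - v) / x)"
    have Ckb: "Ck L UNIV ?b"
      using Ck_affine[OF b(1), of "- 1 / x" "0"] by simp
    have supp: "?b v = 0" if "x * K < \<bar>v\<bar>" for v
    proof (rule b(2))
      show "K < \<bar>(0 - v) / x\<bar>" using that x by (simp add: pos_less_divide_eq mult.commute)
    qed
    have supp': "?b v = 0" if "K * x < v" for v
      using supp[of v] that by (simp add: mult.commute)
    have "kernel_sum (K * x) (\<lambda>n. ?b (lam n))
       = of_real (1 / (2 * pi)) * (LINT t|lborel. f (vline 0 t) * laplace ?b (- vline 0 t))"
      by (rule perron_pairing[OF Ckb supp supp' th])
    also have "(LINT t|lborel. f (vline 0 t) * laplace ?b (- vline 0 t))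
        = (LINT t|lborel. f (\<i> * of_real t) * (of_real x * laplace b (of_real x * (\<i> * of_real t))))"
      unfolding laplace_affine[OF x] by simp
    also have "\<dots> = \<bar>1 / x\<bar> *\<^sub>R (LINT t|lborel. f (\<i> * of_real (0 + 1 / x * t)) * (of_real x * laplace b (of_real x * (\<i> * of_real (0 + 1 / x * t)))))"
      using x by (intro lborel_integral_real_affine) simp
    also have "(\<lambda>t. f (\<i> * of_real (0 + 1 / x * t)) * (of_real x * laplace b (of_real x * (\<i> * of_real (0 + 1 / x * t)))))
        = (\<lambda>t. of_real x * ?g x t)"
    proof
      fix t
      have "of_real x * (\<i> * of_real (0 + 1 / x * t)) = \<i> * complex_of_real t" using x by simp
      moreover have "max 1 x = x" using elim by simp
      moreover have "0 + 1 / x * t = t / x" by simp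
      ultimately show "f (\<i> * of_real (0 + 1 / x * t)) * (of_real x * laplace b (of_real x * (\<i> * of_real (0 + 1 / x * t)))) = of_real x * ?g x t"
        by (simp only: mult_ac)
    qed
    also have "\<bar>1 / x\<bar> *\<^sub>R (LINT t|lborel. of_real x * ?g x t) = (LINT t|lborel. ?g x t)"
      unfolding integral_mult_right_zero using x by (simp add: scaleR_conv_of_real)
    finally show ?case by simp
  qed
  from Lim_transform_eventually[OF lim' this] show ?thesis by simp
qed

end


section \<open>Taylor expansion of the truncated power\<close>

text \<open>
  The convention \<open>0\<^sup>0 = 1\<close>, in contrast to \<open>powr\<close>, makes this the indicator
  function of \<open>u \<ge> 0\<close> for \<open>k = 0\<close>.
\<close>

definition trunc_powr :: "real \<Rightarrow> real \<Rightarrow> real" where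
  "trunc_powr k u = (if u < 0 then 0 else if k = 0 then 1 else u powr k)"

lemma trunc_powr_pos: "0 < u \<Longrightarrow> trunc_powr k u = u powr k"
  by (simp add: trunc_powr_def)

lemma trunc_powr_nonneg: "0 \<le> trunc_powr k u"
  by (simp add: trunc_powr_def)

lemma trunc_powr_le_powr:
  assumes "0 \<le> k" "u \<le> w" "0 < w"
  shows "trunc_powr k u \<le> w powr k"
  using assms by (auto simp: trunc_powr_def intro!: powr_mono2)

text \<open>
  The remainder of the binomial series, uniformly up to half of its radius of convergence.
\<close>

lemma gbinomial_tail:
  fixes k :: real
  shows "\<exists>S\<ge>0. \<forall>v. 0 \<le> v \<longrightarrow> v \<le> 1/2 \<longrightarrow>
    \<bar>(1 - v) powr k - (\<Sum>r<N. (k gchoose r) * (- v) ^ r)\<bar> \<le> S * v ^ N"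
proof -
  define G where "G = (\<lambda>r. \<bar>(k gchoose r) * (1/2) ^ r\<bar>)"
  have "summable (\<lambda>r. (k gchoose r) * (3/4) ^ r)"
    using gen_binomial_real[of "3/4" k] by (simp add: sums_iff)
  then have G: "summable G"
    unfolding G_def real_norm_def[symmetric] by (rule powser_insidea) simp
  have GN: "summable (\<lambda>r. G (r + N))" using G by (simp add: summable_iff_shift)
  define S where "S = 2 ^ N * (\<Sum>r. G (r + N))"
  have "S \<ge> 0" unfolding S_def by (intro mult_nonneg_nonneg suminf_nonneg GN) (auto simp: G_def)
  moreover have "\<bar>(1 - v) powr k - (\<Sum>r<N. (k gchoose r) * (- v) ^ r)\<bar> \<le> S * v ^ N" if v: "0 \<le> v" "v \<le> 1/2" for v
  proof -
    have "(\<lambda>r. (k gchoose r) * (- v) ^ r) sums (1 - v) powr k"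
      using gen_binomial_real[of "- v" k] v by simp
    then have s: "(\<lambda>r. (k gchoose (r + N)) * (- v) ^ (r + N)) sums ((1 - v) powr k - (\<Sum>r<N. (k gchoose r) * (- v) ^ r))"
      by (subst sums_iff_shift) simp
    have le: "norm ((k gchoose (r + N)) * (- v) ^ (r + N)) \<le> v ^ N * (2 ^ N * G (r + N))" for r
    proof -
      have "\<bar>k gchoose (r + N)\<bar> * v ^ r * v ^ N \<le> \<bar>k gchoose (r + N)\<bar> * (1/2) ^ r * v ^ N"
        using v by (intro mult_right_mono mult_left_mono power_mono) auto
      then show ?thesis using v by (simp add: G_def abs_mult power_abs power_add field_simps)
    qed
    have "norm (\<Sum>r. (k gchoose (r + N)) * (- v) ^ (r + N)) \<le> (\<Sum>r. v ^ N * (2 ^ N * G (r + N)))"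
      by (intro norm_suminf_le le summable_mult GN)
    also have "\<dots> = S * v ^ N"
      using suminf_mult[OF summable_mult[OF GN], of "v ^ N" "2 ^ N"] suminf_mult[OF GN, of "2 ^ N"]
      by (simp add: S_def)
    finally show ?thesis using s by (simp add: sums_iff)
  qed
  ultimately show ?thesis by blast
qed

text \<open>
  For \<open>v \<le> 1/2\<close> the remainder is of order \<open>v\<^bsup>N+1\<^esup>\<close> with \<open>N + 1
  \<ge> k\<close>. For larger \<open>v\<close>, also beyond the endpoint \<open>v = 1\<close>, all terms are
  separately \<open>O (v\<^sup>k)\<close>.
\<close>

lemma trunc_powr_taylor_unit:
  assumes k: "0 \<le> k" and N: "N = nat \<lfloor>k\<rfloor>"
  shows "\<exists>C\<ge>0. \<forall>v>0. \<bar>trunc_powr k (1 - v) - (\<Sum>r\<le>N. (k gchoose r) * (- v) ^ r)\<bar> \<le> C * v powr k"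
proof -
  obtain S where S: "S \<ge> 0" "\<And>v. 0 \<le> v \<Longrightarrow> v \<le> 1/2 \<Longrightarrow>
    \<bar>(1 - v) powr k - (\<Sum>r<Suc N. (k gchoose r) * (- v) ^ r)\<bar> \<le> S * v ^ Suc N"
    using gbinomial_tail[of k "Suc N"] by blast
  define A where "A = (\<Sum>r\<le>N. \<bar>k gchoose r\<bar>)"
  have A: "A \<ge> 0" unfolding A_def by (intro sum_nonneg) auto
  define C where "C = S + 2 powr k * (1 + A)"
  have C: "C \<ge> 0" "S \<le> C" "2 powr k * (1 + A) \<le> C" using S A by (auto simp: C_def)
  have "\<bar>trunc_powr k (1 - v) - (\<Sum>r\<le>N. (k gchoose r) * (- v) ^ r)\<bar> \<le> C * v powr k" if v: "v > 0" for v
  proof (cases "v \<le> 1/2")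
    case True
    have "\<bar>trunc_powr k (1 - v) - (\<Sum>r\<le>N. (k gchoose r) * (- v) ^ r)\<bar> \<le> S * v ^ Suc N"
      using S(2)[of v] True v by (simp add: trunc_powr_pos lessThan_Suc_atMost del: power_Suc)
    also have "v ^ Suc N = v powr real (Suc N)" using v by (simp add: powr_realpow del: power_Suc of_nat_Suc)
    also have "v powr real (Suc N) \<le> v powr k"
      using True v k N by (intro powr_mono') (linarith | simp)+
    finally have "\<bar>trunc_powr k (1 - v) - (\<Sum>r\<le>N. (k gchoose r) * (- v) ^ r)\<bar> \<le> S * v powr k" using S by (simp add: mult_left_mono)
    also have "\<dots> \<le> C * v powr k" using C by (intro mult_right_mono) auto
    finally show ?thesis .
  next
    case False
    have vr: "v ^ r \<le> 2 powr k * v powr k" if r: "real r \<le> k" for r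
    proof -
      have eq: "v ^ r = v powr k * v powr (real r - k)"
        using v by (simp add: powr_realpow flip: powr_add)
      have "v powr (real r - k) \<le> (1/2) powr (real r - k)"
        using False v r by (intro powr_mono2') auto
      also have "(1/2::real) powr (real r - k) = 2 powr (k - real r)"
        using powr_minus[of "1/2::real" "k - real r"] by (simp add: powr_divide)
      also have "\<dots> \<le> 2 powr k" by (intro powr_mono) auto
      finally have "v powr k * v powr (real r - k) \<le> v powr k * 2 powr k" by (rule mult_left_mono) simp
      then show ?thesis by (simp only: eq mult.commute)
    qed
    have "\<bar>trunc_powr k (1 - v)\<bar> \<le> 1" using trunc_powr_le_powr[of k "1 - v" 1] k v trunc_powr_nonneg[of k "1 - v"] by simp
    also have "1 \<le> 2 powr k * v powr k" using vr[of 0] k by simp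
    finally have 1: "\<bar>trunc_powr k (1 - v)\<bar> \<le> 2 powr k * v powr k" .
    have "\<bar>\<Sum>r\<le>N. (k gchoose r) * (- v) ^ r\<bar> \<le> (\<Sum>r\<le>N. \<bar>k gchoose r\<bar> * (2 powr k * v powr k))"
    proof (rule order_trans[OF sum_abs sum_mono])
      fix r assume "r \<in> {..N}"
      then have "real r \<le> k" using N k by simp linarith
      then show "\<bar>(k gchoose r) * (- v) ^ r\<bar> \<le> \<bar>k gchoose r\<bar> * (2 powr k * v powr k)"
        using v vr[of r] by (simp add: abs_mult power_abs mult_left_mono)
    qed
    also have "\<dots> = A * (2 powr k * v powr k)" by (simp add: A_def sum_distrib_right)
    finally have "\<bar>trunc_powr k (1 - v) - (\<Sum>r\<le>N. (k gchoose r) * (- v) ^ r)\<bar> \<le> 2 powr k * v powr k + A * (2 powr k * v powr k)"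
      using 1 by linarith
    also have "\<dots> = 2 powr k * (1 + A) * v powr k" by (simp add: algebra_simps)
    also have "\<dots> \<le> C * v powr k" using C by (intro mult_right_mono) auto
    finally show ?thesis .
  qed
  then show ?thesis using C by blast
qed

text \<open>
  For \<open>d > 0\<close> scaling reduces this to \<open>d = 1\<close>, which makes the constant uniform in the
  distance \<open>d\<close> of the centre from the endpoint. If \<open>d = 0\<close>, the zero polynomial serves
  for \<open>k > 0\<close> and the constant \<open>1\<close> for \<open>k = 0\<close>. The bound on the
  coefficients says that the polynomial has size \<open>\<tau>\<^sup>k\<close> on the scale
  \<open>\<tau>\<close>, even if \<open>d\<close> is much smaller than \<open>\<tau>\<close>.
\<close>

lemma trunc_powr_taylor:
  assumes k: "0 \<le> k" and N: "N = nat \<lfloor>k\<rfloor>"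
  shows "\<exists>C\<ge>0. \<forall>d \<tau>. 0 \<le> d \<longrightarrow> d \<le> \<tau> \<longrightarrow> 0 < \<tau> \<longrightarrow>
    (\<exists>e. (\<forall>r\<le>N. \<bar>e r\<bar> \<le> C * \<tau> powr (k - real r)) \<and> e 0 = trunc_powr k d \<and>
      (\<forall>u>0. \<bar>trunc_powr k (d - u) - (\<Sum>r\<le>N. e r * (- u) ^ r)\<bar> \<le> C * u powr k))"
proof -
  obtain C1 where C1: "C1 \<ge> 0" "\<And>v. v > 0 \<Longrightarrow> \<bar>trunc_powr k (1 - v) - (\<Sum>r\<le>N. (k gchoose r) * (- v) ^ r)\<bar> \<le> C1 * v powr k"
    using trunc_powr_taylor_unit[OF assms] by blast
  define C where "C = 1 + C1 + (\<Sum>r\<le>N. \<bar>k gchoose r\<bar>)"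
  have Cr: "\<bar>k gchoose r\<bar> \<le> C" if "r \<le> N" for r
  proof -
    have "\<bar>k gchoose r\<bar> \<le> (\<Sum>r\<le>N. \<bar>k gchoose r\<bar>)" by (rule member_le_sum) (use that in auto)
    then show ?thesis using C1 by (simp add: C_def)
  qed
  have C: "C \<ge> 1" "C \<ge> C1" using C1(1) by (auto simp: C_def intro!: sum_nonneg add_nonneg_nonneg)
  have "\<exists>e. (\<forall>r\<le>N. \<bar>e r\<bar> \<le> C * \<tau> powr (k - real r)) \<and> e 0 = trunc_powr k d \<and>
      (\<forall>u>0. \<bar>trunc_powr k (d - u) - (\<Sum>r\<le>N. e r * (- u) ^ r)\<bar> \<le> C * u powr k)"
    if d: "0 \<le> d" "d \<le> \<tau>" "0 < \<tau>" for d \<tau>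
  proof (cases "d = 0")
    case True
    define e where "e = (\<lambda>r::nat. if k = 0 \<and> r = 0 then 1 else (0::real))"
    have "\<bar>e r\<bar> \<le> C * \<tau> powr (k - real r)" for r using C d by (auto simp: e_def)
    moreover have "e 0 = trunc_powr k d" using True by (simp add: e_def trunc_powr_def)
    moreover have "\<bar>trunc_powr k (d - u) - (\<Sum>r\<le>N. e r * (- u) ^ r)\<bar> \<le> C * u powr k" if "u > 0" for u
    proof (cases "k = 0")
      case k0: True
      then have "N = 0" using N by simp
      then show ?thesis using k0 True that C by (simp add: e_def trunc_powr_def)
    next
      case False
      then show ?thesis using True that C by (simp add: e_def trunc_powr_def)
    qed
    ultimately show ?thesis by blast
  next
    case False
    then have d0: "d > 0" using d by simp
    define e where "e = (\<lambda>r::nat. (k gchoose r) * d powr (k - real r))"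
    have "\<bar>e r\<bar> \<le> C * \<tau> powr (k - real r)" if r: "r \<le> N" for r
    proof -
      have "real r \<le> k" using r N k by simp linarith
      then have "d powr (k - real r) \<le> \<tau> powr (k - real r)" using d by (intro powr_mono2) auto
      then show ?thesis unfolding e_def abs_mult using Cr[OF r] C by (intro mult_mono) auto
    qed
    moreover have "e 0 = trunc_powr k d" using d0 by (simp add: e_def trunc_powr_def)
    moreover have "\<bar>trunc_powr k (d - u) - (\<Sum>r\<le>N. e r * (- u) ^ r)\<bar> \<le> C * u powr k" if u: "u > 0" for u
    proof -
      define v where "v = u / d"
      have v: "v > 0" "u = d * v" using u d0 by (auto simp: v_def)
      have "d - u = d * (1 - v)" using v by (simp add: algebra_simps)
      then have 1: "trunc_powr k (d - u) = d powr k * trunc_powr k (1 - v)"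
        using d0 by (auto simp: trunc_powr_def powr_mult mult_less_0_iff)
      have "e r * (- u) ^ r = d powr k * ((k gchoose r) * (- v) ^ r)" for r
      proof -
        have "d powr (k - real r) * d ^ r = d powr k"
          using d0 by (simp add: powr_realpow[symmetric] flip: powr_add)
        moreover have "(- u) ^ r = d ^ r * (- v) ^ r" unfolding v(2) by (simp flip: power_mult_distrib)
        ultimately show ?thesis by (simp add: e_def mult.assoc mult.left_commute mult.commute[of "d ^ r"])
      qed
      then have "\<bar>trunc_powr k (d - u) - (\<Sum>r\<le>N. e r * (- u) ^ r)\<bar>
          = d powr k * \<bar>trunc_powr k (1 - v) - (\<Sum>r\<le>N. (k gchoose r) * (- v) ^ r)\<bar>"
        unfolding 1 by (simp add: abs_mult flip: sum_distrib_left right_diff_distrib)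
      also have "\<dots> \<le> d powr k * (C * v powr k)"
        using C by (intro mult_left_mono order_trans[OF C1(2)[OF v(1)]] mult_right_mono) auto
      also have "\<dots> = C * u powr k" unfolding v(2) by (simp add: powr_mult)
      finally show ?thesis .
    qed
    ultimately show ?thesis by blast
  qed
  then show ?thesis using C by (intro exI[of _ C]) auto
qed

lemma freq_gap_facts:
  assumes fr: "frequency lam"
  shows "0 < freq_gap lam n" "freq_gap lam n \<le> 1" "m \<noteq> n \<Longrightarrow> freq_gap lam n \<le> \<bar>lam n - lam m\<bar>"
proof -
  note ff = frequency_facts[OF fr]
  show "0 < freq_gap lam n" "freq_gap lam n \<le> 1" using ff(4) by (auto simp: freq_gap_def)
  show "freq_gap lam n \<le> \<bar>lam n - lam m\<bar>" if "m \<noteq> n"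
  proof (cases "m < n")
    case True
    then have "freq_gap lam n \<le> lam n - lam (n - 1)" by (auto simp: freq_gap_def)
    moreover have "lam m \<le> lam (n - 1)" using ff(5) True by auto
    ultimately show ?thesis by linarith
  next
    case False
    then have "n < m" using that by simp
    then have "lam (n + 1) \<le> lam m" using ff(5) by auto
    moreover have "freq_gap lam n \<le> lam (n + 1) - lam n" by (auto simp: freq_gap_def)
    ultimately show ?thesis by linarith
  qed
qed


section \<open>Dyadic decomposition of the Riesz kernel\<close>

text \<open>
  Now the extension reaches beyond the line \<open>Re s = - \<kappa>\<close> to the left of \<open>0\<close>, so
  windows at \<open>y\<close> gain \<open>exp (- \<kappa> y)\<close>.
\<close>

locale riesz_extension_left = riesz_extension +
  fixes \<kappa> :: real
  assumes \<kappa>: "0 < \<kappa>" "\<theta> < - \<kappa>"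
begin

text \<open>
  A bump around \<open>lam n\<close> of the width of the gap isolates the single coefficient \<open>a n\<close>.
\<close>

lemma coefficient_bound:
  "\<exists>C\<ge>0. \<forall>n. norm (a n) \<le> C * (1 / freq_gap lam n) powr k * exp (- \<kappa> * lam n)"
proof -
  have supp: "bump L v = 0" if "1 < \<bar>v\<bar>" for v using that by (simp add: bump_eq_0)
  obtain C where C: "C \<ge> 0" "\<And>y h X. 0 < h \<Longrightarrow> (\<And>v. v > X \<Longrightarrow> bump L ((y - v) / h) = 0) \<Longrightarrow>
    norm (kernel_sum X (\<lambda>n. bump L ((y - lam n) / h))) \<le> C * (1 + 1 / h) powr k * exp (- \<kappa> * y + 1 * \<bar>- \<kappa>\<bar> * h)"
    using local_mean_bound[of "bump L" 1 "- \<kappa>", OF Ck_bump supp _ \<kappa>(2)] by auto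
  have "norm (a n) \<le> C * 2 powr k * exp \<kappa> * (1 / freq_gap lam n) powr k * exp (- \<kappa> * lam n)" for n
  proof -
    define h where "h = freq_gap lam n"
    have h: "0 < h" "h \<le> 1" using freq_gap_facts[OF fr] by (auto simp: h_def)
    have z: "bump L ((lam n - lam m) / h) = 0" if "m \<noteq> n" for m
      using freq_gap_facts(3)[OF fr that] h by (intro bump_eq_0) (simp add: h_def)
    have "(\<Sum>m | lam m \<le> lam n + h. a m * of_real (bump L ((lam n - lam m) / h)))
        = (\<Sum>m\<in>{n}. a m * of_real (bump L ((lam n - lam m) / h)))"
      by (rule sum.mono_neutral_right) (use frequency_facts(1)[OF fr] h z in auto)
    also have "\<dots> = a n" by (simp add: bump_eq_1)
    finally have "norm (a n) \<le> C * (1 + 1 / h) powr k * exp (- \<kappa> * lam n + 1 * \<bar>- \<kappa>\<bar> * h)"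
      using C(2)[of h "lam n + h" "lam n"] h by (simp add: bump_eq_0 pos_le_divide_eq)
    also have "\<dots> \<le> C * (2 * (1 / h)) powr k * (exp \<kappa> * exp (- \<kappa> * lam n))"
    proof (intro mult_mono mult_left_mono powr_mono2 k C)
      show "1 + 1 / h \<le> 2 * (1 / h)" using h by (simp add: field_simps)
      have "\<kappa> * h \<le> \<kappa>" using h \<kappa> by (simp add: mult_left_le)
      then show "exp (- \<kappa> * lam n + 1 * \<bar>- \<kappa>\<bar> * h) \<le> exp \<kappa> * exp (- \<kappa> * lam n)"
        using \<kappa> by (simp add: mult_exp_exp)
    qed (use h C in auto)
    also have "\<dots> = C * 2 powr k * exp \<kappa> * (1 / h) powr k * exp (- \<kappa> * lam n)"
      unfolding powr_mult[of 2] by (simp only: mult_ac)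
    finally show ?thesis by (simp add: h_def)
  qed
  then show ?thesis using C(1) by (intro exI[of _ "C * 2 powr k * exp \<kappa>"]) auto
qed

text \<open>
  The Riesz kernel with its endpoint removed: unchanged at distance at least \<open>2 h\<close> from
  \<open>x\<close>, zero at distance at most \<open>h\<close>.
\<close>

definition cut :: "real \<Rightarrow> real \<Rightarrow> nat \<Rightarrow> real" where
  "cut x h n = smooth_step L ((x - lam n) / h) * trunc_powr k (x - lam n)"

text \<open>
  One dyadic scale: by homogeneity the difference of two cuts is \<open>h\<^sup>k\<close> times a window of
  width \<open>h\<close> with a fixed profile, and \<open>h\<^sup>k (1 + 1 / h)\<^sup>k = (1 +
  h)\<^sup>k\<close> no longer degenerates for small \<open>h\<close>.
\<close>

lemma cut_step_bound:
  "\<exists>C\<ge>0. \<forall>x h. 0 < h \<longrightarrow> norm (kernel_sum x (cut x h) - kernel_sum x (cut x (2 * h)))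
     \<le> C * (1 + h) powr k * exp (- \<kappa> * x + 4 * \<kappa> * h)"
proof -
  define b where "b = (\<lambda>v. smooth_step L v - smooth_step L (v / 2))"
  have Cb: "Ck L UNIV b"
    unfolding b_def using Ck_affine[OF Ck_smooth_step, of L "1/2" 0] by (intro Ck_diff Ck_smooth_step) auto
  have b0: "b v = 0" if "v \<le> 1" for v using that by (simp add: b_def smooth_step_eq_0)
  have b4: "b v = 0" if "v \<ge> 4" for v using that by (simp add: b_def smooth_step_eq_1)
  define \<beta> where "\<beta> = (\<lambda>v. v powr k * b v)"
  have C\<beta>: "Ck L UNIV \<beta>" unfolding \<beta>_def by (rule Ck_powr_cutoff[OF Cb, of 1]) (use b0 in auto)
  have \<beta>0: "\<beta> v = 0" if "v \<le> 1" for v using b0[OF that] by (simp add: \<beta>_def)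
  have supp: "\<beta> v = 0" if "4 < \<bar>v\<bar>" for v
  proof (cases "v \<le> 1")
    case False then show ?thesis using that b4[of v] by (simp add: \<beta>_def)
  qed (rule \<beta>0)
  obtain C where C: "C \<ge> 0" "\<And>y h X. 0 < h \<Longrightarrow> (\<And>v. v > X \<Longrightarrow> \<beta> ((y - v) / h) = 0) \<Longrightarrow>
    norm (kernel_sum X (\<lambda>n. \<beta> ((y - lam n) / h))) \<le> C * (1 + 1 / h) powr k * exp (- \<kappa> * y + 4 * \<bar>- \<kappa>\<bar> * h)"
    using local_mean_bound[of \<beta> 4 "- \<kappa>", OF C\<beta> supp _ \<kappa>(2)] by auto
  have "norm (kernel_sum x (cut x h) - kernel_sum x (cut x (2 * h)))
     \<le> C * (1 + h) powr k * exp (- \<kappa> * x + 4 * \<kappa> * h)" if h: "0 < h" for x h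
  proof -
    have eq: "cut x h n - cut x (2 * h) n = h powr k * \<beta> ((x - lam n) / h)" if "lam n \<le> x" for n
    proof (cases "lam n = x")
      case True then show ?thesis using \<beta>0[of 0] by (simp add: cut_def smooth_step_eq_0)
    next
      case False
      then have v: "0 < (x - lam n) / h" using that h by simp
      have "trunc_powr k (x - lam n) = (h * ((x - lam n) / h)) powr k" using False that h by (simp add: trunc_powr_pos)
      also have "\<dots> = h powr k * ((x - lam n) / h) powr k" by (rule powr_mult)
      finally show ?thesis by (simp add: cut_def \<beta>_def b_def algebra_simps)
    qed
    have "kernel_sum x (cut x h) - kernel_sum x (cut x (2 * h))
       = kernel_sum x (\<lambda>n. cut x h n - cut x (2 * h) n)"
      by (simp add: sum_subtractf[symmetric] algebra_simps)
    also have "\<dots> = kernel_sum x (\<lambda>n. h powr k * \<beta> ((x - lam n) / h))"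
      by (intro sum.cong refl) (simp only: eq mem_Collect_eq)
    also have "\<dots> = of_real (h powr k) * kernel_sum x (\<lambda>n. \<beta> ((x - lam n) / h))"
      unfolding sum_distrib_left by (intro sum.cong refl) simp
    also have "norm \<dots> \<le> h powr k * (C * (1 + 1 / h) powr k * exp (- \<kappa> * x + 4 * \<bar>- \<kappa>\<bar> * h))"
    proof -
      have "\<beta> ((x - v) / h) = 0" if "v > x" for v using that h by (intro \<beta>0) (simp add: pos_divide_le_eq)
      then show ?thesis unfolding norm_mult using C(2)[OF h, of x x] by (simp add: mult_left_mono)
    qed
    also have "\<dots> = C * (h powr k * (1 + 1 / h) powr k) * exp (- \<kappa> * x + 4 * \<kappa> * h)" using \<kappa> by simp
    also have "h powr k * (1 + 1 / h) powr k = (1 + h) powr k"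
      using h by (simp add: powr_mult[symmetric] distrib_left add.commute)
    finally show ?thesis .
  qed
  then show ?thesis using C(1) by blast
qed

lemma dyadic_bound:
  "\<exists>C\<ge>0. \<forall>x J. 0 < x \<longrightarrow> norm (kernel_sum x (cut x (x / 8 / 2 ^ J)) - kernel_sum x (cut x (x / 8)))
     \<le> C * real J * (1 + x) powr k * exp (- \<kappa> * x / 2)"
proof -
  obtain C where C: "C \<ge> 0" "\<And>x h. 0 < h \<Longrightarrow> norm (kernel_sum x (cut x h) - kernel_sum x (cut x (2 * h)))
     \<le> C * (1 + h) powr k * exp (- \<kappa> * x + 4 * \<kappa> * h)"
    using cut_step_bound by blast
  have "norm (kernel_sum x (cut x (x / 8 / 2 ^ J)) - kernel_sum x (cut x (x / 8)))
     \<le> C * real J * (1 + x) powr k * exp (- \<kappa> * x / 2)" if x: "0 < x" for x J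
  proof (induction J)
    case (Suc J)
    let ?S = "\<lambda>h. \<Sum>n | lam n \<le> x. a n * of_real (cut x h n)"
    define h where "h = x / 8 / 2 ^ Suc J"
    have h: "0 < h" "2 * h = x / 8 / 2 ^ J" using x by (auto simp: h_def)
    have "h \<le> x / 8 / 2 ^ 0"
      unfolding h_def using x one_le_power[of "2::real" "Suc J"] by (intro divide_left_mono) auto
    then have hx: "h \<le> x / 8" by simp
    have "norm (?S h - ?S (2 * h)) \<le> C * (1 + h) powr k * exp (- \<kappa> * x + 4 * \<kappa> * h)" by (rule C(2)[OF h(1)])
    also have "\<dots> \<le> C * (1 + x) powr k * exp (- \<kappa> * x / 2)"
    proof (intro mult_mono mult_left_mono powr_mono2 k C)
      have "\<kappa> * h \<le> \<kappa> * (x / 8)" using hx \<kappa> by (intro mult_left_mono) auto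
      then show "exp (- \<kappa> * x + 4 * \<kappa> * h) \<le> exp (- \<kappa> * x / 2)" by simp
    qed (use h hx x C in auto)
    finally have 1: "norm (?S h - ?S (2 * h)) \<le> C * (1 + x) powr k * exp (- \<kappa> * x / 2)" .
    have "norm (?S h - ?S (x / 8)) \<le> norm (?S h - ?S (2 * h)) + norm (?S (2 * h) - ?S (x / 8))"
      using norm_triangle_ineq[of "?S h - ?S (2 * h)" "?S (2 * h) - ?S (x / 8)"] by simp
    also have "\<dots> \<le> C * (1 + x) powr k * exp (- \<kappa> * x / 2) + C * real J * (1 + x) powr k * exp (- \<kappa> * x / 2)"
      using 1 Suc.IH unfolding h(2) by (rule add_mono)
    also have "\<dots> = C * real (Suc J) * (1 + x) powr k * exp (- \<kappa> * x / 2)" by (simp add: algebra_simps)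
    finally show ?case by (simp only: h_def)
  qed simp
  then show ?thesis using C(1) by blast
qed

text \<open>
  Cut at a distance proportional to \<open>x\<close>, the Riesz kernel becomes a fixed smooth kernel stretched
  by \<open>x\<close>. As all frequencies are non-negative, it may be cut off on the negative axis to have
  compact support.
\<close>

lemma smooth_cut_limit:
  "((\<lambda>x. kernel_sum x (cut x (x / 8)) / of_real (x powr k)) \<longlongrightarrow> f 0) at_top"
proof -
  define g where "g = (\<lambda>u. u powr k * smooth_step L (8 * u))"
  have g: "Ck L UNIV g"
    unfolding g_def
    using Ck_affine[OF Ck_smooth_step, of L 8 0]
    by (intro Ck_powr_cutoff[where \<delta> = "1/8"]) (auto simp: smooth_step_eq_0)
  \<comment> \<open>The argument is \<open>w = - lam n / x\<close>; the second factor is 1 for \<open>w \<le> 1\<close> and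
    0 for \<open>w \<ge> 2\<close>.\<close>
  define b where "b = (\<lambda>w. g (1 * w + 1) * smooth_step L ((-1) * w + 3))"
  have b: "Ck L UNIV b"
    unfolding b_def by (intro Ck_mult Ck_affine g Ck_smooth_step) auto
  have supp: "b w = 0" if "2 < \<bar>w\<bar>" for w
    using that by (cases "w \<ge> 0") (auto simp: b_def g_def smooth_step_eq_0)
  have b1: "b 0 = 1" by (simp add: b_def g_def smooth_step_eq_1)
  have lim: "((\<lambda>x. \<Sum>n | lam n \<le> 2 * x. a n * of_real (b (- lam n / x))) \<longlongrightarrow> f 0 * of_real (b 0)) at_top"
    by (rule smooth_mean_limit[OF b supp]) (use \<kappa> in auto)
  have "\<forall>\<^sub>F x in at_top. kernel_sum (2 * x) (\<lambda>n. b (- lam n / x))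
      = kernel_sum x (cut x (x / 8)) / of_real (x powr k)"
    using eventually_gt_at_top[of 0]
  proof eventually_elim
    case (elim x)
    have 0: "b (- lam n / x) = 0" if "x < lam n" for n
    proof -
      have "8 * (1 * (- lam n / x) + 1) \<le> 1" using that elim by (simp add: field_simps)
      then show ?thesis by (simp add: b_def g_def smooth_step_eq_0)
    qed
    have 1: "b (- lam n / x) = cut x (x / 8) n / x powr k" if le: "lam n \<le> x" for n
    proof -
      have e: "1 * (- lam n / x) + 1 = (x - lam n) / x" using elim by (simp add: field_simps)
      have "0 \<le> lam n" by (rule frequency_facts(2)[OF fr])
      then have "smooth_step L ((-1) * (- lam n / x) + 3) = 1" using elim by (intro smooth_step_eq_1) (simp add: field_simps)
      then have "b (- lam n / x) = ((x - lam n) / x) powr k * smooth_step L (8 * ((x - lam n) / x))"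
        unfolding b_def g_def e by simp
      also have "\<dots> = cut x (x / 8) n / x powr k"
      proof (cases "lam n = x")
        case True then show ?thesis by (simp add: cut_def smooth_step_eq_0)
      next
        case False
        then show ?thesis using le elim by (simp add: cut_def trunc_powr_pos powr_divide field_simps)
      qed
      finally show ?thesis .
    qed
    have "kernel_sum (2 * x) (\<lambda>n. b (- lam n / x)) = kernel_sum x (\<lambda>n. b (- lam n / x))"
      using frequency_facts(1)[OF fr] elim 0 by (intro sum.mono_neutral_right) auto
    also have "\<dots> = kernel_sum x (cut x (x / 8)) / of_real (x powr k)"
      unfolding sum_divide_distrib
      by (intro sum.cong refl) (simp only: mem_Collect_eq 1 of_real_divide times_divide_eq_right)
    finally show ?case .
  qed
  from Lim_transform_eventually[OF lim this] show ?thesis by (simp add: b1)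
qed
end


section \<open>Frequencies close to the endpoint\<close>

context riesz_extension_left
begin

text \<open>
  The cost of changing a kernel between \<open>lam p\<close> and \<open>lam m\<close>: by the coefficient bound
  the sum is dominated by \<open>\<Sum> y\<^sub>n\<^sup>k\<close> with \<open>y\<^sub>n = (lam n - lam p) /
  \<epsilon>\<^sub>n\<close>. The gap condition bounds \<open>\<Sum> y\<^sub>n\<close>, and since
  \<open>y\<^sub>n \<ge> 1\<close> this also bounds the sum of the powers, for any \<open>k \<ge> 0\<close>.
\<close>

lemma cluster_error_bound:
  "\<exists>C\<ge>0. \<forall>p m B D g. 0 \<le> B \<longrightarrow> 0 \<le> D \<longrightarrow> gap_sum p m \<le> B \<longrightarrow>
     (\<forall>n\<in>{p<..<m}. \<bar>g n\<bar> \<le> D * (lam n - lam p) powr k) \<longrightarrow>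
     (\<Sum>n\<in>{p<..<m}. norm (a n * of_real (g n))) \<le> D * C * (1 + B) powr (k + 1) * exp (- \<kappa> * lam p)"
proof -
  obtain C where C: "C \<ge> 0" "\<And>n. norm (a n) \<le> C * (1 / freq_gap lam n) powr k * exp (- \<kappa> * lam n)"
    using coefficient_bound by blast
  have "(\<Sum>n\<in>{p<..<m}. norm (a n * of_real (g n))) \<le> D * C * (1 + B) powr (k + 1) * exp (- \<kappa> * lam p)"
    if B: "0 \<le> B" and D: "0 \<le> D" and sum: "gap_sum p m \<le> B"
      and g: "\<And>n. n \<in> {p<..<m} \<Longrightarrow> \<bar>g n\<bar> \<le> D * (lam n - lam p) powr k" for p m B D and g :: "nat \<Rightarrow> real"
  proof -
    define y where "y = (\<lambda>n. (lam n - lam p) / freq_gap lam n)"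
    have y1: "1 \<le> y n" if "n \<in> {p<..<m}" for n
    proof -
      have "freq_gap lam n \<le> lam n - lam p"
        using freq_gap_facts(3)[OF fr, of p n] that frequency_facts(3)[OF fr, of p n] by auto
      then show ?thesis using freq_gap_facts(1)[OF fr, of n] by (simp add: y_def)
    qed
    have yB: "y n \<le> B" if "n \<in> {p<..<m}" for n
    proof -
      have "y n \<le> (\<Sum>j\<in>{p<..<m}. y j)"
        by (rule member_le_sum) (use that y1 in \<open>auto intro: order_trans[OF zero_le_one]\<close>)
      then show ?thesis using sum by (simp add: y_def)
    qed
    have summand: "norm (a n * of_real (g n)) \<le> D * C * exp (- \<kappa> * lam p) * (1 + B) powr k * y n" if n: "n \<in> {p<..<m}" for n
    proof -
      have "norm (a n * of_real (g n)) \<le> (C * (1 / freq_gap lam n) powr k * exp (- \<kappa> * lam n)) * (D * (lam n - lam p) powr k)"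
        unfolding norm_mult using C g[OF n] by (intro mult_mono) auto
      also have "\<dots> = D * C * (y n powr k) * exp (- \<kappa> * lam n)"
        unfolding y_def divide_inverse powr_mult by (simp add: mult_ac)
      also have "\<dots> \<le> D * C * ((1 + B) powr k * y n) * exp (- \<kappa> * lam p)"
      proof (intro mult_mono mult_left_mono mult_nonneg_nonneg D C)
        have "y n powr k \<le> (1 + B) powr k" using yB[OF n] y1[OF n] k by (intro powr_mono2) auto
        also have "\<dots> \<le> (1 + B) powr k * y n"
          using mult_left_mono[OF y1[OF n], of "(1 + B) powr k"] by simp
        finally show "y n powr k \<le> (1 + B) powr k * y n" .
        show "exp (- \<kappa> * lam n) \<le> exp (- \<kappa> * lam p)"
          using frequency_facts(3)[OF fr, of p n] n \<kappa> by simp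
      qed (use y1[OF n] in auto)
      finally show ?thesis by (simp only: mult_ac)
    qed
    have "(\<Sum>n\<in>{p<..<m}. norm (a n * of_real (g n))) \<le> (\<Sum>n\<in>{p<..<m}. D * C * exp (- \<kappa> * lam p) * (1 + B) powr k * y n)"
      by (intro sum_mono summand)
    also have "\<dots> = D * C * exp (- \<kappa> * lam p) * (1 + B) powr k * (\<Sum>n\<in>{p<..<m}. y n)"
      by (rule sum_distrib_left[symmetric])
    also have "\<dots> \<le> D * C * exp (- \<kappa> * lam p) * (1 + B) powr k * (1 + B)"
      using sum B D C by (intro mult_left_mono) (auto simp: y_def)
    also have "\<dots> = D * C * (1 + B) powr (k + 1) * exp (- \<kappa> * lam p)"
      using B by (simp add: powr_add)
    finally show ?thesis .
  qed
  then show ?thesis using C(1) by (intro exI[of _ C]) auto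
qed

text \<open>
  For the Taylor polynomials: each monomial times the bump is a window of width \<open>\<tau>\<close> with fixed
  profile, and the bound on its coefficient compensates the factor \<open>(1 + 1 / \<tau>)\<^sup>k\<close>.
\<close>

lemma polynomial_bump_bound:
  "\<exists>C\<ge>0. \<forall>y \<tau> A e. 0 < \<tau> \<longrightarrow> \<tau> \<le> 1 \<longrightarrow> 0 \<le> A \<longrightarrow> (\<forall>r\<le>N. \<bar>e r\<bar> \<le> A * \<tau> powr (k - real r)) \<longrightarrow>
     norm (kernel_sum (y + \<tau>) (\<lambda>n. (\<Sum>r\<le>N. e r * (y - lam n) ^ r) * bump L ((y - lam n) / \<tau>)))
       \<le> A * C * exp (- \<kappa> * y)"
proof -
  define \<beta> where "\<beta> = (\<lambda>r v. v ^ r * bump L v)"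
  have C\<beta>: "Ck L UNIV (\<beta> r)" for r unfolding \<beta>_def by (intro Ck_mult Ck_power Ck_bump) auto
  have supp: "\<beta> r v = 0" if "1 < \<bar>v\<bar>" for v r using that by (simp add: \<beta>_def bump_eq_0)
  have "\<forall>r. \<exists>C\<ge>0. \<forall>y h X. 0 < h \<longrightarrow> (\<forall>v>X. \<beta> r ((y - v) / h) = 0) \<longrightarrow>
    norm (kernel_sum X (\<lambda>n. \<beta> r ((y - lam n) / h))) \<le> C * (1 + 1 / h) powr k * exp (- \<kappa> * y + 1 * \<bar>- \<kappa>\<bar> * h)"
  proof (rule allI, rule local_mean_bound[where K = 1 and c = "- \<kappa>"])
    fix r
    show "\<beta> r v = 0" if "1 < \<bar>v\<bar>" for v by (rule supp[OF that])
    show "Ck L UNIV (\<beta> r)" by (rule C\<beta>)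
    show "\<theta> < - \<kappa>" by (rule \<kappa>(2))
  qed simp
  from choice[OF this] obtain C where C': "\<forall>r. 0 \<le> C r \<and> (\<forall>y h X. 0 < h \<longrightarrow> (\<forall>v>X. \<beta> r ((y - v) / h) = 0) \<longrightarrow>
    norm (kernel_sum X (\<lambda>n. \<beta> r ((y - lam n) / h))) \<le> C r * (1 + 1 / h) powr k * exp (- \<kappa> * y + 1 * \<bar>- \<kappa>\<bar> * h))" ..
  have C: "0 \<le> C r" "0 < h \<Longrightarrow> (\<And>v. v > X \<Longrightarrow> \<beta> r ((y - v) / h) = 0) \<Longrightarrow>
    norm (kernel_sum X (\<lambda>n. \<beta> r ((y - lam n) / h))) \<le> C r * (1 + 1 / h) powr k * exp (- \<kappa> * y + 1 * \<bar>- \<kappa>\<bar> * h)" for r y h X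
    using C' by blast+
  define C' where "C' = (\<Sum>r\<le>N. C r * 2 powr k * exp \<kappa>)"
  have "norm (kernel_sum (y + \<tau>) (\<lambda>n. (\<Sum>r\<le>N. e r * (y - lam n) ^ r) * bump L ((y - lam n) / \<tau>)))
       \<le> A * C' * exp (- \<kappa> * y)"
    if \<tau>: "0 < \<tau>" "\<tau> \<le> 1" and A: "0 \<le> A" and e: "\<And>r. r \<le> N \<Longrightarrow> \<bar>e r\<bar> \<le> A * \<tau> powr (k - real r)" for y \<tau> A e
  proof -
    let ?T = "\<lambda>r. \<Sum>n | lam n \<le> y + \<tau>. a n * of_real (\<beta> r ((y - lam n) / \<tau>))"
    have "kernel_sum (y + \<tau>) (\<lambda>n. (\<Sum>r\<le>N. e r * (y - lam n) ^ r) * bump L ((y - lam n) / \<tau>))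
      = (\<Sum>n | lam n \<le> y + \<tau>. \<Sum>r\<le>N. of_real (e r * \<tau> ^ r) * (a n * of_real (\<beta> r ((y - lam n) / \<tau>))))"
    proof (intro sum.cong refl)
      fix n
      have "(\<Sum>r\<le>N. e r * (y - lam n) ^ r) * bump L ((y - lam n) / \<tau>) = (\<Sum>r\<le>N. e r * \<tau> ^ r * \<beta> r ((y - lam n) / \<tau>))"
        unfolding sum_distrib_right
        by (intro sum.cong refl) (use \<tau> in \<open>simp add: \<beta>_def power_divide\<close>)
      then have "a n * of_real ((\<Sum>r\<le>N. e r * (y - lam n) ^ r) * bump L ((y - lam n) / \<tau>))
          = a n * (\<Sum>r\<le>N. of_real (e r * \<tau> ^ r) * of_real (\<beta> r ((y - lam n) / \<tau>)))"
        by (simp only: of_real_sum of_real_mult)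
      also have "\<dots> = (\<Sum>r\<le>N. of_real (e r * \<tau> ^ r) * (a n * of_real (\<beta> r ((y - lam n) / \<tau>))))"
        unfolding sum_distrib_left by (intro sum.cong refl) (simp only: mult_ac)
      finally show "a n * of_real ((\<Sum>r\<le>N. e r * (y - lam n) ^ r) * bump L ((y - lam n) / \<tau>))
          = (\<Sum>r\<le>N. of_real (e r * \<tau> ^ r) * (a n * of_real (\<beta> r ((y - lam n) / \<tau>))))" .
    qed
    also have "\<dots> = (\<Sum>r\<le>N. \<Sum>n | lam n \<le> y + \<tau>. of_real (e r * \<tau> ^ r) * (a n * of_real (\<beta> r ((y - lam n) / \<tau>))))"
      by (rule sum.swap)
    also have "\<dots> = (\<Sum>r\<le>N. of_real (e r * \<tau> ^ r) * ?T r)"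
      by (simp only: sum_distrib_left)
    also have "norm \<dots> \<le> (\<Sum>r\<le>N. A * (C r * 2 powr k * exp \<kappa>) * exp (- \<kappa> * y))"
    proof (rule sum_norm_le)
      fix r assume "r \<in> {..N}"
      then have r: "r \<le> N" by simp
      have er: "norm (complex_of_real (e r * \<tau> ^ r)) \<le> A * \<tau> powr k"
      proof -
        have "\<bar>e r\<bar> * \<tau> ^ r \<le> A * \<tau> powr (k - real r) * \<tau> ^ r"
          using e[OF r] \<tau> by (intro mult_right_mono) auto
        also have "\<dots> = A * \<tau> powr k"
          using \<tau> by (simp add: powr_realpow[symmetric] mult.assoc flip: powr_add)
        finally show ?thesis using \<tau> by (simp add: norm_mult norm_power)
      qed
      have "norm (?T r) \<le> C r * (1 + 1 / \<tau>) powr k * exp (- \<kappa> * y + 1 * \<bar>- \<kappa>\<bar> * \<tau>)"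
      proof (rule C(2)[OF \<tau>(1)])
        fix v assume v: "y + \<tau> < v"
        have "(y - v) / \<tau> < - 1" using v \<tau> by (simp add: pos_divide_less_eq)
        then show "\<beta> r ((y - v) / \<tau>) = 0" by (intro supp) linarith
      qed
      also have "\<dots> \<le> C r * (2 * (1 / \<tau>)) powr k * (exp \<kappa> * exp (- \<kappa> * y))"
      proof (intro mult_mono mult_left_mono powr_mono2 k C)
        show "1 + 1 / \<tau> \<le> 2 * (1 / \<tau>)" using \<tau> by (simp add: field_simps)
        have "\<kappa> * \<tau> \<le> \<kappa>" using \<tau> \<kappa> by (simp add: mult_left_le)
        then show "exp (- \<kappa> * y + 1 * \<bar>- \<kappa>\<bar> * \<tau>) \<le> exp \<kappa> * exp (- \<kappa> * y)"
          using \<kappa> by (simp add: mult_exp_exp)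
      qed (use \<tau> C in auto)
      finally have T: "norm (?T r) \<le> C r * (2 * (1 / \<tau>)) powr k * (exp \<kappa> * exp (- \<kappa> * y))" .
      have "norm (of_real (e r * \<tau> ^ r) * ?T r) \<le> A * \<tau> powr k * (C r * (2 * (1 / \<tau>)) powr k * (exp \<kappa> * exp (- \<kappa> * y)))"
        unfolding norm_mult[of "of_real (e r * \<tau> ^ r)"] using A by (intro mult_mono er T) auto
      also have "\<dots> = A * (C r * (\<tau> powr k * (2 * (1 / \<tau>)) powr k) * exp \<kappa>) * exp (- \<kappa> * y)"
        by (simp only: mult_ac)
      also have "\<tau> powr k * (2 * (1 / \<tau>)) powr k = 2 powr k"
        using \<tau> by (simp add: powr_mult[symmetric])
      finally show "norm (of_real (e r * \<tau> ^ r) * ?T r) \<le> A * (C r * 2 powr k * exp \<kappa>) * exp (- \<kappa> * y)" .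
    qed
    also have "\<dots> = A * C' * exp (- \<kappa> * y)" by (simp add: C'_def sum_distrib_left sum_distrib_right mult.assoc)
    finally show ?thesis .
  qed
  moreover have "C' \<ge> 0" unfolding C'_def using C(1) by (intro sum_nonneg) auto
  ultimately show ?thesis by (intro exI[of _ C']) auto
qed

lemma cut_eq_trunc_powr:
  assumes "0 < h" "lam n \<le> x - 2 * h"
  shows "cut x h n = trunc_powr k (x - lam n)"
proof -
  have "(x - lam n) / h \<ge> 2" using assms by (simp add: pos_le_divide_eq)
  then show ?thesis by (simp add: cut_def smooth_step_eq_1)
qed

lemma cut_eq_0:
  assumes "0 < h" "x - h \<le> lam n"
  shows "cut x h n = 0"
proof -
  have "(x - lam n) / h \<le> 1" using assms by (simp add: pos_divide_le_eq)
  then show ?thesis by (simp add: cut_def smooth_step_eq_0)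
qed

text \<open>
  The part of the Riesz kernel near its endpoint. The condition on \<open>p\<close> is what the gap condition
  supplies for frequencies within \<open>2 \<tau>\<close> of \<open>x\<close>; that \<open>lam m\<close> exceeds
  \<open>lam p\<close> by \<open>4 \<tau>\<close> places \<open>lam m\<close> beyond \<open>x\<close> and beyond
  all kernels that occur. Two cutting scales are needed, because a frequency close to \<open>x - \<tau>\<close>
  leaves no gap there in which the kernel could be changed freely.
\<close>

lemma tail_bound:
  "\<exists>C\<ge>0. \<forall>x \<tau> B. 0 < \<tau> \<longrightarrow> \<tau> \<le> 1 \<longrightarrow> 0 \<le> B \<longrightarrow>
    (\<forall>p. lam p \<le> x \<longrightarrow> x - 2 * \<tau> \<le> lam p \<longrightarrow>
       (\<exists>m>p. lam p + 4 * \<tau> \<le> lam m \<and> gap_sum p m \<le> B)) \<longrightarrow>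
    (\<exists>\<tau>'\<in>{\<tau>, \<tau> / 4}. norm (kernel_sum x (\<lambda>n. trunc_powr k (x - lam n) - cut x \<tau>' n)) \<le> C * (1 + B) powr (k + 1) * exp (- \<kappa> * x))"
proof -
  define N where "N = nat \<lfloor>k\<rfloor>"
  obtain C1 where C1: "C1 \<ge> 0" and err: "\<And>p m B D (g :: nat \<Rightarrow> real). 0 \<le> B \<Longrightarrow> 0 \<le> D \<Longrightarrow> gap_sum p m \<le> B \<Longrightarrow>
     (\<And>n. n \<in> {p<..<m} \<Longrightarrow> \<bar>g n\<bar> \<le> D * (lam n - lam p) powr k) \<Longrightarrow>
     (\<Sum>n\<in>{p<..<m}. norm (a n * of_real (g n))) \<le> D * C1 * (1 + B) powr (k + 1) * exp (- \<kappa> * lam p)"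
    using cluster_error_bound by (auto simp: Ball_def)
  obtain A where A: "A \<ge> 0" and taylor: "\<And>d \<tau>. 0 \<le> d \<Longrightarrow> d \<le> \<tau> \<Longrightarrow> 0 < \<tau> \<Longrightarrow>
    (\<exists>e. (\<forall>r\<le>N. \<bar>e r\<bar> \<le> A * \<tau> powr (k - real r)) \<and> e 0 = trunc_powr k d \<and>
      (\<forall>u>0. \<bar>trunc_powr k (d - u) - (\<Sum>r\<le>N. e r * (- u) ^ r)\<bar> \<le> A * u powr k))"
    using trunc_powr_taylor[OF k N_def] by blast
  obtain C2 where C2: "C2 \<ge> 0" and poly: "\<And>y \<tau> A e. 0 < \<tau> \<Longrightarrow> \<tau> \<le> 1 \<Longrightarrow> 0 \<le> A \<Longrightarrow> (\<forall>r\<le>N. \<bar>e r\<bar> \<le> A * \<tau> powr (k - real r)) \<Longrightarrow>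
     norm (kernel_sum (y + \<tau>) (\<lambda>n. (\<Sum>r\<le>N. e r * (y - lam n) ^ r) * bump L ((y - lam n) / \<tau>)))
       \<le> A * C2 * exp (- \<kappa> * y)"
    using polynomial_bump_bound[of N] by blast
  define D where "D = A + 2 powr k * (1 + real (N + 1) * A)"
  have D: "0 \<le> D" "A \<le> D" "2 powr k * (1 + real (N + 1) * A) \<le> D" using A by (auto simp: D_def)
  define C where "C = (C1 + (A * C2 + D * C1)) * exp (2 * \<kappa>)"
  have C: "C \<ge> 0" using A C1 C2 D by (simp add: C_def)
  have "\<exists>\<tau>'\<in>{\<tau>, \<tau> / 4}. norm (kernel_sum x (\<lambda>n. trunc_powr k (x - lam n) - cut x \<tau>' n)) \<le> C * (1 + B) powr (k + 1) * exp (- \<kappa> * x)"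
    if \<tau>: "0 < \<tau>" "\<tau> \<le> 1" and B: "0 \<le> B"
      and cond: "\<And>p. lam p \<le> x \<Longrightarrow> x - 2 * \<tau> \<le> lam p \<Longrightarrow>
       (\<exists>m>p. lam p + 4 * \<tau> \<le> lam m \<and> gap_sum p m \<le> B)" for x \<tau> B
  proof -
    have B1: "1 \<le> (1 + B) powr (k + 1)" using B k by (intro ge_one_powr_ge_zero) auto
    have ex: "exp (- \<kappa> * lam p) \<le> exp (2 * \<kappa>) * exp (- \<kappa> * x)" if "x - 2 * \<tau> \<le> lam p" for p
    proof -
      have "x - 2 \<le> lam p" using that \<tau> by linarith
      then have "\<kappa> * (x - 2) \<le> \<kappa> * lam p" using \<kappa> by (intro mult_left_mono) auto
      then show ?thesis by (simp add: mult_exp_exp algebra_simps)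
    qed
    have step: "norm S \<le> C * (1 + B) powr (k + 1) * exp (- \<kappa> * x)"
      if S: "norm S \<le> E * (1 + B) powr (k + 1) * exp (- \<kappa> * lam p)" and p: "x - 2 * \<tau> \<le> lam p"
        and E: "0 \<le> E" "E \<le> C1 + (A * C2 + D * C1)" for S :: complex and E p
    proof -
      have "norm S \<le> E * (1 + B) powr (k + 1) * (exp (2 * \<kappa>) * exp (- \<kappa> * x))"
        by (rule order_trans[OF S mult_left_mono[OF ex[OF p]]]) (use E in simp)
      also have "\<dots> \<le> (C1 + (A * C2 + D * C1)) * (1 + B) powr (k + 1) * (exp (2 * \<kappa>) * exp (- \<kappa> * x))"
        using E by (intro mult_right_mono) auto
      finally show ?thesis by (simp only: C_def mult_ac)
    qed
    let ?F = "{n. lam n \<le> x}"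
    show ?thesis
    proof (cases "\<exists>p. x - 2 * \<tau> < lam p \<and> lam p < x - \<tau>")
      case True
      then obtain p where p: "x - 2 * \<tau> < lam p" "lam p < x - \<tau>" by blast
      obtain m where m: "m > p" "lam p + 4 * \<tau> \<le> lam m" "gap_sum p m \<le> B"
        using cond[of p] p \<tau> by auto
      \<comment> \<open>The kernel is cut between \<open>x - \<tau> / 2\<close> and \<open>x\<close>, where its values are at
        most \<open>(\<tau> / 2)\<^sup>k\<close> and \<open>lam n - lam p \<ge> \<tau> / 2\<close>.\<close>
      define g where "g = (\<lambda>n. if lam n \<le> x then trunc_powr k (x - lam n) - cut x (\<tau> / 4) n else 0)"
      have g0: "g n = 0" if "lam n \<le> x - \<tau> / 2" for n
        using cut_eq_trunc_powr[of "\<tau> / 4" n x] that \<tau> by (simp add: g_def)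
      have gle: "\<bar>g n\<bar> \<le> 1 * (lam n - lam p) powr k" for n
      proof (cases "lam n \<le> x - \<tau> / 2 \<or> x < lam n")
        case True then show ?thesis using g0[of n] by (auto simp: g_def)
      next
        case False
        have "\<bar>g n\<bar> \<le> trunc_powr k (x - lam n)"
          using False smooth_step_bounds[of L "(x - lam n) / (\<tau> / 4)"] trunc_powr_nonneg[of k "x - lam n"]
          by (auto simp: g_def cut_def abs_le_iff mult_left_le_one_le)
        also have "\<dots> \<le> (lam n - lam p) powr k"
          using False p \<tau> by (intro trunc_powr_le_powr k) linarith+
        finally show ?thesis by simp
      qed
      have nz: "n \<in> {p<..<m}" if "g n \<noteq> 0" for n
      proof -
        have "\<not> lam n \<le> x - \<tau> / 2" using that g0 by blast
        moreover have "lam n \<le> x" using that by (auto simp: g_def split: if_splits)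
        ultimately have "lam p < lam n" "lam n < lam m" using p m \<tau> by linarith+
        then show ?thesis using frequency_facts(4)[OF fr] by auto
      qed
      have "(\<Sum>n\<in>?F. a n * of_real (trunc_powr k (x - lam n) - cut x (\<tau> / 4) n)) = (\<Sum>n\<in>?F. a n * of_real (g n))"
        by (intro sum.cong refl) (simp add: g_def)
      also have "\<dots> = (\<Sum>n\<in>?F \<inter> {p<..<m}. a n * of_real (g n))"
        using nz frequency_facts(1)[OF fr] by (intro sum.mono_neutral_right) auto
      also have "norm \<dots> \<le> (\<Sum>n\<in>?F \<inter> {p<..<m}. norm (a n * of_real (g n)))" by (rule norm_sum)
      also have "\<dots> \<le> (\<Sum>n\<in>{p<..<m}. norm (a n * of_real (g n)))" by (intro sum_mono2) auto
      also have "\<dots> \<le> 1 * C1 * (1 + B) powr (k + 1) * exp (- \<kappa> * lam p)"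
        by (rule err[OF B _ m(3) gle]) simp
      finally have "norm (\<Sum>n\<in>?F. a n * of_real (trunc_powr k (x - lam n) - cut x (\<tau> / 4) n)) \<le> C * (1 + B) powr (k + 1) * exp (- \<kappa> * x)"
        by (rule step) (use p A C1 C2 D in auto)
      then show ?thesis by blast
    next
      case False
      \<comment> \<open>No frequency lies strictly between \<open>x - 2 \<tau>\<close> and \<open>x - \<tau>\<close>, so cutting
        in this gap is exact for all \<open>n < p\<close>.\<close>
      define p where "p = (LEAST n. x - \<tau> \<le> lam n)"
      have "\<exists>n. x - \<tau> \<le> lam n" using frequency_facts(6)[OF fr, of "x - \<tau>"] less_imp_le by blast
      then have p: "x - \<tau> \<le> lam p" unfolding p_def by (rule LeastI_ex)
      have below: "lam n \<le> x - 2 * \<tau>" if "n < p" for n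
      proof -
        have "\<not> x - \<tau> \<le> lam n" using not_less_Least that unfolding p_def by blast
        then show ?thesis using False by (meson not_le)
      qed
      define g where "g = (\<lambda>n. if n < p then 0 else trunc_powr k (x - lam n))"
      have geq: "trunc_powr k (x - lam n) - cut x \<tau> n = g n" for n
      proof (cases "n < p")
        case True
        then show ?thesis using cut_eq_trunc_powr[OF \<tau>(1) below[OF True]] by (simp add: g_def)
      next
        case F: False
        then have "x - \<tau> \<le> lam n" using p frequency_facts(5)[OF fr, of p n] by simp
        then show ?thesis using cut_eq_0[OF \<tau>(1)] F by (simp add: g_def)
      qed
      have "norm (\<Sum>n\<in>?F. a n * of_real (g n)) \<le> C * (1 + B) powr (k + 1) * exp (- \<kappa> * x)"
      proof (cases "lam p \<le> x")
        case False
        have "n < p" if "lam n \<le> x" for n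
          using that False frequency_facts(5)[OF fr, of p n] by linarith
        then have "(\<Sum>n\<in>?F. a n * of_real (g n)) = 0" by (intro sum.neutral) (simp add: g_def)
        then show ?thesis using C by simp
      next
        case px: True
        obtain m where m: "m > p" "lam p + 4 * \<tau> \<le> lam m" "gap_sum p m \<le> B"
          using cond[of p] px p \<tau> by auto
        have d: "0 \<le> x - lam p" "x - lam p \<le> \<tau>" using px p by auto
        obtain e where e: "\<And>r. r \<le> N \<Longrightarrow> \<bar>e r\<bar> \<le> A * \<tau> powr (k - real r)" "e 0 = trunc_powr k (x - lam p)"
          "\<And>u. u > 0 \<Longrightarrow> \<bar>trunc_powr k (x - lam p - u) - (\<Sum>r\<le>N. e r * (- u) ^ r)\<bar> \<le> A * u powr k"
          using taylor[OF d \<tau>(1)] by blast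
        define G where "G = {n. lam n \<le> lam p + \<tau>}"
        have finG: "finite G" unfolding G_def by (rule frequency_facts(1)[OF fr])
        \<comment> \<open>The replacement for the kernel to the right of the gap; it vanishes at all frequencies below \<open>lam
          p\<close> and agrees with the Riesz kernel at \<open>lam p\<close>.\<close>
        define K where "K = (\<lambda>n. (\<Sum>r\<le>N. e r * (lam p - lam n) ^ r) * bump L ((lam p - lam n) / \<tau>))"
        have S2: "norm (\<Sum>n\<in>G. a n * of_real (K n)) \<le> A * C2 * exp (- \<kappa> * lam p)"
          unfolding G_def K_def by (rule poly) (use \<tau> A e(1) in auto)
        have "(\<Sum>n\<in>?F. a n * of_real (g n)) = (\<Sum>n\<in>G. a n * of_real (g n))"
        proof (rule sum.mono_neutral_left[OF finG])
          show "?F \<subseteq> G" using p by (auto simp: G_def)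
          show "\<forall>n\<in>G - ?F. a n * of_real (g n) = 0" by (auto simp: g_def trunc_powr_def)
        qed
        also have "\<dots> = (\<Sum>n\<in>G. a n * of_real (K n)) + (\<Sum>n\<in>G. a n * of_real (g n - K n))"
          by (simp add: sum.distrib[symmetric] algebra_simps)
        also have "norm \<dots> \<le> A * C2 * exp (- \<kappa> * lam p) + D * C1 * (1 + B) powr (k + 1) * exp (- \<kappa> * lam p)"
        proof (rule order_trans[OF norm_triangle_ineq add_mono[OF S2]])
          have z: "g n - K n = 0" if "n \<le> p" for n
          proof (cases "n = p")
            case True
            have "(\<Sum>r\<le>N. e r * 0 ^ r) = e 0" by (simp add: power_0_left sum.delta if_distrib cong: if_cong)
            then show ?thesis using True e(2) by (simp add: g_def K_def bump_eq_1)
          next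
            case False
            then have "n < p" using that by simp
            then have "(lam p - lam n) / \<tau> \<ge> 1" using below[of n] p \<tau> by (simp add: pos_le_divide_eq)
            then have "bump L ((lam p - lam n) / \<tau>) = 0" by (intro bump_eq_0) linarith
            then show ?thesis using \<open>n < p\<close> by (simp add: g_def K_def)
          qed
          have nz: "n \<in> {p<..<m}" if "n \<in> G" "g n - K n \<noteq> 0" for n
          proof -
            have "p < n" using z[of n] that(2) not_le by blast
            moreover have "lam n < lam m" using that(1) m \<tau> by (simp add: G_def)
            ultimately show ?thesis using frequency_facts(4)[OF fr] by auto
          qed
          define g' where "g' = (\<lambda>n. if n \<in> G then g n - K n else 0)"
          have gle: "\<bar>g' n\<bar> \<le> D * (lam n - lam p) powr k" if n: "n \<in> {p<..<m}" for n
          proof (cases "n \<in> G")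
            case nG: True
            define u where "u = lam n - lam p"
            have u: "0 < u" "u \<le> \<tau>" using n nG frequency_facts(3)[OF fr, of p n] by (auto simp: u_def G_def)
            have g'eq: "g' n = trunc_powr k (x - lam p - u) - (\<Sum>r\<le>N. e r * (- u) ^ r) * bump L (- u / \<tau>)"
              using n nG by (simp add: g'_def g_def K_def u_def)
            show ?thesis
            \<comment> \<open>Where the bump equals 1 this is the Taylor estimate; elsewhere \<open>u\<close> is comparable to
              \<open>\<tau>\<close> and both terms are \<open>O (\<tau>\<^sup>k)\<close>.\<close>
            proof (cases "u \<le> \<tau> / 2")
              case True
              then have "bump L (- u / \<tau>) = 1" using u \<tau> by (intro bump_eq_1) (simp add: pos_divide_le_eq)
              then have "\<bar>g' n\<bar> \<le> A * u powr k" using e(3)[OF u(1)] by (simp add: g'eq)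
              also have "\<dots> \<le> D * u powr k" using D by (intro mult_right_mono) auto
              finally show ?thesis by (simp add: u_def)
            next
              case False
              have 1: "trunc_powr k (x - lam p - u) \<le> (2 * u) powr k"
                using False d u by (intro trunc_powr_le_powr k) auto
              have "\<bar>\<Sum>r\<le>N. e r * (- u) ^ r\<bar> \<le> (\<Sum>r\<le>N. A * (2 * u) powr k)"
              proof (rule order_trans[OF sum_abs sum_mono])
                fix r assume "r \<in> {..N}"
                then have r: "r \<le> N" "real r \<le> k" using k by (auto simp: N_def) linarith
                have "\<bar>e r * (- u) ^ r\<bar> \<le> A * \<tau> powr (k - real r) * u ^ r"
                  using e(1)[OF r(1)] u by (simp add: abs_mult power_abs mult_right_mono)
                also have "\<dots> \<le> A * (2 * u) powr (k - real r) * (2 * u) ^ r"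
                  using False u \<tau> A r by (intro mult_mono mult_left_mono powr_mono2 power_mono) auto
                also have "\<dots> = A * (2 * u) powr k"
                proof -
                  have pos: "0 < 2 * u" using u by simp
                  have "(2 * u) powr (k - real r) * (2 * u) ^ r = (2 * u) powr k"
                    unfolding powr_realpow[OF pos, symmetric] powr_add[symmetric] by simp
                  then show ?thesis by (simp only: mult.assoc)
                qed
                finally show "\<bar>e r * (- u) ^ r\<bar> \<le> A * (2 * u) powr k" .
              qed
              also have "\<dots> = real (N + 1) * A * (2 * u) powr k" by simp
              finally have 2: "\<bar>\<Sum>r\<le>N. e r * (- u) ^ r\<bar> \<le> real (N + 1) * A * (2 * u) powr k" .
              have "\<bar>(\<Sum>r\<le>N. e r * (- u) ^ r) * bump L (- u / \<tau>)\<bar> \<le> \<bar>\<Sum>r\<le>N. e r * (- u) ^ r\<bar> * 1"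
                unfolding abs_mult using bump_bounds[of L "- u / \<tau>"] by (intro mult_left_mono) auto
              then have "\<bar>g' n\<bar> \<le> (2 * u) powr k + real (N + 1) * A * (2 * u) powr k"
                unfolding g'eq using 1 2 trunc_powr_nonneg[of k "x - lam p - u"] by linarith
              also have "\<dots> = 2 powr k * (1 + real (N + 1) * A) * u powr k" by (simp add: powr_mult algebra_simps)
              also have "\<dots> \<le> D * u powr k" using D by (intro mult_right_mono) auto
              finally show ?thesis by (simp add: u_def)
            qed
          qed (use D in \<open>simp add: g'_def\<close>)
          have "(\<Sum>n\<in>G. a n * of_real (g n - K n)) = (\<Sum>n\<in>G \<inter> {p<..<m}. a n * of_real (g n - K n))"
            using nz finG by (intro sum.mono_neutral_right) auto
          also have "\<dots> = (\<Sum>n\<in>G \<inter> {p<..<m}. a n * of_real (g' n))"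
            by (intro sum.cong refl) (simp add: g'_def)
          also have "norm \<dots> \<le> (\<Sum>n\<in>G \<inter> {p<..<m}. norm (a n * of_real (g' n)))" by (rule norm_sum)
          also have "\<dots> \<le> (\<Sum>n\<in>{p<..<m}. norm (a n * of_real (g' n)))" by (intro sum_mono2) auto
          also have "\<dots> \<le> D * C1 * (1 + B) powr (k + 1) * exp (- \<kappa> * lam p)"
            by (rule err[OF B D(1) m(3) gle])
          finally show "norm (\<Sum>n\<in>G. a n * of_real (g n - K n)) \<le> D * C1 * (1 + B) powr (k + 1) * exp (- \<kappa> * lam p)" .
        qed
        also have "\<dots> \<le> (A * C2 + D * C1) * (1 + B) powr (k + 1) * exp (- \<kappa> * lam p)"
        proof -
          have "A * C2 * 1 \<le> A * C2 * (1 + B) powr (k + 1)" using A C2 B1 by (intro mult_left_mono) auto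
          then have "A * C2 * exp (- \<kappa> * lam p) \<le> A * C2 * (1 + B) powr (k + 1) * exp (- \<kappa> * lam p)"
            by (intro mult_right_mono) auto
          then show ?thesis by (simp only: distrib_right)
        qed
        finally show ?thesis by (rule step) (use p \<tau> A C1 C2 D in auto)
      qed
      then show ?thesis by (simp only: geq[symmetric] bex_simps) blast
    qed
  qed
  then show ?thesis using C by blast
qed
end


section \<open>Summability\<close>

context riesz_extension_left
begin

text \<open>
  The Riesz mean is the smoothly cut mean, which converges to \<open>f 0\<close>, plus dyadic pieces and a tail.
  With \<open>B = c exp (\<delta> x)\<close> the tail costs a power \<open>(1 + B)\<^bsup>k+1\<^esup>\<close>
  and the dyadic pieces about \<open>B + x\<close> terms; for small \<open>\<delta>\<close> both lose against
  the factor \<open>exp (- \<kappa> x / 2)\<close>.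
\<close>

lemma riesz_mean_limit_of_gaps:
  assumes gaps: "\<forall>\<delta>>0. \<exists>C>0. \<forall>n. \<exists>m>n.
           ln (lam m / (lam m - lam n)) + (\<Sum>j\<in>{n<..<m}. (lam j - lam n) / freq_gap lam j)
             \<le> C * exp (\<delta> * lam n)"
  shows "((\<lambda>x. riesz_mean lam k a x 0) \<longlongrightarrow> f 0) at_top"
proof -
  define \<delta> where "\<delta> = \<kappa> / (4 * (k + 1))"
  have \<delta>: "0 < \<delta>" "\<delta> * (k + 1) = \<kappa> / 4" "\<delta> \<le> \<kappa> / 4"
    using \<kappa> k by (auto simp: \<delta>_def field_simps)
  obtain c where c: "c > 0" "\<And>n. \<exists>m>n. ln (lam m / (lam m - lam n)) + (\<Sum>j\<in>{n<..<m}. (lam j - lam n) / freq_gap lam j)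
             \<le> c * exp (\<delta> * lam n)"
    using gaps \<delta>(1) by blast
  obtain Ct where Ct: "Ct \<ge> 0" and tail: "\<And>x \<tau> B. 0 < \<tau> \<Longrightarrow> \<tau> \<le> 1 \<Longrightarrow> 0 \<le> B \<Longrightarrow>
    (\<forall>p. lam p \<le> x \<longrightarrow> x - 2 * \<tau> \<le> lam p \<longrightarrow>
       (\<exists>m>p. lam p + 4 * \<tau> \<le> lam m \<and> gap_sum p m \<le> B)) \<Longrightarrow>
    (\<exists>\<tau>'\<in>{\<tau>, \<tau> / 4}. norm (kernel_sum x (\<lambda>n. trunc_powr k (x - lam n) - cut x \<tau>' n)) \<le> Ct * (1 + B) powr (k + 1) * exp (- \<kappa> * x))"
    using tail_bound by blast
  obtain Cd where Cd: "Cd \<ge> 0" and dyadic: "\<And>x J. 0 < x \<Longrightarrow> norm (kernel_sum x (cut x (x / 8 / 2 ^ J)) - kernel_sum x (cut x (x / 8)))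
     \<le> Cd * real J * (1 + x) powr k * exp (- \<kappa> * x / 2)"
    using dyadic_bound by blast
  let ?S = "\<lambda>x h. \<Sum>n | lam n \<le> x. a n * complex_of_real (cut x h n)"
  define E where "E = (\<lambda>x. Ct * (1 + c) powr (k + 1) * exp (- \<kappa> * x * (3/4))
      + Cd * ((c + x) / ln 2 + 3) * (1 + x) powr k * exp (- \<kappa> * x / 4))"
  have key: "norm (riesz_mean lam k a x 0 - ?S x (x / 8) / of_real (x powr k)) \<le> E x" if x: "x \<ge> 3" for x
  proof -
    define B where "B = c * exp (\<delta> * x)"
    have B: "B > 0" using c by (simp add: B_def)
    \<comment> \<open>Large enough for \<open>2\<^sup>J \<ge> exp (B + x)\<close>, which makes \<open>8 \<tau> \<le> exp (-
      B)\<close>.\<close>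
    define J where "J = nat \<lceil>(B + x) / ln 2\<rceil>"
    have J1: "(B + x) / ln 2 \<le> real J" unfolding J_def by linarith
    have "0 \<le> (B + x) / ln 2" using B x by simp
    then have J2: "real J \<le> (B + x) / ln 2 + 1" unfolding J_def by linarith
    have "exp (B + x) \<le> exp (real J * ln 2)" using J1 by (simp add: pos_divide_le_eq)
    also have "\<dots> = 2 ^ J" by (simp add: exp_of_nat_mult)
    finally have J3: "exp B * exp x \<le> 2 ^ J" by (simp add: exp_add)
    define \<tau> where "\<tau> = x / 8 / 2 ^ J"
    have \<tau>0: "0 < \<tau>" using x by (simp add: \<tau>_def)
    have \<tau>B: "8 * \<tau> \<le> exp (- B)"
    proof -
      have "x \<le> exp x" using exp_ge_add_one_self[of x] by linarith
      then have "exp B * x \<le> 2 ^ J" using J3 by (meson exp_ge_zero mult_left_mono order_trans)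
      then have "x / 2 ^ J \<le> 1 / exp B" by (simp add: field_simps)
      moreover have "8 * \<tau> = x / 2 ^ J" by (simp add: \<tau>_def)
      moreover have "exp (- B) = 1 / exp B" by (simp add: exp_minus inverse_eq_divide)
      ultimately show ?thesis by (simp only:)
    qed
    moreover have "exp (- B) \<le> 1" using B by simp
    ultimately have \<tau>1: "\<tau> \<le> 1" by linarith
    have cond: "\<exists>m>p. lam p + 4 * \<tau> \<le> lam m \<and> gap_sum p m \<le> B"
      if p: "lam p \<le> x" "x - 2 * \<tau> \<le> lam p" for p
    proof -
      obtain m where m: "m > p" "ln (lam m / (lam m - lam p)) + gap_sum p m \<le> c * exp (\<delta> * lam p)"
        using c(2) by blast
      have "c * exp (\<delta> * lam p) \<le> B" using p c(1) \<delta>(1) by (simp add: B_def)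
      with m(2) have sum: "ln (lam m / (lam m - lam p)) + gap_sum p m \<le> B" by linarith
      have lp: "lam p \<ge> 1" using p \<tau>1 x by linarith
      have pm: "lam p < lam m" using frequency_facts(3)[OF fr m(1)] .
      have nn: "0 \<le> gap_sum p m"
        using freq_gap_facts(1)[OF fr] frequency_facts(3)[OF fr] by (intro sum_nonneg divide_nonneg_pos) (auto intro: less_imp_le)
      have r: "1 \<le> lam m / (lam m - lam p)" using pm lp by simp
      have "0 \<le> ln (lam m / (lam m - lam p))" using r by simp
      then have "gap_sum p m \<le> B" using sum by linarith
      moreover have "lam p + 4 * \<tau> \<le> lam m"
      proof -
        \<comment> \<open>The logarithmic term keeps \<open>lam m - lam p\<close> above \<open>lam m * exp (- B)\<close>, and
          \<open>lam m \<ge> 1\<close>.\<close>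
        have "ln (lam m / (lam m - lam p)) \<le> B" using sum nn by linarith
        then have "exp (ln (lam m / (lam m - lam p))) \<le> exp B" by simp
        then have "lam m / (lam m - lam p) \<le> exp B" using r by (subst (asm) exp_ln) linarith+
        then have "lam m * exp (- B) \<le> lam m - lam p" using pm by (simp add: pos_divide_le_eq exp_minus field_simps)
        moreover have "1 * exp (- B) \<le> lam m * exp (- B)" using lp pm by (intro mult_right_mono) auto
        ultimately show ?thesis using \<tau>B \<tau>0 by linarith
      qed
      ultimately show ?thesis using m(1) by blast
    qed
    obtain \<tau>' where \<tau>': "\<tau>' \<in> {\<tau>, \<tau> / 4}" and
      1: "norm (kernel_sum x (\<lambda>n. trunc_powr k (x - lam n) - cut x \<tau>' n)) \<le> Ct * (1 + B) powr (k + 1) * exp (- \<kappa> * x)"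
      using tail[OF \<tau>0 \<tau>1 less_imp_le[OF B], of x] cond by blast
    obtain J' where J': "\<tau>' = x / 8 / 2 ^ J'" "J' \<le> J + 2"
    proof (cases "\<tau>' = \<tau>")
      case True then show ?thesis using that[of J] by (simp add: \<tau>_def)
    next
      case False
      then have "\<tau>' = x / 8 / 2 ^ (J + 2)" using \<tau>' by (simp add: \<tau>_def power_add)
      then show ?thesis using that by blast
    qed
    have "norm (?S x \<tau>' - ?S x (x / 8)) \<le> Cd * real J' * (1 + x) powr k * exp (- \<kappa> * x / 2)"
      unfolding J'(1) by (rule dyadic) (use x in simp)
    also have "\<dots> \<le> Cd * ((B + x) / ln 2 + 3) * (1 + x) powr k * exp (- \<kappa> * x / 2)"
      using J'(2) J2 Cd by (intro mult_right_mono mult_left_mono) auto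
    finally have 2: "norm (?S x \<tau>' - ?S x (x / 8)) \<le> Cd * ((B + x) / ln 2 + 3) * (1 + x) powr k * exp (- \<kappa> * x / 2)" .
    have "riesz_mean lam k a x 0 = kernel_sum x (\<lambda>n. trunc_powr k (x - lam n)) / of_real (x powr k)"
      unfolding riesz_mean_def sum_divide_distrib
    proof (intro sum.cong refl)
      fix n assume "n \<in> {n. lam n \<le> x}"
      then have n: "lam n \<le> x" by simp
      have "riesz_weight lam k x n = trunc_powr k (x - lam n) / x powr k"
      proof (cases "k = 0")
        case False
        have "1 - lam n / x = (x - lam n) / x" using x by (simp add: field_simps)
        then show ?thesis using False n x by (simp add: riesz_weight_def trunc_powr_def powr_divide)
      qed (use n x in \<open>simp add: riesz_weight_def trunc_powr_def\<close>)
      then show "a n * of_real (riesz_weight lam k x n) * exp (- of_real (lam n) * 0) = a n * of_real (trunc_powr k (x - lam n)) / of_real (x powr k)"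
        by simp
    qed
    then have split: "riesz_mean lam k a x 0 - ?S x (x / 8) / of_real (x powr k)
        = (kernel_sum x (\<lambda>n. trunc_powr k (x - lam n) - cut x \<tau>' n) + (?S x \<tau>' - ?S x (x / 8))) / of_real (x powr k)"
      by (simp add: diff_divide_distrib add_divide_distrib sum_subtractf right_diff_distrib)
    have shrink: "norm (z / of_real (x powr k)) \<le> norm z" for z :: complex
    proof -
      have "1 \<le> x powr k" using x k by (intro ge_one_powr_ge_zero) auto
      then have "norm z * 1 \<le> norm z * x powr k" by (intro mult_left_mono) auto
      then show ?thesis using x by (simp add: norm_divide pos_divide_le_eq)
    qed
    have "norm (riesz_mean lam k a x 0 - ?S x (x / 8) / of_real (x powr k)) \<le> Ct * (1 + B) powr (k + 1) * exp (- \<kappa> * x) + Cd * ((B + x) / ln 2 + 3) * (1 + x) powr k * exp (- \<kappa> * x / 2)"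
      unfolding split by (rule order_trans[OF shrink norm_triangle_mono[OF 1 2]])
    also have "\<dots> \<le> E x"
      unfolding E_def
    proof (rule add_mono)
      have "1 + B \<le> (1 + c) * exp (\<delta> * x)" using \<delta> x by (simp add: B_def distrib_right)
      then have "(1 + B) powr (k + 1) \<le> ((1 + c) * exp (\<delta> * x)) powr (k + 1)"
        using B k by (intro powr_mono2) auto
      also have "\<dots> = (1 + c) powr (k + 1) * exp (\<delta> * (k + 1) * x)"
        unfolding powr_mult using c by (simp add: exp_powr_real mult_ac)
      finally have "Ct * (1 + B) powr (k + 1) * exp (- \<kappa> * x) \<le> Ct * ((1 + c) powr (k + 1) * exp (\<kappa> / 4 * x)) * exp (- \<kappa> * x)"
        using Ct \<delta>(2) by (intro mult_right_mono mult_left_mono) auto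
      also have "\<dots> = Ct * (1 + c) powr (k + 1) * (exp (\<kappa> / 4 * x) * exp (- \<kappa> * x))" by (simp only: mult_ac)
      also have "exp (\<kappa> / 4 * x) * exp (- \<kappa> * x) = exp (- \<kappa> * x * (3/4))" by (simp add: mult_exp_exp)
      finally show "Ct * (1 + B) powr (k + 1) * exp (- \<kappa> * x) \<le> Ct * (1 + c) powr (k + 1) * exp (- \<kappa> * x * (3/4))" .
      have e1: "1 \<le> exp (\<kappa> / 4 * x)" using \<kappa> x by simp
      have "B \<le> c * exp (\<kappa> / 4 * x)" unfolding B_def using c \<delta>(3) x by (intro mult_left_mono) (auto intro!: mult_right_mono)
      moreover have "x \<le> x * exp (\<kappa> / 4 * x)" using mult_left_mono[OF e1, of x] x by simp
      ultimately have "B + x \<le> (c + x) * exp (\<kappa> / 4 * x)" by (simp add: distrib_right)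
      then have "(B + x) / ln 2 \<le> (c + x) * exp (\<kappa> / 4 * x) / ln 2" by (intro divide_right_mono) auto
      also have "\<dots> = (c + x) / ln 2 * exp (\<kappa> / 4 * x)" by simp
      finally have "(B + x) / ln 2 \<le> (c + x) / ln 2 * exp (\<kappa> / 4 * x)" .
      then have "(B + x) / ln 2 + 3 \<le> (c + x) / ln 2 * exp (\<kappa> / 4 * x) + 3 * exp (\<kappa> / 4 * x)" using e1 by linarith
      then have "(B + x) / ln 2 + 3 \<le> ((c + x) / ln 2 + 3) * exp (\<kappa> / 4 * x)" by (simp only: distrib_right)
      then have "Cd * ((B + x) / ln 2 + 3) * (1 + x) powr k * exp (- \<kappa> * x / 2)
          \<le> Cd * (((c + x) / ln 2 + 3) * exp (\<kappa> / 4 * x)) * (1 + x) powr k * exp (- \<kappa> * x / 2)"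
        using Cd by (intro mult_right_mono mult_left_mono) auto
      also have "\<dots> = Cd * ((c + x) / ln 2 + 3) * (1 + x) powr k * (exp (\<kappa> / 4 * x) * exp (- \<kappa> * x / 2))" by (simp only: mult_ac)
      also have "exp (\<kappa> / 4 * x) * exp (- \<kappa> * x / 2) = exp (- \<kappa> * x / 4)" by (simp add: mult_exp_exp)
      finally show "Cd * ((B + x) / ln 2 + 3) * (1 + x) powr k * exp (- \<kappa> * x / 2) \<le> Cd * ((c + x) / ln 2 + 3) * (1 + x) powr k * exp (- \<kappa> * x / 4)" .
    qed
    finally show ?thesis .
  qed
  have E0: "(E \<longlongrightarrow> 0) at_top"
  proof -
    have "((\<lambda>x. Ct * (1 + c) powr (k + 1) * exp (- \<kappa> * x * (3/4))) \<longlongrightarrow> 0) at_top"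
      using \<kappa>(1) by real_asymp
    moreover have "((\<lambda>x. Cd * ((c + x) / ln 2 + 3) * (1 + x) powr k * exp (- \<kappa> * x / 4)) \<longlongrightarrow> 0) at_top"
      using \<kappa>(1) by real_asymp
    ultimately show ?thesis unfolding E_def using tendsto_add by fastforce
  qed
  have "((\<lambda>x. riesz_mean lam k a x 0 - ?S x (x / 8) / of_real (x powr k)) \<longlongrightarrow> 0) at_top"
    by (rule Lim_null_comparison[OF _ E0]) (use eventually_ge_at_top[of 3] in eventually_elim, use key in auto)
  from tendsto_add[OF this smooth_cut_limit] show ?thesis by simp
qed
end

lemma riesz_mean_translate:
  "riesz_mean lam l (\<lambda>n. a n * exp (- of_real (lam n) * s0)) x s = riesz_mean lam l a x (s0 + s)"
  unfolding riesz_mean_def by (intro sum.cong refl) (simp add: mult_exp_exp algebra_simps)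

theorem theorem6p3:
  fixes lam :: "nat \<Rightarrow> real" and k :: real
  assumes "frequency lam"
    and "\<forall>\<delta>>0. \<exists>C>0. \<forall>n. \<exists>m>n.
           ln (lam m / (lam m - lam n)) + (\<Sum>j\<in>{n<..<m}. (lam j - lam n) / freq_gap lam j)
             \<le> C * exp (\<delta> * lam n)"
    and "0 \<le> k"
  shows "\<forall>a \<in> dirichlet_ext k lam.
           riesz_abscissa lam k a \<le> 0 \<and> (\<forall>s. 0 < Re s \<longrightarrow> riesz_summable lam k a s)"
proof
  fix a assume "a \<in> dirichlet_ext k lam"
  then obtain l f where l: "0 \<le> l" "riesz_abscissa lam l a < \<infinity>" and hol: "f holomorphic_on half_plane 0"
    and lim: "\<And>s. s \<in> half_plane (riesz_abscissa lam l a) \<inter> half_plane 0 \<Longrightarrow> ((\<lambda>x. riesz_mean lam l a x s) \<longlongrightarrow> f s) at_top"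
    and bdd: "bdd_above ((\<lambda>s. norm (f s) / (1 + norm s) powr k) ` half_plane 0)"
    unfolding dirichlet_ext_def by blast
  obtain r where r: "riesz_abscissa lam l a < ereal r"
    using less_PInf_Ex_of_nat l(2) by auto
  define \<sigma>1 where "\<sigma>1 = max r 0"
  have lim1: "((\<lambda>x. riesz_mean lam l a x s) \<longlongrightarrow> f s) at_top" if "\<sigma>1 < Re s" for s
    using that by (intro lim) (auto simp: half_plane_def \<sigma>1_def intro: less_trans[OF r])
  obtain M0 where M0: "\<And>s. s \<in> half_plane 0 \<Longrightarrow> norm (f s) / (1 + norm s) powr k \<le> M0"
    using bdd by (auto simp: bdd_above_def)
  define M where "M = max M0 0"
  have M: "norm (f s) \<le> M * (1 + norm s) powr k" if "0 < Re s" for s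
  proof -
    have "0 < 1 + norm s" by (simp add: add_pos_nonneg)
    then have pos: "0 < (1 + norm s) powr k" by simp
    have "norm (f s) / (1 + norm s) powr k \<le> M" using M0[of s] that by (auto simp: half_plane_def M_def)
    then show ?thesis using pos by (simp add: pos_divide_le_eq)
  qed
  have summable: "riesz_summable lam k a s0" if s0: "0 < Re s0" for s0
  proof -
    define L where "L = nat \<lceil>k + l\<rceil> + 7"
    interpret riesz_extension_left lam "\<lambda>n. a n * exp (- of_real (lam n) * s0)" "\<lambda>s. f (s0 + s)"
      "- Re s0" \<sigma>1 l "M * (1 + norm s0) powr k" k L "Re s0 / 2"
    proof
      show "frequency lam" "0 \<le> l" "0 \<le> k" "0 \<le> M * (1 + norm s0) powr k"
        using assms l by (auto simp: M_def)
      show "((\<lambda>x. riesz_mean lam l (\<lambda>n. a n * exp (- of_real (lam n) * s0)) x s) \<longlongrightarrow> f (s0 + s)) at_top" if "\<sigma>1 < Re s" for s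
        unfolding riesz_mean_translate using that s0 by (intro lim1) simp
      show "(\<lambda>s. f (s0 + s)) holomorphic_on {s. - Re s0 < Re s}"
      proof -
        have "(\<lambda>s. s0 + s) holomorphic_on {s. - Re s0 < Re s}" by (intro holomorphic_on_add holomorphic_on_const holomorphic_on_ident)
        moreover have "(\<lambda>s. s0 + s) ` {s. - Re s0 < Re s} \<subseteq> half_plane 0" by (auto simp: half_plane_def)
        ultimately show ?thesis using holomorphic_on_compose_gen[OF _ hol] by (fastforce simp: comp_def)
      qed
      show "norm (f (s0 + s)) \<le> M * (1 + norm s0) powr k * (1 + norm s) powr k" if "- Re s0 < Re s" for s
      proof -
        have "norm (f (s0 + s)) \<le> M * (1 + norm (s0 + s)) powr k" using that by (intro M) simp
        also have "\<dots> \<le> M * ((1 + norm s0) * (1 + norm s)) powr k"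
        proof (intro mult_left_mono powr_mono2 assms(3))
          have "0 \<le> norm s0 * norm s" by simp
          then show "1 + norm (s0 + s) \<le> (1 + norm s0) * (1 + norm s)"
            using norm_triangle_ineq[of s0 s] by (simp only: distrib_right distrib_left mult_1_left mult_1_right)
        qed (auto simp: M_def)
        also have "\<dots> = M * (1 + norm s0) powr k * (1 + norm s) powr k" by (simp add: powr_mult)
        finally show ?thesis .
      qed
      have "k + l + 7 \<le> real L" unfolding L_def by linarith
      then show "k + 2 \<le> real L" "l + 5 \<le> real L" using assms(3) l(1) by linarith+
      show "0 < Re s0 / 2" "- Re s0 < - (Re s0 / 2)" using s0 by auto
    qed
    have "((\<lambda>x. riesz_mean lam k a x s0) \<longlongrightarrow> f s0) at_top"
      using riesz_mean_limit_of_gaps[OF assms(2)] unfolding riesz_mean_translate by simp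
    then show ?thesis unfolding riesz_summable_def by blast
  qed
  have "riesz_abscissa lam k a \<le> ereal \<sigma>" if "0 < \<sigma>" for \<sigma>
    unfolding riesz_abscissa_def by (rule Inf_lower) (use summable[of "of_real \<sigma>"] that in auto)
  then have "riesz_abscissa lam k a \<le> 0"
    by - (rule ereal_le_epsilon2, simp)
  then show "riesz_abscissa lam k a \<le> 0 \<and> (\<forall>s. 0 < Re s \<longrightarrow> riesz_summable lam k a s)"
    using summable by blast
qed

end
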